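(* Let $\ell$ be a prime, $\mathfrak{r}$ a positive integer, $\mathfrak{q}=\ell^{\mathfrak{r}}>11$ and $n=\mathfrak{q}+1$. Let $B$ be an $n$-element set and $G$ a subgroup of $\mathrm{Perm}(B)$ that contains a subgroup $H$ isomorphic to $\mathbf{L}_2(\mathfrak{q})=\mathrm{PSL}(2,\mathbb{F}_{\mathfrak{q}})$. If $p$ is an odd prime, then the $G$-module $(\mathbb{F}_p^B)^{00}$ is central simple.
   Context: $\mathbb{F}_{\mathfrak{q}}$ is a field with $\mathfrak{q}$ elements. $\mathbb{F}_p^B$ is the space of maps $h:B\to\mathbb{F}_p$ with action $(sh)(b)=h(s^{-1}(b))$; $(\mathbb{F}_p^B)^0=\{h:\sum_b h(b)=0\}$; the heart $(\mathbb{F}_p^B)^{00}$ is $(\mathbb{F}_p^B)^0/(\mathbb{F}_p\cdot1_B)$ if $p\mid n$ ($1_B$ the constant function $1$) and $(\mathbb{F}_p^B)^0$ otherwise. For a group $G$ acting linearly on $V$, an $\mathbb{F}_p$-subalgebra $R\subset\mathrm{End}_{\mathbb{F}_p}(V)$ containing $\mathrm{Id}$ is $G$-normal if $gRg^{-1}\subset R$ for all $g\in G$; $V$ is central simple if every $G$-normal subalgebra is a central simple $\mathbb{F}_p$-algebra. *)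

theory Defs
  imports
    "HOL-Analysis.Determinants"
    "HOL-Number_Theory.Residues"
    "HOL-Algebra.Bij"
    "HOL-Algebra.QuotRing"
    "HOL-Algebra.Module"
    "HOL-Algebra.Subrings"
begin

section \<open>The groups \<open>SL(2, F)\<close> and \<open>PSL(2, F)\<close>\<close>

definition SL2 :: "('k::field^2^2) monoid" where
  "SL2 = \<lparr>carrier = {A. det A = 1}, mult = (**), one = mat 1\<rparr>"

definition group_center :: "('g, 'm) monoid_scheme \<Rightarrow> 'g set" where
  "group_center G = {z \<in> carrier G. \<forall>x\<in>carrier G. z \<otimes>\<^bsub>G\<^esub> x = x \<otimes>\<^bsub>G\<^esub> z}"

definition PSL2 :: "('k::field^2^2) set monoid" where
  "PSL2 = SL2 Mod (group_center SL2)"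


section \<open>Central simple algebras\<close>

text \<open>
  The record type \<open>module\<close> extends \<open>ring\<close> by a scalar multiplication, so it also carries
  (possibly non-commutative) algebras. The library locale \<open>algebra\<close> is not used, because it
  requires commutativity. A plain module leaves the fields \<open>mult\<close> and \<open>one\<close> unspecified.
\<close>

definition assoc_algebra :: "('k, 'm) ring_scheme \<Rightarrow> ('k, 'a, 'n) module_scheme \<Rightarrow> bool" where
  "assoc_algebra F A \<longleftrightarrow> ring A \<and> Module.module F A \<and>
     (\<forall>c\<in>carrier F. \<forall>x\<in>carrier A. \<forall>y\<in>carrier A.
        (c \<odot>\<^bsub>A\<^esub> x) \<otimes>\<^bsub>A\<^esub> y = c \<odot>\<^bsub>A\<^esub> (x \<otimes>\<^bsub>A\<^esub> y) \<and>
        x \<otimes>\<^bsub>A\<^esub> (c \<odot>\<^bsub>A\<^esub> y) = c \<odot>\<^bsub>A\<^esub> (x \<otimes>\<^bsub>A\<^esub> y))"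

definition finitely_spanned :: "('k, 'm) ring_scheme \<Rightarrow> ('k, 'a, 'n) module_scheme \<Rightarrow> bool" where
  "finitely_spanned F V \<longleftrightarrow>
     (\<exists>S. finite S \<and> S \<subseteq> carrier V \<and>
        (\<forall>x\<in>carrier V. \<exists>c\<in>S \<rightarrow> carrier F. x = (\<Oplus>\<^bsub>V\<^esub>s\<in>S. c s \<odot>\<^bsub>V\<^esub> s)))"

definition central_simple_algebra ::
    "('k, 'm) ring_scheme \<Rightarrow> ('k, 'a, 'n) module_scheme \<Rightarrow> bool" where
  "central_simple_algebra F A \<longleftrightarrow>
     field F \<and> assoc_algebra F A \<and> finitely_spanned F A \<and>
     carrier A \<noteq> {\<zero>\<^bsub>A\<^esub>} \<and>
     (\<forall>I. ideal I A \<longrightarrow> I = {\<zero>\<^bsub>A\<^esub>} \<or> I = carrier A) \<and>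
     group_center A = {c \<odot>\<^bsub>A\<^esub> \<one>\<^bsub>A\<^esub> |c. c \<in> carrier F}"


section \<open>Linear group actions and central simple modules\<close>

text \<open>
  Endomorphisms are extensional functions, so that equality in \<open>End_alg F V\<close> is equality of
  linear maps on the carrier of \<open>V\<close>.
\<close>

definition End_alg ::
    "('k, 'm) ring_scheme \<Rightarrow> ('k, 'v, 'n) module_scheme \<Rightarrow> ('k, 'v \<Rightarrow> 'v) module" where
  "End_alg F V =
     \<lparr>carrier = {f \<in> carrier V \<rightarrow>\<^sub>E carrier V.
        (\<forall>x\<in>carrier V. \<forall>y\<in>carrier V. f (x \<oplus>\<^bsub>V\<^esub> y) = f x \<oplus>\<^bsub>V\<^esub> f y) \<and>
        (\<forall>c\<in>carrier F. \<forall>x\<in>carrier V. f (c \<odot>\<^bsub>V\<^esub> x) = c \<odot>\<^bsub>V\<^esub> f x)},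
      mult = compose (carrier V),
      one = (\<lambda>x\<in>carrier V. x),
      zero = (\<lambda>x\<in>carrier V. \<zero>\<^bsub>V\<^esub>),
      add = (\<lambda>f g. \<lambda>x\<in>carrier V. f x \<oplus>\<^bsub>V\<^esub> g x),
      smult = (\<lambda>c f. \<lambda>x\<in>carrier V. c \<odot>\<^bsub>V\<^esub> f x)\<rparr>"

definition linear_rep ::
    "('k, 'm) ring_scheme \<Rightarrow> ('k, 'v, 'n) module_scheme \<Rightarrow> ('g, 'l) monoid_scheme \<Rightarrow>
     ('g \<Rightarrow> 'v \<Rightarrow> 'v) \<Rightarrow> bool" where
  "linear_rep F V G \<rho> \<longleftrightarrow>
     field F \<and> Module.module F V \<and> group G \<and> \<rho> \<in> hom G (units_of (End_alg F V))"

text \<open>\<open>subring\<close> includes that the identity endomorphism lies in \<open>R\<close>.\<close>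

definition G_normal_subalgebra ::
    "('k, 'm) ring_scheme \<Rightarrow> ('k, 'v, 'n) module_scheme \<Rightarrow> ('g, 'l) monoid_scheme \<Rightarrow>
     ('g \<Rightarrow> 'v \<Rightarrow> 'v) \<Rightarrow> ('v \<Rightarrow> 'v) set \<Rightarrow> bool" where
  "G_normal_subalgebra F V G \<rho> R \<longleftrightarrow>
     subring R (End_alg F V) \<and> submodule R F (End_alg F V) \<and>
     (\<forall>g\<in>carrier G. \<forall>u\<in>R.
        \<rho> g \<otimes>\<^bsub>End_alg F V\<^esub> u \<otimes>\<^bsub>End_alg F V\<^esub> inv\<^bsub>End_alg F V\<^esub> (\<rho> g) \<in> R)"

definition central_simple_module ::
    "('k, 'm) ring_scheme \<Rightarrow> ('k, 'v, 'n) module_scheme \<Rightarrow> ('g, 'l) monoid_scheme \<Rightarrow>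
     ('g \<Rightarrow> 'v \<Rightarrow> 'v) \<Rightarrow> bool" where
  "central_simple_module F V G \<rho> \<longleftrightarrow>
     linear_rep F V G \<rho> \<and>
     (\<forall>R. G_normal_subalgebra F V G \<rho> R \<longrightarrow>
        central_simple_algebra F ((End_alg F V)\<lparr>carrier := R\<rparr>))"


section \<open>Permutation modules and their hearts\<close>

definition quot_module ::
    "('k, 'v, 'n) module_scheme \<Rightarrow> 'v set \<Rightarrow> ('k, 'v set) module" where
  "quot_module V W =
     \<lparr>carrier = a_rcosets\<^bsub>V\<^esub> W, mult = undefined, one = undefined,
      zero = W, add = set_add V,
      smult = (\<lambda>c X. \<Union>x\<in>X. W +>\<^bsub>V\<^esub> (c \<odot>\<^bsub>V\<^esub> x))\<rparr>"

definition perm_module :: "('k, 'm) ring_scheme \<Rightarrow> 'b set \<Rightarrow> ('k, 'b \<Rightarrow> 'k) module" where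
  "perm_module F B =
     \<lparr>carrier = B \<rightarrow>\<^sub>E carrier F, mult = undefined, one = undefined,
      zero = (\<lambda>b\<in>B. \<zero>\<^bsub>F\<^esub>),
      add = (\<lambda>f g. \<lambda>b\<in>B. f b \<oplus>\<^bsub>F\<^esub> g b),
      smult = (\<lambda>c f. \<lambda>b\<in>B. c \<otimes>\<^bsub>F\<^esub> f b)\<rparr>"

definition zero_sum_module :: "('k, 'm) ring_scheme \<Rightarrow> 'b set \<Rightarrow> ('k, 'b \<Rightarrow> 'k) module" where
  "zero_sum_module F B =
     (perm_module F B)\<lparr>carrier :=
        {h \<in> carrier (perm_module F B). (\<Oplus>\<^bsub>F\<^esub>b\<in>B. h b) = \<zero>\<^bsub>F\<^esub>}\<rparr>"

definition const_maps :: "('k, 'm) ring_scheme \<Rightarrow> 'b set \<Rightarrow> ('b \<Rightarrow> 'k) set" where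
  "const_maps F B = {c \<odot>\<^bsub>perm_module F B\<^esub> (\<lambda>b\<in>B. \<one>\<^bsub>F\<^esub>) |c. c \<in> carrier F}"

definition perm_act :: "'b set \<Rightarrow> ('b \<Rightarrow> 'b) \<Rightarrow> ('b \<Rightarrow> 'k) \<Rightarrow> 'b \<Rightarrow> 'k" where
  "perm_act B s h = (\<lambda>b\<in>B. h ((inv\<^bsub>BijGroup B\<^esub> s) b))"

text \<open>
  The heart is \<open>heart_quotient F B\<close> if the characteristic of \<open>F\<close> divides \<open>card B\<close>, and
  \<open>zero_sum_module F B\<close> otherwise; the two live in different types. Only in the former case do
  the constant maps lie in \<open>zero_sum_module F B\<close>.
\<close>

definition heart_quotient :: "('k, 'm) ring_scheme \<Rightarrow> 'b set \<Rightarrow> ('k, ('b \<Rightarrow> 'k) set) module" where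
  "heart_quotient F B = quot_module (zero_sum_module F B) (const_maps F B)"

definition zero_sum_act ::
    "('k, 'm) ring_scheme \<Rightarrow> 'b set \<Rightarrow> ('b \<Rightarrow> 'b) \<Rightarrow> ('b \<Rightarrow> 'k) \<Rightarrow> 'b \<Rightarrow> 'k" where
  "zero_sum_act F B s = (\<lambda>h\<in>carrier (zero_sum_module F B). perm_act B s h)"

definition heart_quotient_act ::
    "('k, 'm) ring_scheme \<Rightarrow> 'b set \<Rightarrow> ('b \<Rightarrow> 'b) \<Rightarrow> ('b \<Rightarrow> 'k) set \<Rightarrow> ('b \<Rightarrow> 'k) set" where
  "heart_quotient_act F B s = (\<lambda>X\<in>carrier (heart_quotient F B). perm_act B s ` X)"

end

theory Submission
  imports Defs "HOL-Analysis.Convex" "HOL-Computational_Algebra.Polynomial"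
    "HOL-Algebra.Multiplicative_Group"
begin

text \<open>
  Two facts about \<open>SL(2, q)\<close> drive the proof. First, for \<open>q > 11\<close> every nontrivial transitive
  action has degree at least \<open>q + 1\<close>. If the degree \<open>N\<close> were at most \<open>q\<close>, counting fixed points
  of unipotent elements shows that the Borel subgroup is transitive, and Cauchy--Schwarz for the
  incidence matrix of the orbits of all conjugates of the unipotent group \<open>U\<close> bounds the number
  of fixed points so severely that \<open>U\<close> acts regularly. Then the points are the elements of the
  field, the Weyl element acts by \<open>x \<mapsto> c / x\<close> with \<open>c\<close> depending only on the square class of
  \<open>x\<close>, and the braid relation between it and \<open>U\<close> holds for too few \<open>x\<close>. It follows that the
  action on \<open>B\<close> is the action on the projective line.

  Second, the matrix coefficients of the heart separate tensors, which means absolute simplicity.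
  Only the case \<open>p dvd n\<close> is not immediate. There, vanishing of all coefficients forces the
  number of intersections of a hyperbola with the lines of a fixed direction to be constant
  modulo \<open>p\<close>, hence constant since it is at most \<open>2\<close> and \<open>p\<close> is odd; but its average is
  \<open>(q - 1) / q\<close>.

  Let \<open>R\<close> be a normal subalgebra. The conjugates of a minimal ideal \<open>I\<close> cut out independent
  nonzero subspaces of the heart, so there are at most \<open>q\<close> of them, and \<open>I\<close> is invariant by the
  first fact; by simplicity of the heart it annihilates no vector, whence \<open>R\<close> is simple. The
  centre of \<open>R\<close> is a finite field, whose automorphism group is abelian, so the perfect group
  \<open>SL(2, q)\<close> fixes the centre, and by absolute simplicity it consists of scalars.
\<close>

section \<open>Matrices of determinant one and their actions\<close>

text \<open>The bound 11 goes back to Galois: apart from the solvable q = 2, 3, the group PSL(2, q)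
  acts nontrivially on fewer than q + 1 points exactly for q = 5, 7, 11 (degree q) and q = 9 (degree
  6, as the alternating group A6). Counting replaces the classification of subgroups, so each
  exceptional action survives up to some estimate: A6 until orbits of three points are counted, q =
  5 until a single quadratic equation, 7 and 11 until the roots of eight quadratic equations are
  counted, one for each pattern of square classes.

  V being finite, cardinalities stand in for dimensions: a chain of annihilators, each at least
  \<open>card (carrier F)\<close> times larger than the one before, bounds the number of conjugate
  ideals. Simplicity of the heart alone would not make the centre scalar; endomorphisms commuting
  with the group have to be scalars over F itself, and this requires separating tensors of rank two.
  As the separation is integer counting modulo p, no distinction between p = l and p \<noteq> l
  arises.\<close>

definition mat2 :: "'k::field \<Rightarrow> 'k \<Rightarrow> 'k \<Rightarrow> 'k \<Rightarrow> 'k^2^2" where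
  "mat2 a b c d = vector [vector [a, b], vector [c, d]]"

lemma mat2_mult:
  "mat2 a b c d ** mat2 a' b' c' d' = mat2 (a*a' + b*c') (a*b' + b*d') (c*a' + d*c') (c*b' + d*d')"
  by (simp add: mat2_def matrix_matrix_mult_def vec_eq_iff forall_2 sum_2)

lemma det_mat2: "det (mat2 a b c d) = a*d - b*c"
  by (simp add: mat2_def det_2)

lemma mat_1_mat2: "mat 1 = mat2 1 0 0 1"
  by (simp add: mat2_def mat_def vec_eq_iff forall_2)

lemma mat2_cases: obtains a b c d where "A = mat2 a b c d"
proof
  show "A = mat2 (A$1$1) (A$1$2) (A$2$1) (A$2$2)"
    by (simp add: mat2_def vec_eq_iff forall_2)
qed

lemma mat2_eq_iff: "mat2 a b c d = mat2 a' b' c' d' \<longleftrightarrow> a = a' \<and> b = b' \<and> c = c' \<and> d = d'"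
  by (auto simp add: mat2_def vec_eq_iff forall_2)

definition upper :: "'k::field \<Rightarrow> 'k^2^2" where "upper a = mat2 1 a 0 1"
definition lower :: "'k::field \<Rightarrow> 'k^2^2" where "lower a = mat2 1 0 a 1"
definition weyl :: "'k::field^2^2" where "weyl = mat2 0 (-1) 1 0"
definition torus :: "'k::field \<Rightarrow> 'k^2^2" where "torus t = mat2 t 0 0 (1/t)"
definition neg_one :: "'k::field^2^2" where "neg_one = mat2 (-1) 0 0 (-1)"

lemmas SL2_defs = upper_def lower_def weyl_def torus_def neg_one_def mat_1_mat2

lemma det_SL2 [simp]:
  "det (upper a) = 1" "det (lower a) = 1" "det (weyl :: 'k::field^2^2) = 1"
  "det (neg_one :: 'k::field^2^2) = 1" "t \<noteq> 0 \<Longrightarrow> det (torus t) = 1"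
  by (simp_all add: SL2_defs det_mat2)

lemma det_mult_1 [simp]: "det A = 1 \<Longrightarrow> det B = 1 \<Longrightarrow> det (A ** B :: 'k::field^2^2) = 1"
  by (simp add: det_mul)

text \<open>Closure under products is enough, as the cube of \<open>weyl\<close> is its inverse. A
  matrix with c \<noteq> 0 is a product upper, lower, upper; the case c = 0 is reduced to it by one
  factor \<open>weyl\<close>.\<close>

lemma SL2_generated_weyl:
  fixes A :: "'k::field^2^2"
  assumes mult: "\<And>A B. det A = 1 \<Longrightarrow> det B = 1 \<Longrightarrow> P A \<Longrightarrow> P B \<Longrightarrow> P (A ** B)"
    and up: "\<And>a. P (upper a)" and w: "P weyl" and A: "det A = 1"
  shows "P A"
proof -
  have w3: "P (weyl ** (weyl ** weyl))"
    by (intro mult w det_SL2 det_mult_1)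
  have low: "P (lower a)" for a
  proof -
    have "lower a = weyl ** (upper (-a) ** (weyl ** (weyl ** weyl)))"
      by (simp add: SL2_defs mat2_mult)
    then show ?thesis
      using mult[OF _ _ w mult[OF _ _ up w3]] by simp
  qed
  have big: "P (mat2 a b c d)" if "a*d - b*c = 1" "c \<noteq> 0" for a b c d
  proof -
    have "mat2 a b c d = upper (a/c) ** (upper (-1/c) ** (lower c ** (upper (-1/c) ** upper (d/c))))"
      using that by (simp add: SL2_defs mat2_mult mat2_eq_iff field_simps)
    moreover have "P \<dots>"
      by (intro mult up low det_SL2 det_mult_1)
    ultimately show ?thesis by simp
  qed
  obtain a b c d where Aeq: "A = mat2 a b c d" by (rule mat2_cases)
  have det: "a*d - b*c = 1" using A by (simp add: Aeq det_mat2)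
  show ?thesis
  proof (cases "c = 0")
    case False
    then show ?thesis using big det Aeq by simp
  next
    case True
    then have d: "d \<noteq> 0" using det by auto
    have "A = mat2 (-b) a (-d) c ** weyl"
      by (simp add: Aeq SL2_defs mat2_mult)
    moreover have "P (mat2 (-b) a (-d) c)" using big[of "-b" c a "-d"] det d by (simp add: algebra_simps)
    moreover have "det (mat2 (-b) a (-d) c) = 1" using det by (simp add: det_mat2 algebra_simps)
    ultimately show ?thesis using mult w by simp
  qed
qed

lemma SL2_generated_lower:
  fixes A :: "'k::field^2^2"
  assumes mult: "\<And>A B. det A = 1 \<Longrightarrow> det B = 1 \<Longrightarrow> P A \<Longrightarrow> P B \<Longrightarrow> P (A ** B)"
    and up: "\<And>a. P (upper a)" and low: "\<And>a. P (lower a)" and A: "det A = 1"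
  shows "P A"
proof (rule SL2_generated_weyl[of P, OF _ _ _ A])
  have "weyl = upper (-1) ** (lower 1 ** upper (-1) :: 'k^2^2)"
    by (simp add: SL2_defs mat2_mult)
  moreover have "P \<dots>" by (intro mult up low det_SL2 det_mult_1)
  ultimately show "P weyl" by simp
qed (use mult up in auto)

lemma mat2_inverse:
  fixes A :: "'k::field^2^2"
  assumes "det A = 1"
  obtains A' where "det A' = 1" "A ** A' = mat 1" "A' ** A = mat 1"
proof -
  obtain a b c d where Aeq: "A = mat2 a b c d" by (rule mat2_cases)
  show ?thesis
    by (rule that[of "mat2 d (-b) (-c) a"])
      (use assms in \<open>simp_all add: Aeq det_mat2 mat_1_mat2 mat2_mult mat2_eq_iff algebra_simps\<close>)
qed

text \<open>An action of PSL(2, q) written with matrices: by \<open>act_neg\<close> the matrix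
  \<open>weyl\<close>, whose square is \<open>neg_one\<close>, acts as an involution. The values of
  \<open>act\<close> outside determinant 1 are arbitrary.\<close>

locale SL2_action =
  fixes act :: "'k::{field,finite}^2^2 \<Rightarrow> 'x \<Rightarrow> 'x" and X :: "'x set"
  assumes finite_X: "finite X"
    and act_closed: "det A = 1 \<Longrightarrow> x \<in> X \<Longrightarrow> act A x \<in> X"
    and act_one: "x \<in> X \<Longrightarrow> act (mat 1) x = x"
    and act_mult: "det A = 1 \<Longrightarrow> det B = 1 \<Longrightarrow> x \<in> X \<Longrightarrow> act (A ** B) x = act A (act B x)"
    and act_neg: "x \<in> X \<Longrightarrow> act neg_one x = x"
begin

definition fix_count :: "'k^2^2 \<Rightarrow> nat" where
  "fix_count A = card {x \<in> X. act A x = x}"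

lemma act_inverse:
  assumes "det A = 1" obtains A' where "det A' = 1"
    "\<And>x. x \<in> X \<Longrightarrow> act A (act A' x) = x" "\<And>x. x \<in> X \<Longrightarrow> act A' (act A x) = x"
  using assms by (metis mat2_inverse act_mult act_one)

lemma act_inj: "det A = 1 \<Longrightarrow> x \<in> X \<Longrightarrow> y \<in> X \<Longrightarrow> act A x = act A y \<longleftrightarrow> x = y"
  by (metis act_inverse)

lemma act_bij: assumes "det A = 1" shows "bij_betw (act A) X X"
proof -
  have "inj_on (act A) X" using act_inj[OF assms] by (auto simp: inj_on_def)
  moreover have "act A ` X \<subseteq> X" using act_closed[OF assms] by auto
  ultimately show ?thesis
    using finite_X by (simp add: bij_betw_def endo_inj_surj)
qed

text \<open>With conjugacy written as B A = C B, most uses come down to an identity between products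
  of explicit matrices, free of inverses.\<close>

lemma fix_count_conj:
  assumes "det A = 1" "det B = 1" "det C = 1" "B ** A = C ** B"
  shows "fix_count A = fix_count C"
proof -
  have "bij_betw (act B) {x\<in>X. act A x = x} {x\<in>X. act C x = x}"
  proof (rule bij_betw_subset[OF act_bij[OF assms(2)]])
    have *: "act C (act B x) = act B x \<longleftrightarrow> act A x = x" if "x \<in> X" for x
      using that assms by (metis act_mult act_inj act_closed)
    have "y \<in> act B ` {x\<in>X. act A x = x}" if "y \<in> X" "act C y = y" for y
    proof -
      obtain x where "x \<in> X" "y = act B x"
        using act_bij[OF assms(2)] \<open>y \<in> X\<close> by (auto simp: bij_betw_def)
      then show ?thesis using * that by auto
    qed
    then show "act B ` {x\<in>X. act A x = x} = {x\<in>X. act C x = x}"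
      using * act_closed[OF assms(2)] by auto
  qed auto
  then show ?thesis by (auto simp: fix_count_def dest: bij_betw_same_card)
qed

lemma fix_count_lower: "fix_count (lower a) = fix_count (upper (-a))"
  by (rule fix_count_conj[of "upper (-a)" weyl, symmetric])
    (simp_all add: SL2_defs det_mat2 mat2_mult mat2_eq_iff)

lemma act_upper_add: "x \<in> X \<Longrightarrow> act (upper a) (act (upper b) x) = act (upper (a+b)) x"
  by (subst act_mult[symmetric]) (simp_all add: SL2_defs mat2_mult add.commute det_mat2)

lemma act_upper_0: "x \<in> X \<Longrightarrow> act (upper 0) x = x"
  using act_one by (simp add: SL2_defs)

lemma fixed_if_upper_weyl:
  assumes "x \<in> X" "\<And>a. act (upper a) x = x" "act weyl x = x" "det A = 1"
  shows "act A x = x"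
  by (rule SL2_generated_weyl[of "\<lambda>A. act A x = x"]) (use assms act_mult in auto)

lemma fixed_if_upper_lower:
  assumes "x \<in> X" "\<And>a. act (upper a) x = x" "\<And>a. act (lower a) x = x" "det A = 1"
  shows "act A x = x"
  by (rule SL2_generated_lower[of "\<lambda>A. act A x = x"]) (use assms act_mult in auto)

text \<open>The product \<open>upper (-1/c) ** (lower c ** upper (-1/c))\<close> is antidiagonal and
  fixes x. It conjugates the upper unipotent group onto the lower one, so both fix x, and together
  they generate.\<close>

lemma upper_stabilizer_trivial_lower:
  assumes x: "x \<in> X" and up: "\<And>a. act (upper a) x = x" and c: "c \<noteq> 0" "act (lower c) x = x"
    and A: "det A = 1"
  shows "act A x = x"
proof -
  let ?n = "mat2 0 (-1/c) c 0"
  have n: "det ?n = 1" using c by (simp add: det_mat2)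
  have "?n = upper (-1/c) ** (lower c ** upper (-1/c))"
    using c by (simp add: SL2_defs mat2_mult mat2_eq_iff)
  then have nx: "act ?n x = x" using x up c by (simp add: act_mult)
  have "act (lower b) x = x" for b
  proof -
    have "?n ** upper (-b/c^2) = lower b ** ?n"
      using c by (simp add: SL2_defs mat2_mult mat2_eq_iff power2_eq_square)
    then show ?thesis using nx x up n act_mult det_SL2 by metis
  qed
  then show ?thesis using fixed_if_upper_lower x up A by blast
qed

text \<open>Since x is not fixed by the whole group, no nontrivial \<open>lower c\<close> fixes it.
  Transported by \<open>weyl\<close>, this says that the unipotent group acts freely on the orbit of
  \<open>act weyl x\<close>; its q points together with x give q + 1. The same points later serve as
  coordinates of the projective line.\<close>

lemma card_if_upper_fixed:
  assumes x: "x \<in> X" and up: "\<And>a. act (upper a) x = x" and A: "det A = 1" "act A x \<noteq> x"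
  shows "CARD('k) + 1 \<le> card X"
    and "inj (\<lambda>a. act (upper a) (act weyl x))" and "x \<notin> range (\<lambda>a. act (upper a) (act weyl x))"
proof -
  let ?y = "\<lambda>a. act (upper a) (act weyl x)"
  have wx: "act weyl x \<in> X" using x act_closed by simp
  have lowx: "act (lower c) x = x \<Longrightarrow> c = 0" for c
    using upper_stabilizer_trivial_lower[OF x up _ _ A(1)] A(2) by blast
  show inj: "inj ?y"
  proof (rule injI)
    fix a b assume "?y a = ?y b"
    then have "act (upper (-b)) (?y a) = act (upper (-b)) (?y b)" by simp
    then have "act (upper (a-b)) (act weyl x) = act weyl x"
      by (simp add: act_upper_add wx act_upper_0)
    moreover have "upper (a-b) ** weyl = weyl ** lower (b-a)"
      by (simp add: SL2_defs mat2_mult)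
    ultimately have "act weyl (act (lower (b-a)) x) = act weyl x"
      by (metis act_mult x det_SL2(1-3))
    then have "act (lower (b-a)) x = x" using act_inj x act_closed by simp
    then show "a = b" using lowx by fastforce
  qed
  have "?y a \<noteq> x" for a
  proof
    assume "?y a = x"
    then have "act (upper (-a)) (?y a) = x" using up by simp
    then have "act weyl x = x" by (simp add: act_upper_add wx act_upper_0)
    then show False using fixed_if_upper_weyl x up A by blast
  qed
  then show nin: "x \<notin> range ?y" by (auto simp: image_iff eq_commute[of x])
  have "card (insert x (range ?y)) \<le> card X"
    using x wx act_closed by (intro card_mono finite_X) auto
  then show "CARD('k) + 1 \<le> card X"
    using nin inj by (simp add: card_image)
qed

end

section \<open>Counting fixed points of unipotent elements\<close>

text \<open>Conjugation by \<open>torus t\<close> multiplies the parameter of \<open>upper a\<close>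
  by t^2, so fixed point counts depend only on square classes. In even characteristic there is one
  class and \<nu> is 1; otherwise \<nu> is a nonsquare and each of the two classes has (q - 1)/2
  elements. The doubled sum formula covers both.\<close>

lemma square_classes:
  "\<exists>\<nu>::'k::{field,finite}. \<nu> \<noteq> 0 \<and> (\<forall>a. a \<noteq> 0 \<longrightarrow> (\<exists>t. t \<noteq> 0 \<and> (a = t^2 \<or> a = t^2 * \<nu>))) \<and>
     (\<forall>f :: 'k \<Rightarrow> nat. (\<forall>t a. t \<noteq> 0 \<longrightarrow> f (t^2 * a) = f a) \<longrightarrow>
        2 * (\<Sum>a\<in>-{0}. f a) = (CARD('k) - 1) * (f 1 + f \<nu>)) \<and>
     (even CARD('k) \<longrightarrow> \<nu> = 1)"
proof (cases "(1::'k) + 1 = 0")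
  case True
  have "inj (\<lambda>t::'k. t^2)"
  proof (rule injI)
    fix s t :: 'k assume "s^2 = t^2"
    then have "(s - t) * (s + t) = 0" by (simp add: algebra_simps power2_eq_square)
    moreover have "s + t = s - t"
    proof -
      have "t + t = t * (1 + 1)" by (simp add: algebra_simps)
      then have "t + t = 0" using True by simp
      then show ?thesis by (simp add: eq_neg_iff_add_eq_0 diff_conv_add_uminus del: add_uminus_conv_diff)
    qed
    ultimately show "s = t" by simp
  qed
  then have "surj (\<lambda>t::'k. t^2)" by (simp add: finite_UNIV_inj_surj)
  then have sq: "\<exists>t. t \<noteq> 0 \<and> a = t^2" if "a \<noteq> 0" for a :: 'k
    using that by (metis surjD zero_power2)
  have "2 * (\<Sum>a\<in>-{0}. f a) = (CARD('k) - 1) * (f 1 + f 1)"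
    if "\<forall>t a. t \<noteq> 0 \<longrightarrow> f (t^2 * a) = f a" for f :: "'k \<Rightarrow> nat"
  proof -
    have "f a = f 1" if "a \<noteq> 0" for a
      using sq[OF that] \<open>\<forall>t a. _\<close> by (metis mult.right_neutral)
    then have "(\<Sum>a\<in>-{0}. f a) = (\<Sum>a\<in>-{0::'k}. f 1)" by (intro sum.cong refl) (metis ComplD singletonI)
    then show ?thesis by (simp add: Compl_eq_Diff_UNIV card_Diff_singleton)
  qed
  then show ?thesis using sq by (intro exI[of _ 1]) auto
next
  case False
  define S where "S = (\<lambda>t::'k. t^2) ` (-{0})"
  have neg: "t \<noteq> - t" if "t \<noteq> 0" for t :: 'k
  proof
    assume "t = - t"
    then have "t * (1 + 1) = 0" by (metis eq_neg_iff_add_eq_0 distrib_left mult.right_neutral)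
    then show False using that False by simp
  qed
  have "card {t\<in>-{0}. t^2 = y} = 2" if y: "y \<in> S" for y :: 'k
  proof -
    obtain t where t: "t \<noteq> 0" "y = t^2" using y by (auto simp: S_def)
    have "{t\<in>-{0}. t^2 = y} = {t, -t}"
      using t by (auto simp: power2_eq_iff)
    then show ?thesis using neg[OF t(1)] by simp
  qed
  then have "(\<Sum>y\<in>S. \<Sum>t | t \<in> -{0::'k} \<and> t^2 = y. (1::nat)) = (\<Sum>y\<in>S. 2)"
    by (intro sum.cong) auto
  moreover have "(\<Sum>y\<in>S. \<Sum>t | t \<in> -{0::'k} \<and> t^2 = y. (1::nat)) = (\<Sum>t\<in>-{0::'k}. 1)"
    unfolding S_def by (rule sum.image_gen[symmetric]) simp
  ultimately have card_S: "2 * card S = CARD('k) - 1" by (simp add: Compl_eq_Diff_UNIV card_Diff_singleton)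
  have q0: "CARD('k) \<ge> 2"
    using card_mono[of "UNIV::'k set" "{0,1}"] by simp
  define N where "N = -{0} - S"
  have S0: "S \<subseteq> -{0}" by (auto simp: S_def)
  then have "card N = CARD('k) - 1 - card S"
    by (simp add: N_def card_Diff_subset Compl_eq_Diff_UNIV card_Diff_singleton)
  then have card_N: "card N = card S" using card_S by simp
  have "1 \<in> S" by (auto simp: S_def intro: image_eqI[of _ _ 1])
  then have "card S > 0" by (auto simp: card_gt_0_iff S_def)
  then obtain \<nu> where \<nu>: "\<nu> \<in> N" using card_N by (metis card.empty ex_in_conv less_irrefl)
  then have \<nu>0: "\<nu> \<noteq> 0" by (auto simp: N_def)
  have N_eq: "(\<lambda>x. x * \<nu>) ` S = N"
  proof (rule card_subset_eq)
    show "(\<lambda>x. x * \<nu>) ` S \<subseteq> N"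
    proof
      fix y assume "y \<in> (\<lambda>x. x * \<nu>) ` S"
      then obtain s where s: "s \<noteq> 0" "y = s^2 * \<nu>" by (auto simp: S_def)
      have "y \<notin> S"
      proof
        assume "y \<in> S"
        then obtain t where t: "t \<noteq> 0" "s^2 * \<nu> = t^2" using s by (auto simp: S_def)
        then have "\<nu> = (t/s)^2" using s by (simp add: field_simps)
        moreover have "t/s \<noteq> 0" using s t by simp
        ultimately have "\<nu> \<in> S" by (auto simp: S_def)
        then show False using \<nu> by (simp add: N_def)
      qed
      then show "y \<in> N" using s \<nu>0 by (simp add: N_def)
    qed
    show "card ((\<lambda>x. x * \<nu>) ` S) = card N"
      using \<nu>0 card_N by (subst card_image) (auto simp: inj_on_def)
  qed simp
  then have cls: "a \<in> S \<or> (\<exists>x\<in>S. a = x * \<nu>)" if "a \<noteq> 0" for a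
    using that by (auto simp: N_def)
  have sums: "2 * (\<Sum>a\<in>-{0}. f a) = (CARD('k) - 1) * (f 1 + f \<nu>)"
    if f: "\<forall>t a. t \<noteq> 0 \<longrightarrow> f (t^2 * a) = f a" for f :: "'k \<Rightarrow> nat"
  proof -
    have "(\<Sum>a\<in>-{0}. f a) = (\<Sum>a\<in>S. f a) + (\<Sum>a\<in>N. f a)"
      using S0 by (simp add: N_def sum.subset_diff[of S "-{0}"] add.commute)
    moreover have "(\<Sum>a\<in>S. f a) = (\<Sum>a\<in>S. f 1)"
    proof (rule sum.cong[OF refl])
      fix a assume "a \<in> S"
      then obtain t where "t \<noteq> 0" "a = t^2 * 1" by (auto simp: S_def)
      then show "f a = f 1" using f by (simp only: simp_thms)
    qed
    moreover have "(\<Sum>a\<in>N. f a) = (\<Sum>a\<in>N. f \<nu>)"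
    proof (rule sum.cong[OF refl])
      fix a assume "a \<in> N"
      then obtain t where "t \<noteq> 0" "a = t^2 * \<nu>"
        using N_eq by (auto simp: S_def)
      then show "f a = f \<nu>" using f by simp
    qed
    ultimately have "2 * (\<Sum>a\<in>-{0}. f a) = (2 * card S) * (f 1 + f \<nu>)"
      using card_N by (simp add: algebra_simps)
    then show ?thesis by (simp only: card_S)
  qed
  have "odd CARD('k)" using card_S q0
    by (metis Suc_diff_1 Suc_1 Suc_le_lessD add_gr_0 even_Suc even_mult_iff even_numeral le_add_diff_inverse plus_1_eq_Suc zero_less_one)
  then have odd_imp: "even CARD('k) \<longrightarrow> \<nu> = 1" by simp
  have cls': "\<exists>t. t \<noteq> 0 \<and> (a = t^2 \<or> a = t^2 * \<nu>)" if "a \<noteq> 0" for a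
    using cls[OF that] by (auto simp: S_def)
  show ?thesis
  proof (intro exI[of _ \<nu>] conjI)
    show "\<forall>f :: 'k \<Rightarrow> nat. (\<forall>t a. t \<noteq> 0 \<longrightarrow> f (t^2 * a) = f a) \<longrightarrow>
        2 * (\<Sum>a\<in>-{0}. f a) = (CARD('k) - 1) * (f 1 + f \<nu>)"
      by (intro allI impI, rule sums)
    show "\<forall>a. a \<noteq> 0 \<longrightarrow> (\<exists>t. t \<noteq> 0 \<and> (a = t^2 \<or> a = t^2 * \<nu>))"
      by (intro allI impI, rule cls')
  qed (fact \<nu>0 odd_imp)+
qed

definition second_class :: "'k::{field,finite}" where
  "second_class = (SOME \<nu>. \<nu> \<noteq> 0 \<and> (\<forall>a. a \<noteq> 0 \<longrightarrow> (\<exists>t. t \<noteq> 0 \<and> (a = t^2 \<or> a = t^2 * \<nu>))) \<and>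
     (\<forall>f :: 'k \<Rightarrow> nat. (\<forall>t a. t \<noteq> 0 \<longrightarrow> f (t^2 * a) = f a) \<longrightarrow>
        2 * (\<Sum>a\<in>-{0}. f a) = (CARD('k) - 1) * (f 1 + f \<nu>)) \<and>
     (even CARD('k) \<longrightarrow> \<nu> = 1))"

lemmas second_class_props = someI_ex[OF square_classes, folded second_class_def]

lemma second_class_cases: "a \<noteq> 0 \<Longrightarrow> \<exists>t. t \<noteq> 0 \<and> (a = t^2 \<or> a = t^2 * second_class)"
  and second_class_even: "even CARD('k::{field,finite}) \<Longrightarrow> (second_class :: 'k) = 1"
  using second_class_props by blast+

lemma sum_square_classes:
  fixes f :: "'k::{field,finite} \<Rightarrow> nat"
  assumes "\<And>t a. t \<noteq> 0 \<Longrightarrow> f (t^2 * a) = f a"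
  shows "2 * (\<Sum>a\<in>-{0}. f a) = (CARD('k) - 1) * (f 1 + f second_class)"
  using second_class_props assms by blast

section \<open>Orbits and fixed points of the unipotent group\<close>

context SL2_action begin

text \<open>Orbits and stabilisers are those of the unipotent group only, with stabilisers taken as
  subsets of the additive group of the field.\<close>

definition orb :: "'x \<Rightarrow> 'x set" where "orb x = range (\<lambda>a. act (upper a) x)"
definition stab :: "'x \<Rightarrow> 'k set" where "stab x = {a. act (upper a) x = x}"

lemma orb_self: "x \<in> X \<Longrightarrow> x \<in> orb x"
  unfolding orb_def by (rule range_eqI[of _ _ 0]) (simp add: act_upper_0)

lemma orb_subset: "x \<in> X \<Longrightarrow> orb x \<subseteq> X"
  using act_closed by (auto simp: orb_def)

lemma orb_eq: assumes "x \<in> X" "y \<in> orb x" shows "orb y = orb x"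
proof -
  obtain b where b: "y = act (upper b) x" using assms unfolding orb_def by blast
  have "orb y = (\<lambda>a. act (upper (a + b)) x) ` UNIV"
    using assms(1) by (simp add: orb_def b act_upper_add)
  also have "\<dots> = (\<lambda>a. act (upper a) x) ` ((\<lambda>a. a + b) ` UNIV)" by (simp only: image_image)
  also have "(\<lambda>a. a + b) ` UNIV = UNIV" using surj_plus_right by blast
  finally show ?thesis by (simp add: orb_def)
qed

text \<open>Holds because the unipotent group is abelian.\<close>

lemma stab_eq: assumes "x \<in> X" "y \<in> orb x" shows "stab y = stab x"
proof -
  obtain b where b: "y = act (upper b) x" using assms unfolding orb_def by blast
  have "act (upper a) y = act (upper b) (act (upper a) x)" for a
    using assms(1) by (simp add: b act_upper_add add.commute)
  then show ?thesis
    unfolding stab_def using act_inj assms(1) act_closed by (auto simp: b)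
qed

lemma card_orb_stab: assumes x: "x \<in> X" shows "card (orb x) * card (stab x) = CARD('k)"
proof -
  have *: "card {a \<in> UNIV. act (upper a) x = y} = card (stab x)" if y: "y \<in> orb x" for y
  proof -
    obtain b where b: "y = act (upper b) x" using y unfolding orb_def by blast
    have "bij_betw (\<lambda>a. a + b) (stab x) {a. act (upper a) x = y}"
    proof (rule bij_betwI[where g = "\<lambda>a. a - b"])
      show "(\<lambda>a. a + b) \<in> stab x \<rightarrow> {a. act (upper a) x = y}"
        using x by (auto simp: stab_def b) (metis act_upper_add add.commute)
      show "(\<lambda>a. a - b) \<in> {a. act (upper a) x = y} \<rightarrow> stab x"
      proof (rule Pi_I)
        fix a assume "a \<in> {a. act (upper a) x = y}"
        then have "act (upper (-b)) (act (upper a) x) = act (upper (-b)) (act (upper b) x)"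
          by (simp add: b)
        then show "a - b \<in> stab x"
          using x by (simp add: act_upper_add stab_def act_upper_0)
      qed
    qed auto
    then show ?thesis using bij_betw_same_card by fastforce
  qed
  have "(\<Sum>a\<in>(UNIV::'k set). (1::nat)) = (\<Sum>y\<in>orb x. \<Sum>a | a \<in> UNIV \<and> act (upper a) x = y. 1)"
    unfolding orb_def by (rule sum.image_gen) simp
  also have "\<dots> = (\<Sum>y\<in>orb x. card (stab x))" using * by (intro sum.cong) auto
  finally show ?thesis by simp
qed

lemma dvd_sum_orbits:
  fixes \<phi> :: "'x \<Rightarrow> nat"
  assumes \<Omega>: "\<Omega> \<subseteq> X" "\<And>x a. x \<in> \<Omega> \<Longrightarrow> act (upper a) x \<in> \<Omega>"
    and d: "\<And>x. x \<in> \<Omega> \<Longrightarrow> d dvd sum \<phi> (orb x)"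
  shows "d dvd sum \<phi> \<Omega>"
proof -
  have "\<Union> (orb ` \<Omega>) = \<Omega>"
  proof
    show "\<Union> (orb ` \<Omega>) \<subseteq> \<Omega>" using \<Omega>(2) by (auto simp: orb_def)
    show "\<Omega> \<subseteq> \<Union> (orb ` \<Omega>)" using \<Omega>(1) orb_self by blast
  qed
  moreover have "sum \<phi> (\<Union> (orb ` \<Omega>)) = sum (sum \<phi>) (orb ` \<Omega>)"
  proof (rule sum.Union_disjoint[unfolded comp_def])
    show "\<forall>A\<in>orb ` \<Omega>. finite A" by (auto simp: orb_def)
    show "\<forall>A\<in>orb ` \<Omega>. \<forall>B\<in>orb ` \<Omega>. A \<noteq> B \<longrightarrow> A \<inter> B = {}"
    proof (intro ballI impI)
      fix A B assume A: "A \<in> orb ` \<Omega>" and B: "B \<in> orb ` \<Omega>" and ne: "A \<noteq> B"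
      obtain x y where xy: "x \<in> \<Omega>" "A = orb x" "y \<in> \<Omega>" "B = orb y" using A B by blast
      have "z \<notin> A \<inter> B" for z
        using xy ne orb_eq[of x z] orb_eq[of y z] \<Omega>(1) by blast
      then show "A \<inter> B = {}" by blast
    qed
  qed
  moreover have "d dvd sum (sum \<phi>) (orb ` \<Omega>)"
  proof (rule dvd_sum)
    fix A assume "A \<in> orb ` \<Omega>"
    then obtain x where "x \<in> \<Omega>" "A = orb x" by blast
    then show "d dvd sum \<phi> A" using d by metis
  qed
  ultimately show ?thesis by metis
qed

definition fix_count_on :: "'x set \<Rightarrow> 'k \<Rightarrow> nat" where
  "fix_count_on \<Omega> a = card {x \<in> \<Omega>. act (upper a) x = x}"

text \<open>Burnside's double count of the pairs (a, x) with \<open>upper a\<close> fixing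
  x.\<close>

lemma sum_stab:
  assumes "\<Omega> \<subseteq> X"
  shows "(\<Sum>x\<in>\<Omega>. card (stab x)) = (\<Sum>a\<in>UNIV. fix_count_on \<Omega> a)"
proof -
  have fin: "finite \<Omega>" using assms finite_X finite_subset by blast
  have "(\<Sum>x\<in>\<Omega>. card (stab x)) = (\<Sum>x\<in>\<Omega>. \<Sum>a\<in>UNIV. if act (upper a) x = x then 1 else 0)"
    by (simp add: stab_def sum.If_cases)
  also have "\<dots> = (\<Sum>a\<in>UNIV. \<Sum>x\<in>\<Omega>. if act (upper a) x = x then 1 else 0)"
    by (rule sum.swap)
  also have "\<dots> = (\<Sum>a\<in>UNIV. fix_count_on \<Omega> a)"
    using fin by (simp add: fix_count_on_def sum.If_cases Int_def)
  finally show ?thesis .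
qed

definition borel_invariant :: "'x set \<Rightarrow> bool" where
  "borel_invariant \<Omega> \<longleftrightarrow> \<Omega> \<subseteq> X \<and> (\<forall>x\<in>\<Omega>. \<forall>a. act (upper a) x \<in> \<Omega>) \<and>
     (\<forall>x\<in>\<Omega>. \<forall>t. t \<noteq> 0 \<longrightarrow> act (torus t) x \<in> \<Omega>)"

text \<open>For Borel-invariant \<Omega> this is twice the average number of fixed points of a
  nontrivial \<open>upper a\<close>. For even q the two summands coincide,
  \<open>second_class\<close> being 1.\<close>

definition class_count :: "'x set \<Rightarrow> nat" where
  "class_count \<Omega> = fix_count_on \<Omega> 1 + fix_count_on \<Omega> second_class"

lemma torus_upper: "t \<noteq> 0 \<Longrightarrow> x \<in> X \<Longrightarrow> act (torus t) (act (upper a) x) = act (upper (t^2*a)) (act (torus t) x)"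
proof -
  assume t: "t \<noteq> 0" and x: "x \<in> X"
  have "torus t ** upper a = upper (t^2*a) ** torus t"
    using t by (simp add: SL2_defs mat2_mult mat2_eq_iff power2_eq_square)
  then show ?thesis using t x act_mult[of "torus t" "upper a"] act_mult[of "upper (t^2*a)" "torus t"] by simp
qed

lemma torus_torus: "s \<noteq> 0 \<Longrightarrow> t \<noteq> 0 \<Longrightarrow> x \<in> X \<Longrightarrow> act (torus s) (act (torus t) x) = act (torus (s*t)) x"
  by (subst act_mult[symmetric]) (simp_all add: SL2_defs mat2_mult det_mat2)

lemma torus_1: "x \<in> X \<Longrightarrow> act (torus 1) x = x"
  using act_one by (simp add: SL2_defs)

lemma fix_count_on_square:
  assumes "borel_invariant \<Omega>" "t \<noteq> 0"
  shows "fix_count_on \<Omega> (t^2 * a) = fix_count_on \<Omega> a"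
proof -
  have \<Omega>: "\<Omega> \<subseteq> X" "\<And>x t. x \<in> \<Omega> \<Longrightarrow> t \<noteq> 0 \<Longrightarrow> act (torus t) x \<in> \<Omega>"
    using assms(1) by (auto simp: borel_invariant_def)
  have fin: "finite \<Omega>" using \<Omega> finite_X finite_subset by blast
  have le: "fix_count_on \<Omega> a \<le> fix_count_on \<Omega> (t^2 * a)" if "t \<noteq> 0" for t a
    unfolding fix_count_on_def
  proof (rule card_inj_on_le[where f = "act (torus t)"])
    show "inj_on (act (torus t)) {x \<in> \<Omega>. act (upper a) x = x}"
      using \<Omega> that by (auto intro!: inj_onI simp: act_inj subset_iff)
    show "act (torus t) ` {x \<in> \<Omega>. act (upper a) x = x} \<subseteq> {x \<in> \<Omega>. act (upper (t\<^sup>2 * a)) x = x}"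
      using \<Omega> that torus_upper by (auto simp: subset_iff) (metis)
  qed (use fin in simp)
  have eq: "(1/t)^2 * (t^2 * a) = a" using assms(2) by (simp add: power_one_over)
  show ?thesis
    using le[of t a] le[of "1/t" "t^2*a", unfolded eq] assms(2) by force
qed

lemma fix_count_on_0: "\<Omega> \<subseteq> X \<Longrightarrow> fix_count_on \<Omega> 0 = card \<Omega>"
  by (auto simp: fix_count_on_def act_upper_0 subset_iff intro: arg_cong[where f=card])

lemma fix_count_on_le: "\<Omega> \<subseteq> X \<Longrightarrow> fix_count_on \<Omega> a \<le> card \<Omega>"
  using finite_X finite_subset by (auto simp: fix_count_on_def intro!: card_mono)

lemma fix_count_on_class: "borel_invariant \<Omega> \<Longrightarrow> a \<noteq> 0 \<Longrightarrow>
    fix_count_on \<Omega> a = fix_count_on \<Omega> 1 \<or> fix_count_on \<Omega> a = fix_count_on \<Omega> second_class"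
  using second_class_cases fix_count_on_square by (metis mult.right_neutral)

lemma sum_fix_count_on:
  assumes "borel_invariant \<Omega>"
  shows "2 * (\<Sum>a\<in>UNIV. fix_count_on \<Omega> a) = 2 * card \<Omega> + (CARD('k) - 1) * class_count \<Omega>"
proof -
  have "(\<Sum>a\<in>UNIV. fix_count_on \<Omega> a) = fix_count_on \<Omega> 0 + (\<Sum>a\<in>-{0}. fix_count_on \<Omega> a)"
    using sum.remove[of UNIV "0::'k" "fix_count_on \<Omega>"] by (simp add: Compl_eq_Diff_UNIV)
  then show ?thesis
    using sum_square_classes[of "fix_count_on \<Omega>"] fix_count_on_square[OF assms]
      fix_count_on_0[of \<Omega>] assms by (simp add: class_count_def borel_invariant_def)
qed

text \<open>Each orbit contributes its size times the order of its stabiliser, which is q.\<close>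

lemma dvd_sum_fix_count_on:
  assumes "borel_invariant \<Omega>"
  shows "CARD('k) dvd (\<Sum>a\<in>UNIV. fix_count_on \<Omega> a)"
proof -
  have \<Omega>: "\<Omega> \<subseteq> X" "\<And>x a. x \<in> \<Omega> \<Longrightarrow> act (upper a) x \<in> \<Omega>"
    using assms by (auto simp: borel_invariant_def)
  have "CARD('k) dvd (\<Sum>x\<in>\<Omega>. card (stab x))"
  proof (rule dvd_sum_orbits[OF \<Omega>])
    fix x assume "x \<in> \<Omega>"
    then have x: "x \<in> X" using \<Omega> by auto
    have "sum (\<lambda>x. card (stab x)) (orb x) = (\<Sum>y\<in>orb x. card (stab x))"
      using stab_eq[OF x] by (intro sum.cong) auto
    then show "CARD('k) dvd sum (\<lambda>x. card (stab x)) (orb x)"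
      using card_orb_stab[OF x] by simp
  qed
  then show ?thesis by (simp add: sum_stab \<Omega>)
qed

text \<open>Modulo q, the doubled sum 2 |\<Omega>| + (q - 1) c reduces to 2 |\<Omega>| - c. If the
  unipotent group fixes no point of a nonempty \<Omega>, this difference is positive and hence at
  least q, which is the source of all lower bounds on degrees below.\<close>

lemma class_count_dvd:
  assumes "borel_invariant \<Omega>"
  shows "class_count \<Omega> \<le> 2 * card \<Omega>" "CARD('k) dvd 2 * card \<Omega> - class_count \<Omega>"
proof -
  have \<Omega>: "\<Omega> \<subseteq> X" using assms by (auto simp: borel_invariant_def)
  show le: "class_count \<Omega> \<le> 2 * card \<Omega>"
    using fix_count_on_le[OF \<Omega>, of 1] fix_count_on_le[OF \<Omega>, of second_class]
    by (simp add: class_count_def)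
  have "CARD('k) dvd 2 * card \<Omega> + (CARD('k) - 1) * class_count \<Omega>"
    using dvd_sum_fix_count_on[OF assms] sum_fix_count_on[OF assms] by (metis dvd_mult)
  moreover have "2 * card \<Omega> + (CARD('k) - 1) * class_count \<Omega> =
      (2 * card \<Omega> - class_count \<Omega>) + CARD('k) * class_count \<Omega>"
    using le by (cases "CARD('k)") auto
  ultimately show "CARD('k) dvd 2 * card \<Omega> - class_count \<Omega>"
    by (metis dvd_add_left_iff dvd_triv_left)
qed

text \<open>Equality would make every \<open>upper a\<close> trivial on \<Omega>, because each
  nonzero a shares its fixed point count with 1 or with \<open>second_class\<close>.\<close>

lemma class_count_less:
  assumes "borel_invariant \<Omega>" "\<Omega> \<noteq> {}" "\<And>x. x \<in> \<Omega> \<Longrightarrow> \<exists>a. act (upper a) x \<noteq> x"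
  shows "class_count \<Omega> < 2 * card \<Omega>"
proof (rule ccontr)
  assume "\<not> ?thesis"
  moreover have \<Omega>: "\<Omega> \<subseteq> X" using assms by (auto simp: borel_invariant_def)
  ultimately have eq: "fix_count_on \<Omega> 1 = card \<Omega>" "fix_count_on \<Omega> second_class = card \<Omega>"
    using fix_count_on_le[OF \<Omega>, of 1] fix_count_on_le[OF \<Omega>, of second_class]
    by (simp_all add: class_count_def)
  have fin: "finite \<Omega>" using \<Omega> finite_X finite_subset by blast
  obtain x where x: "x \<in> \<Omega>" using assms(2) by auto
  then obtain a where a: "act (upper a) x \<noteq> x" using assms(3) by auto
  then have "a \<noteq> 0" using act_upper_0 x \<Omega> by auto
  then have "fix_count_on \<Omega> a = card \<Omega>" using fix_count_on_class[OF assms(1)] eq by metis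
  then have "{x \<in> \<Omega>. act (upper a) x = x} = \<Omega>"
    unfolding fix_count_on_def by (intro card_subset_eq fin) auto
  then show False using a x by auto
qed

lemma fix_count_commute:
  assumes "det A = 1" "det B = 1"
  shows "fix_count (A ** B) = fix_count (B ** A)"
  by (rule fix_count_conj[of "A ** B" B "B ** A"]) (use assms in \<open>simp_all add: matrix_mul_assoc\<close>)

lemma fix_count_upper: "fix_count (upper a) = fix_count_on X a"
  by (simp add: fix_count_def fix_count_on_def)

lemma borel_invariant_X: "borel_invariant X"
  using act_closed by (simp add: borel_invariant_def)

end

section \<open>Transitive actions and the Borel subgroup\<close>

locale SL2_transitive_action = SL2_action act X
  for act :: "'k::{field,finite}^2^2 \<Rightarrow> 'x \<Rightarrow> 'x" and X +
  assumes transitive: "x \<in> X \<Longrightarrow> y \<in> X \<Longrightarrow> \<exists>A. det A = 1 \<and> act A x = y"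
    and card_gt_1: "1 < card X"
begin

lemma upper_moves:
  assumes x: "x \<in> X" and small: "card X \<le> CARD('k)"
  shows "\<exists>a. act (upper a) x \<noteq> x"
proof (rule ccontr)
  assume *: "\<not> ?thesis"
  have "\<exists>y\<in>X. y \<noteq> x"
  proof (rule ccontr)
    assume "\<not> ?thesis"
    then have "X = {x}" using x by blast
    then show False using card_gt_1 by simp
  qed
  then obtain y where "y \<in> X" "y \<noteq> x" by blast
  then obtain A where "det A = 1" "act A x \<noteq> x" using transitive x by blast
  then have "CARD('k) + 1 \<le> card X" using card_if_upper_fixed(1)[OF x] * by blast
  then show False using small by simp
qed

definition borel_act :: "'k \<Rightarrow> 'k \<Rightarrow> 'x \<Rightarrow> 'x" where
  "borel_act a t x = act (upper a) (act (torus t) x)"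

lemma borel_act_closed: "t \<noteq> 0 \<Longrightarrow> x \<in> X \<Longrightarrow> borel_act a t x \<in> X"
  by (simp add: borel_act_def act_closed)

lemma borel_act_comp:
  "s \<noteq> 0 \<Longrightarrow> t \<noteq> 0 \<Longrightarrow> x \<in> X \<Longrightarrow> borel_act a s (borel_act b t x) = borel_act (a + s^2*b) (s*t) x"
  by (simp add: borel_act_def torus_upper act_closed act_upper_add torus_torus)

lemma borel_act_1: "x \<in> X \<Longrightarrow> borel_act 0 1 x = x"
  by (simp add: borel_act_def torus_1 act_upper_0)

lemma borel_act_inverse:
  assumes "t \<noteq> 0" "x \<in> X" shows "borel_act (-a / t^2) (1/t) (borel_act a t x) = x"
  using assms by (simp add: borel_act_comp power_divide borel_act_1)

text \<open>If the Borel orbit \<Omega> had a nonempty complement, then 2 |\<Omega>| minus the class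
  count of \<Omega> would be at least q, and likewise for the complement. As |X| \<le> q, both class
  counts vanish, so the unipotent group acts freely on \<Omega>, which then has q points and leaves
  none for the complement.\<close>

lemma borel_transitive:
  assumes small: "card X \<le> CARD('k)" and x: "x \<in> X" and y: "y \<in> X"
  shows "\<exists>a t. t \<noteq> 0 \<and> borel_act a t x = y"
proof -
  define \<Omega> where "\<Omega> = {borel_act a t x |a t. t \<noteq> 0}"
  have act_up: "act (upper c) z = borel_act c 1 z" if "z \<in> X" for c z
    using that by (simp add: borel_act_def torus_1)
  have act_tor: "act (torus t) z = borel_act 0 t z" if "z \<in> X" "t \<noteq> 0" for t z
    using that by (simp add: borel_act_def act_upper_0 act_closed)
  have inv: "borel_act c s z \<in> \<Omega>" if "z \<in> \<Omega>" "s \<noteq> 0" for c s z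
    using that x by (auto simp: \<Omega>_def borel_act_comp) (metis mult_eq_0_iff)
  have sub: "\<Omega> \<subseteq> X" using x by (auto simp: \<Omega>_def borel_act_closed)
  have bi: "borel_invariant \<Omega>"
    unfolding borel_invariant_def using sub inv act_up act_tor by (simp add: subset_iff)
  have inv': "borel_act c s z \<in> X - \<Omega>" if "z \<in> X - \<Omega>" "s \<noteq> 0" for c s z
  proof -
    have "borel_act c s z \<notin> \<Omega>"
    proof
      assume "borel_act c s z \<in> \<Omega>"
      then have "borel_act (-c / s^2) (1/s) (borel_act c s z) \<in> \<Omega>" using inv that by simp
      then show False using that borel_act_inverse by simp
    qed
    then show ?thesis using that borel_act_closed by simp
  qed
  have bi': "borel_invariant (X - \<Omega>)"
    unfolding borel_invariant_def using inv' act_up act_tor by simp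
  have "x \<in> \<Omega>" unfolding \<Omega>_def by (intro CollectI exI[of _ 0] exI[of _ 1]) (simp add: borel_act_1 x)
  have "X - \<Omega> = {}"
  proof (rule ccontr)
    assume ne: "X - \<Omega> \<noteq> {}"
    have moves: "\<exists>a. act (upper a) z \<noteq> z" if "z \<in> X" for z using upper_moves[OF that small] .
    have lt: "class_count \<Omega> < 2 * card \<Omega>" "class_count (X - \<Omega>) < 2 * card (X - \<Omega>)"
      using class_count_less[OF bi] class_count_less[OF bi' ne] moves sub \<open>x \<in> \<Omega>\<close> by blast+
    have "CARD('k) \<le> 2 * card \<Omega> - class_count \<Omega>" "CARD('k) \<le> 2 * card (X-\<Omega>) - class_count (X-\<Omega>)"
      using class_count_dvd(2)[OF bi] class_count_dvd(2)[OF bi'] lt by (auto dest: dvd_imp_le)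
    moreover have "card X = card \<Omega> + card (X - \<Omega>)"
      using sub finite_X by (metis card_Diff_subset card_mono finite_subset le_add_diff_inverse)
    ultimately have "class_count \<Omega> = 0" using lt small by linarith
    then have "fix_count_on \<Omega> a = 0" if "a \<noteq> 0" for a
      using fix_count_on_class[OF bi that] by (auto simp: class_count_def)
    moreover have "finite \<Omega>" using sub finite_X finite_subset by blast
    ultimately have "stab x = {0}"
      using \<open>x \<in> \<Omega>\<close> x by (auto simp: fix_count_on_def stab_def act_upper_0)
    then have "card (orb x) = CARD('k)" using card_orb_stab[OF x] by simp
    moreover have "orb x \<subseteq> \<Omega>"
      using inv[OF \<open>x \<in> \<Omega>\<close>, of 1] act_up[OF x] by (auto simp: orb_def)
    ultimately have "CARD('k) \<le> card \<Omega>" using \<open>finite \<Omega>\<close> by (metis card_mono)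
    moreover have "card (X - \<Omega>) > 0" using ne finite_X by (simp add: card_gt_0_iff)
    ultimately show False using \<open>card X = _\<close> small by simp
  qed
  then have "y \<in> \<Omega>" using y by blast
  then show ?thesis unfolding \<Omega>_def by blast
qed

text \<open>By transitivity all fibres of (a, t) \<mapsto> \<open>borel_act a t x\<close> have the
  same size, and there are q (q - 1) pairs.\<close>

lemma card_borel_solutions:
  assumes small: "card X \<le> CARD('k)" and x: "x \<in> X" and y: "y \<in> X"
  shows "card X * card {(a, t). t \<noteq> 0 \<and> borel_act a t x = y} = CARD('k) * (CARD('k) - 1)"
proof -
  define c where "c z = card {(a, t). t \<noteq> 0 \<and> borel_act a t x = z}" for z
  have le: "c z \<le> c z'" if z: "z \<in> X" and z': "z' \<in> X" for z z'
  proof -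
    obtain b s where s: "s \<noteq> 0" "borel_act b s z = z'" using borel_transitive[OF small z z'] by blast
    show ?thesis unfolding c_def
    proof (rule card_inj_on_le[where f = "\<lambda>(a,t). (b + s^2*a, s*t)"])
      show "inj_on (\<lambda>(a,t). (b + s^2*a, s*t)) {(a, t). t \<noteq> 0 \<and> borel_act a t x = z}"
        using s by (auto simp: inj_on_def)
      show "(\<lambda>(a, t). (b + s\<^sup>2 * a, s * t)) ` {(a, t). t \<noteq> 0 \<and> borel_act a t x = z}
          \<subseteq> {(a, t). t \<noteq> 0 \<and> borel_act a t x = z'}"
        using s x borel_act_comp by auto
    qed simp
  qed
  have "card {(a::'k, t::'k). t \<noteq> 0} = card (UNIV \<times> (-{0}) :: ('k \<times> 'k) set)"
    by (rule arg_cong[where f=card]) auto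
  then have "card {(a::'k, t::'k). t \<noteq> 0} = CARD('k) * (CARD('k) - 1)"
    by (simp add: card_cartesian_product Compl_eq_Diff_UNIV card_Diff_singleton)
  moreover have "(\<Sum>p\<in>{(a::'k, t::'k). t \<noteq> 0}. (1::nat)) =
      (\<Sum>z\<in>X. \<Sum>p | p \<in> {(a::'k, t::'k). t \<noteq> 0} \<and> (case p of (a,t) \<Rightarrow> borel_act a t x) = z. 1)"
    by (rule sum.group[symmetric]) (use x finite_X borel_act_closed in auto)
  moreover have "{p. p \<in> {(a::'k, t::'k). t \<noteq> 0} \<and> (case p of (a,t) \<Rightarrow> borel_act a t x) = z} =
      {(a, t). t \<noteq> 0 \<and> borel_act a t x = z}" for z by auto
  ultimately have "(\<Sum>z\<in>X. c z) = CARD('k) * (CARD('k) - 1)" by (simp add: c_def)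
  moreover have "(\<Sum>z\<in>X. c z) = (\<Sum>z\<in>X. c y)"
    using le y by (intro sum.cong refl order.antisym)
  ultimately show ?thesis by (simp add: c_def)
qed

text \<open>By Burnside's lemma, q times the number of orbits of the unipotent group on X.\<close>

definition sigma :: nat where "sigma = (\<Sum>a\<in>UNIV. fix_count (upper a))"

lemma fix_count_indicator: "fix_count A = (\<Sum>x\<in>X. if act A x = x then 1 else 0)"
  using finite_X by (simp add: fix_count_def sum.If_cases Int_def)

text \<open>For b \<noteq> 0 the element \<open>upper a ** lower b\<close> is conjugate to a Borel
  element times \<open>weyl\<close>, and as a and b vary each
  \<open>upper a ** (torus t ** weyl)\<close> occurs once. It fixes x when the Borel element carries
  \<open>act weyl x\<close> back to x, which has q (q - 1) / |X| solutions for each x. The terms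
  with b = 0 add up to \<open>sigma\<close>.\<close>

lemma sum_fix_count_upper_lower:
  assumes small: "card X \<le> CARD('k)"
  shows "(\<Sum>b\<in>UNIV. \<Sum>a\<in>UNIV. fix_count (upper a ** lower b)) = sigma + CARD('k) * (CARD('k) - 1)"
proof -
  have b0: "(\<Sum>a\<in>UNIV. fix_count (upper a ** lower 0)) = sigma"
  proof -
    have "lower 0 = (mat 1 :: 'k^2^2)" by (simp add: SL2_defs)
    then show ?thesis by (simp add: sigma_def)
  qed
  have b: "(\<Sum>a\<in>UNIV. fix_count (upper a ** lower b)) =
      (\<Sum>a\<in>UNIV. fix_count (upper a ** (torus (1/b) ** weyl)))" if "b \<noteq> 0" for b
  proof -
    \<comment> \<open>Conjugation by \<open>upper (1/b)\<close> makes the lower right entry zero;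
      the shift of a by 2/b is dictated by the trace 2 + a b.\<close>
    have "fix_count (upper a ** lower b) = fix_count (upper (a + 2/b) ** (torus (1/b) ** weyl))" for a
      by (rule fix_count_conj[of _ "upper (1/b)"])
        (use that in \<open>simp_all add: SL2_defs mat2_mult mat2_eq_iff det_mat2 field_simps\<close>)
    then have "(\<Sum>a\<in>UNIV. fix_count (upper a ** lower b)) =
      (\<Sum>a\<in>UNIV. fix_count (upper (a + 2/b) ** (torus (1/b) ** weyl)))" by simp
    also have "\<dots> = (\<Sum>a\<in>UNIV. fix_count (upper a ** (torus (1/b) ** weyl)))"
      by (rule sum.reindex_bij_witness[of _ "\<lambda>a. a - 2/b" "\<lambda>a. a + 2/b"]) auto
    finally show ?thesis .
  qed
  have "(\<Sum>b\<in>-{0}. \<Sum>a\<in>UNIV. fix_count (upper a ** lower b)) =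
     (\<Sum>b\<in>-{0}. \<Sum>a\<in>UNIV. fix_count (upper a ** (torus (1/b) ** weyl)))"
    by (intro sum.cong refl b) simp
  also have "\<dots> = (\<Sum>t\<in>-{0}. \<Sum>a\<in>UNIV. fix_count (upper a ** (torus t ** weyl)))"
    by (rule sum.reindex_bij_witness[of _ "\<lambda>t. 1/t" "\<lambda>t. 1/t"]) auto
  also have "\<dots> = (\<Sum>t\<in>-{0}. \<Sum>a\<in>UNIV. \<Sum>x\<in>X. if borel_act a t (act weyl x) = x then 1 else 0)"
    by (intro sum.cong refl) (simp add: fix_count_indicator borel_act_def act_mult act_closed)
  also have "\<dots> = (\<Sum>x\<in>X. \<Sum>a\<in>UNIV. \<Sum>t\<in>-{0}. if borel_act a t (act weyl x) = x then 1 else 0)"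
    by (subst sum.swap, subst (2) sum.swap, subst sum.swap) (rule refl)
  also have "\<dots> = (\<Sum>x\<in>X. card {(a, t). t \<noteq> 0 \<and> borel_act a t (act weyl x) = x})"
  proof (rule sum.cong[OF refl])
    fix x assume "x \<in> X"
    have "(\<Sum>a\<in>UNIV. \<Sum>t\<in>-{0}. if borel_act a t (act weyl x) = x then 1 else (0::nat)) = (\<Sum>p\<in>UNIV \<times> (-{0}). if (case p of (a,t) \<Rightarrow> borel_act a t (act weyl x) = x) then 1 else 0)"
      by (simp add: sum.cartesian_product case_prod_unfold)
    also have "\<dots> = card {(a, t). t \<noteq> 0 \<and> borel_act a t (act weyl x) = x}"
      by (simp add: sum.If_cases) (auto intro!: arg_cong[where f=card])
    finally show "(\<Sum>a\<in>UNIV. \<Sum>t\<in>-{0}. if borel_act a t (act weyl x) = x then 1 else 0) =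
         card {(a, t). t \<noteq> 0 \<and> borel_act a t (act weyl x) = x}" .
  qed
  \<comment> \<open>Multiplied by \<open>card X\<close>, because the number of solutions is known
    only as a factor of such a product; the factor is cancelled at the end.\<close>
  also have "card X * \<dots> = card X * (CARD('k) * (CARD('k) - 1))"
    using card_borel_solutions[OF small] act_closed by (simp add: sum_distrib_left)
  finally have "(\<Sum>b\<in>-{0}. \<Sum>a\<in>UNIV. fix_count (upper a ** lower b)) = CARD('k) * (CARD('k) - 1)"
    using card_gt_1 by simp
  moreover have "(\<Sum>b\<in>UNIV. \<Sum>a\<in>UNIV. fix_count (upper a ** lower b)) =
      (\<Sum>a\<in>UNIV. fix_count (upper a ** lower 0)) + (\<Sum>b\<in>-{0}. \<Sum>a\<in>UNIV. fix_count (upper a ** lower b))"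
    using sum.remove[of UNIV "0::'k"] by (simp add: Compl_eq_Diff_UNIV)
  ultimately show ?thesis using b0 by simp
qed

end

section \<open>The trace inequality\<close>

text \<open>The q + 1 conjugates of the unipotent group, indexed by the point of the projective line
  that they fix, with \<open>None\<close> for infinity.\<close>

fun root_elt :: "'k::field option \<times> 'k \<Rightarrow> 'k^2^2" where
  "root_elt (None, a) = upper a"
| "root_elt (Some c, a) = upper c ** (lower a ** upper (-c))"

lemma det_root_elt [simp]: "det (root_elt p) = 1"
  by (cases p rule: root_elt.cases) simp_all

lemma root_elt_add: "root_elt (y, a) ** root_elt (y, b) = root_elt (y, a + b)"
  by (cases y) (simp_all add: SL2_defs mat2_mult mat2_eq_iff algebra_simps)

lemma root_elt_0: "root_elt (y, 0) = mat 1"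
  by (cases y) (simp_all add: SL2_defs mat2_mult)

context SL2_transitive_action begin

lemma act_eq_root_elt:
  assumes "x \<in> X"
  shows "act (root_elt (y, a)) x = act (root_elt (z, b)) x \<longleftrightarrow>
     act (root_elt (z, -b) ** root_elt (y, a)) x = x"
proof -
  have "act (root_elt (z, -b)) (act (root_elt (z, b)) x) = x"
    using assms by (simp add: act_mult[symmetric] root_elt_add root_elt_0 act_one)
  moreover have "act (root_elt (z, -b) ** root_elt (y, a)) x = act (root_elt (z, -b)) (act (root_elt (y, a)) x)"
    using assms by (simp add: act_mult)
  ultimately show ?thesis
    using assms act_closed act_inj[of "root_elt (z, -b)" "act (root_elt (y, a)) x" "act (root_elt (z, b)) x"]
    by simp
qed

lemma sum_fix_count_root_elt: "(\<Sum>a\<in>UNIV. fix_count (root_elt (y, a))) = sigma"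
proof (cases y)
  case None then show ?thesis by (simp add: sigma_def)
next
  case (Some c)
  have "fix_count (root_elt (y, a)) = fix_count (lower a)" for a
    unfolding Some root_elt.simps
    by (rule fix_count_conj[of "lower a" "upper c", symmetric])
      (simp_all add: SL2_defs mat2_mult mat2_eq_iff det_mat2 algebra_simps)
  then have "(\<Sum>a\<in>UNIV. fix_count (root_elt (y, a))) = (\<Sum>a\<in>UNIV. fix_count (upper (-a)))"
    by (simp add: fix_count_lower)
  also have "\<dots> = sigma" unfolding sigma_def
    by (rule sum.reindex_bij_witness[of _ uminus uminus]) auto
  finally show ?thesis .
qed

text \<open>The trace, in the permutation representation, of the product of the sums over two root
  groups.\<close>

definition pair_count :: "'k option \<Rightarrow> 'k option \<Rightarrow> nat" where
  "pair_count z y = (\<Sum>b\<in>UNIV. \<Sum>a\<in>UNIV. fix_count (root_elt (z, -b) ** root_elt (y, a)))"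

lemma pair_count_same: "pair_count y y = CARD('k) * sigma"
proof -
  have "(\<Sum>a\<in>UNIV. fix_count (root_elt (y, -b) ** root_elt (y, a))) = sigma" for b
  proof -
    have "(\<Sum>a\<in>UNIV. fix_count (root_elt (y, -b) ** root_elt (y, a))) =
       (\<Sum>a\<in>UNIV. fix_count (root_elt (y, a)))"
      unfolding root_elt_add
      by (rule sum.reindex_bij_witness[of _ "\<lambda>a. a + b" "\<lambda>a. a - b"]) auto
    then show ?thesis by (simp add: sum_fix_count_root_elt)
  qed
  then show ?thesis by (simp add: pair_count_def)
qed

definition ul_count :: nat where
  "ul_count = (\<Sum>b\<in>UNIV. \<Sum>a\<in>UNIV. fix_count (upper a ** lower b))"

lemma pair_count_None_Some: "pair_count (Some c) None = ul_count"
proof -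
  have "fix_count (root_elt (Some c, -b) ** root_elt (None, a)) = fix_count (upper a ** lower (-b))" for a b
  proof -
    have "fix_count (root_elt (Some c, -b) ** root_elt (None, a)) = fix_count (lower (-b) ** upper a)"
      by (rule fix_count_conj[of _ "upper (-c)"])
        (simp_all add: SL2_defs mat2_mult mat2_eq_iff det_mat2 algebra_simps)
    then show ?thesis by (simp add: fix_count_commute)
  qed
  then have "pair_count (Some c) None = (\<Sum>b\<in>UNIV. \<Sum>a\<in>UNIV. fix_count (upper a ** lower (-b)))"
    by (simp add: pair_count_def)
  also have "\<dots> = ul_count" unfolding ul_count_def
    by (rule sum.reindex_bij_witness[of _ uminus uminus]) auto
  finally show ?thesis .
qed

lemma pair_count_Some_None: "pair_count None (Some c) = ul_count"
proof -
  have "fix_count (root_elt (None, -b) ** root_elt (Some c, a)) = fix_count (upper (-b) ** lower a)" for a b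
    by (rule fix_count_conj[of _ "upper (-c)"])
      (simp_all add: SL2_defs mat2_mult mat2_eq_iff det_mat2 algebra_simps)
  then have "pair_count None (Some c) = (\<Sum>b\<in>UNIV. \<Sum>a\<in>UNIV. fix_count (upper (-b) ** lower a))"
    by (simp add: pair_count_def)
  also have "\<dots> = (\<Sum>b\<in>UNIV. \<Sum>a\<in>UNIV. fix_count (upper b ** lower a))"
    by (rule sum.reindex_bij_witness[of _ uminus uminus]) auto
  also have "\<dots> = ul_count" unfolding ul_count_def by (rule sum.swap)
  finally show ?thesis .
qed

text \<open>Double transitivity on the projective line: any two distinct root groups are
  simultaneously conjugate to the lower and the upper one.\<close>

lemma pair_count_Some_Some:
  assumes "c \<noteq> d" shows "pair_count (Some c) (Some d) = ul_count"
proof -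
  define e where "e = d - c"
  have e: "e \<noteq> 0" using assms by (simp add: e_def)
  have "fix_count (root_elt (Some c, -b) ** root_elt (Some d, a)) = fix_count (upper (- (e^2) * a) ** lower (-b))" for a b
  proof -
    \<comment> \<open>The conjugating matrix is built from points: \<open>upper (-c)\<close> moves c
      and d to 0 and e, then \<open>lower (-1/e)\<close> fixes 0 and moves e to infinity.\<close>
    have "fix_count (root_elt (Some c, -b) ** root_elt (Some d, a)) = fix_count (lower (-b) ** upper (- (e^2) * a))"
    proof (rule fix_count_conj[of _ "lower (-1/e) ** upper (-c)"])
      have d: "d = c + e" by (simp add: e_def)
      have 1: "upper (-c) ** (root_elt (Some c, -b) ** root_elt (Some d, a)) =
          lower (-b) ** ((upper e ** (lower a ** upper (-e))) ** upper (-c))"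
        unfolding d by (simp add: SL2_defs mat2_mult mat2_eq_iff algebra_simps)
      have 2: "lower (-1/e) ** (upper e ** (lower a ** upper (-e))) = upper (- (e^2) * a) ** lower (-1/e)"
        using e by (simp add: SL2_defs mat2_mult mat2_eq_iff field_simps power2_eq_square)
      have 3: "lower (-1/e) ** lower (-b) = lower (-b) ** (lower (-1/e) :: 'k^2^2)"
        by (simp add: SL2_defs mat2_mult mat2_eq_iff)
      let ?L = "lower (-1/e)" and ?U = "upper (-c)" and ?M = "upper e ** (lower a ** upper (-e))"
      have "?L ** ?U ** (root_elt (Some c, -b) ** root_elt (Some d, a)) =
          ?L ** (?U ** (root_elt (Some c, -b) ** root_elt (Some d, a)))"
        by (simp only: matrix_mul_assoc)
      also have "\<dots> = ?L ** (lower (-b) ** (?M ** ?U))" by (simp only: 1)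
      also have "\<dots> = (?L ** lower (-b)) ** ?M ** ?U" by (simp only: matrix_mul_assoc)
      also have "\<dots> = (lower (-b) ** ?L) ** ?M ** ?U" by (simp only: 3)
      also have "\<dots> = lower (-b) ** (?L ** ?M) ** ?U" by (simp only: matrix_mul_assoc)
      also have "\<dots> = lower (-b) ** (upper (- (e^2) * a) ** ?L) ** ?U" by (simp only: 2)
      finally show "?L ** ?U ** (root_elt (Some c, -b) ** root_elt (Some d, a)) =
          lower (-b) ** upper (- (e^2) * a) ** (?L ** ?U)"
        by (simp only: matrix_mul_assoc)
    qed simp_all
    then show ?thesis by (simp add: fix_count_commute)
  qed
  then have "pair_count (Some c) (Some d) =
      (\<Sum>b\<in>UNIV. \<Sum>a\<in>UNIV. fix_count (upper (- (e^2) * a) ** lower (-b)))"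
    by (simp add: pair_count_def)
  also have "\<dots> = (\<Sum>b\<in>UNIV. \<Sum>a\<in>UNIV. fix_count (upper a ** lower (-b)))"
  proof (rule sum.cong[OF refl])
    fix b :: 'k
    show "(\<Sum>a\<in>UNIV. fix_count (upper (- (e^2) * a) ** lower (-b))) =
        (\<Sum>a\<in>UNIV. fix_count (upper a ** lower (-b)))"
      by (rule sum.reindex_bij_witness[of _ "\<lambda>a. - a / e^2" "\<lambda>a. - (e^2) * a"]) (use e in auto)
  qed
  also have "\<dots> = ul_count" unfolding ul_count_def
    by (rule sum.reindex_bij_witness[of _ uminus uminus]) auto
  finally show ?thesis .
qed

lemma pair_count_distinct: "z \<noteq> y \<Longrightarrow> pair_count z y = ul_count"
  using pair_count_None_Some pair_count_Some_None pair_count_Some_Some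
  by (cases z; cases y) auto

lemma card_option_k: "CARD('k option) = CARD('k) + 1"
  by (simp add: card_UNIV_option)

lemma sum_pair_count: "(\<Sum>z\<in>UNIV. \<Sum>y\<in>UNIV. pair_count z y) =
    (CARD('k) + 1) * CARD('k) * (sigma + ul_count)"
proof -
  have "(\<Sum>y\<in>UNIV. pair_count z y) = CARD('k) * sigma + CARD('k) * ul_count" for z
  proof -
    have "(\<Sum>y\<in>UNIV. pair_count z y) = pair_count z z + (\<Sum>y\<in>UNIV - {z}. pair_count z y)"
      by (rule sum.remove) auto
    also have "(\<Sum>y\<in>UNIV - {z}. pair_count z y) = (\<Sum>y\<in>UNIV - {z}. ul_count)"
      by (intro sum.cong refl pair_count_distinct) auto
    finally show ?thesis by (simp add: pair_count_same card_Diff_singleton card_option_k)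
  qed
  then show ?thesis by (simp add: card_option_k algebra_simps)
qed

text \<open>The matrix, in the permutation representation, of the sum of all root elements over
  every root group and parameter; real valued for the sake of Cauchy--Schwarz.\<close>

definition incidence :: "'x \<Rightarrow> 'x \<Rightarrow> real" where
  "incidence x x' = (\<Sum>p\<in>UNIV. if act (root_elt p) x' = x then 1 else 0)"

lemma incidence_trace: "(\<Sum>x\<in>X. incidence x x) = (CARD('k) + 1) * sigma"
proof -
  have "(\<Sum>x\<in>X. incidence x x) = (\<Sum>p\<in>UNIV. \<Sum>x\<in>X. if act (root_elt p) x = x then 1 else 0)"
    unfolding incidence_def by (rule sum.swap)
  also have "\<dots> = (\<Sum>p\<in>UNIV. real (fix_count (root_elt p)))"
    by (intro sum.cong refl) (simp add: fix_count_indicator of_nat_sum if_distrib cong: if_cong)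
  also have "\<dots> = (\<Sum>y\<in>UNIV. \<Sum>a\<in>UNIV. real (fix_count (root_elt (y, a))))"
    by (simp add: sum.cartesian_product case_prod_unfold)
  also have "\<dots> = (\<Sum>y\<in>(UNIV::'k option set). real sigma)"
    by (simp flip: of_nat_sum add: sum_fix_count_root_elt)
  finally show ?thesis by (simp add: card_option_k algebra_simps)
qed

lemma incidence_total: "(\<Sum>x\<in>X. \<Sum>x'\<in>X. incidence x x') = card X * ((CARD('k) + 1) * CARD('k))"
proof -
  have "(\<Sum>x\<in>X. \<Sum>x'\<in>X. incidence x x') = (\<Sum>x'\<in>X. \<Sum>x\<in>X. incidence x x')" by (rule sum.swap)
  also have "\<dots> = (\<Sum>x'\<in>X. \<Sum>p\<in>UNIV. \<Sum>x\<in>X. if act (root_elt p) x' = x then 1 else 0)"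
    unfolding incidence_def by (intro sum.cong refl) (rule sum.swap)
  also have "\<dots> = (\<Sum>x'\<in>X. \<Sum>p\<in>(UNIV::('k option \<times> 'k) set). 1)"
    using finite_X act_closed by (intro sum.cong refl) (simp add: sum.delta')
  finally show ?thesis by (simp add: card_option_k card_cartesian_product flip: UNIV_Times_UNIV)
qed

text \<open>The squared Frobenius norm counts coincidences of two root elements at a point, which
  are the pair counts: q + 1 pairs of equal root groups and (q + 1) q of distinct ones.\<close>

lemma incidence_squares: "(\<Sum>x\<in>X. \<Sum>x'\<in>X. (incidence x x')^2) =
   (CARD('k) + 1) * CARD('k) * (sigma + ul_count)"
proof -
  have split: "(\<Sum>r\<in>UNIV. g r) = (\<Sum>z\<in>UNIV. \<Sum>b\<in>UNIV. g (z, b))" for g :: "'k option \<times> 'k \<Rightarrow> real"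
    by (simp add: sum.cartesian_product)
  have *: "(\<Sum>x\<in>X. (incidence x x')^2) =
      (\<Sum>z\<in>UNIV. \<Sum>b\<in>UNIV. \<Sum>y\<in>UNIV. \<Sum>a\<in>UNIV.
        if act (root_elt (z, -b) ** root_elt (y, a)) x' = x' then 1 else 0)" if x': "x' \<in> X" for x'
  proof -
    have "(\<Sum>x\<in>X. (incidence x x')^2) = (\<Sum>x\<in>X. \<Sum>r\<in>UNIV. \<Sum>p\<in>UNIV.
        (if act (root_elt r) x' = x then 1 else 0) * (if act (root_elt p) x' = x then 1 else 0))"
      by (simp add: incidence_def power2_eq_square sum_product)
    also have "\<dots> = (\<Sum>r\<in>UNIV. \<Sum>p\<in>UNIV. \<Sum>x\<in>X.
        (if act (root_elt r) x' = x then 1 else 0) * (if act (root_elt p) x' = x then 1 else 0))"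
      by (subst sum.swap, rule sum.cong[OF refl], rule sum.swap)
    also have "\<dots> = (\<Sum>r\<in>UNIV. \<Sum>p\<in>UNIV. if act (root_elt p) x' = act (root_elt r) x' then 1 else 0)"
    proof (intro sum.cong refl)
      fix r p :: "'k option \<times> 'k"
      have "(\<Sum>x\<in>X. (if act (root_elt r) x' = x then 1 else 0) * (if act (root_elt p) x' = x then 1 else 0)) =
        (\<Sum>x\<in>X. if act (root_elt r) x' = x then (if act (root_elt p) x' = act (root_elt r) x' then 1 else 0) else (0::real))"
        by (intro sum.cong refl) auto
      also have "\<dots> = (if act (root_elt p) x' = act (root_elt r) x' then 1 else 0)"
        using finite_X act_closed x' by (simp add: sum.delta')
      finally show "(\<Sum>x\<in>X. (if act (root_elt r) x' = x then 1 else 0) * (if act (root_elt p) x' = x then 1 else 0)) =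
        (if act (root_elt p) x' = act (root_elt r) x' then 1 else (0::real))" .
    qed
    also have "\<dots> = (\<Sum>z\<in>UNIV. \<Sum>b\<in>UNIV. \<Sum>y\<in>UNIV. \<Sum>a\<in>UNIV.
        if act (root_elt (y, a)) x' = act (root_elt (z, b)) x' then 1 else 0)"
      by (simp only: split)
    finally show ?thesis by (simp only: act_eq_root_elt[OF x'])
  qed
  have "(\<Sum>x\<in>X. \<Sum>x'\<in>X. (incidence x x')^2) = (\<Sum>x'\<in>X. \<Sum>x\<in>X. (incidence x x')^2)" by (rule sum.swap)
  also have "\<dots> = (\<Sum>x'\<in>X. \<Sum>z\<in>UNIV. \<Sum>b\<in>UNIV. \<Sum>y\<in>UNIV. \<Sum>a\<in>UNIV.
        if act (root_elt (z, -b) ** root_elt (y, a)) x' = x' then 1 else 0)"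
    by (intro sum.cong refl *)
  also have "\<dots> = (\<Sum>z\<in>UNIV. \<Sum>b\<in>UNIV. \<Sum>y\<in>UNIV. \<Sum>a\<in>UNIV. \<Sum>x'\<in>X.
        if act (root_elt (z, -b) ** root_elt (y, a)) x' = x' then 1 else 0)"
    by (subst sum.swap, intro sum.cong refl, subst sum.swap, intro sum.cong refl,
        subst sum.swap, intro sum.cong refl, rule sum.swap)
  also have "\<dots> = (\<Sum>z\<in>UNIV. \<Sum>b\<in>UNIV. \<Sum>y\<in>UNIV. \<Sum>a\<in>UNIV.
        real (fix_count (root_elt (z, -b) ** root_elt (y, a))))"
    by (intro sum.cong refl) (simp add: fix_count_indicator of_nat_sum if_distrib cong: if_cong)
  also have "\<dots> = real (\<Sum>z\<in>UNIV. \<Sum>b\<in>UNIV. \<Sum>y\<in>UNIV. \<Sum>a\<in>UNIV.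
        fix_count (root_elt (z, -b) ** root_elt (y, a)))" by simp
  also have "(\<Sum>z\<in>UNIV. \<Sum>b\<in>UNIV. \<Sum>y\<in>UNIV. \<Sum>a\<in>UNIV.
        fix_count (root_elt (z, -b) ** root_elt (y, a))) = (\<Sum>z\<in>UNIV. \<Sum>y\<in>UNIV. pair_count z y)"
    unfolding pair_count_def by (intro sum.cong refl) (rule sum.swap)
  finally show ?thesis by (simp add: sum_pair_count)
qed

text \<open>
  Cauchy--Schwarz for the inner product of the centred incidence matrix with the projection
  \<open>I - J/N\<close> onto the functions of sum zero.
\<close>
lemma sigma_bound:
  assumes small: "card X \<le> CARD('k)"
  shows "(CARD('k) + 1) * sigma \<le> (CARD('k) + 1) * CARD('k) + 2 * CARD('k) * (card X - 1)"
\<comment> \<open>Cauchy--Schwarz yields the bound only after multiplication by (q + 1)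
  (\<open>sigma\<close> - q), so the case where this factor is not positive is split off.\<close>
proof (cases "sigma \<le> CARD('k)")
  case True
  then show ?thesis by (meson le_add1 mult_le_mono2 order_trans)
next
  case False
  define q N s where "q = real CARD('k)" and "N = real (card X)" and "s = real sigma"
  \<comment> \<open>Every column of \<open>incidence\<close> sums to q (q + 1), the number of
    indices of root elements, so q (q + 1) / N is the mean entry.\<close>
  define A where "A = (\<lambda>(x::'x, x'::'x). incidence x x' - q * (q + 1) / N)"
  define E where "E = (\<lambda>(x::'x, x'::'x). (if x = x' then 1 else 0) - 1 / N)"
  have N: "N > 0" "N = of_nat (card X)" using card_gt_1 by (simp_all add: N_def)
  have XX: "finite (X \<times> X)" using finite_X by simp
  have total: "(\<Sum>p\<in>X\<times>X. incidence (fst p) (snd p)) = N * (q * (q + 1))"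
    using incidence_total by (simp add: sum.cartesian_product case_prod_unfold N_def q_def algebra_simps)
  have ul: "real ul_count = s + q * (q - 1)"
    using sum_fix_count_upper_lower[OF small] by (simp add: ul_count_def s_def q_def of_nat_diff Suc_leI)
  have sq: "(\<Sum>p\<in>X\<times>X. (incidence (fst p) (snd p))^2) = (q + 1) * q * (2 * s + q * (q - 1))"
    using incidence_squares ul
    by (simp add: sum.cartesian_product case_prod_unfold q_def s_def algebra_simps)
  have diag: "(\<Sum>p\<in>X\<times>X. (if fst p = snd p then f (fst p) (snd p) else 0)) = (\<Sum>x\<in>X. f x x)" for f :: "'x \<Rightarrow> 'x \<Rightarrow> real"
  proof -
    have "(\<Sum>x\<in>X. \<Sum>y\<in>X. if x = y then f x y else 0) = (\<Sum>x\<in>X. \<Sum>y\<in>X. if x = y then f x x else 0)"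
      by (intro sum.cong refl) auto
    also have "\<dots> = (\<Sum>x\<in>X. f x x)" using finite_X by (simp add: sum.delta')
    finally show ?thesis by (simp add: sum.cartesian_product case_prod_unfold)
  qed
  have cardXX: "real (card (X \<times> X)) = N * N" by (simp add: card_cartesian_product N_def)
  have AE: "(\<Sum>p\<in>X\<times>X. A p * E p) = (q + 1) * (s - q)"
  proof -
    have "A p * E p = (if fst p = snd p then incidence (fst p) (snd p) - q * (q+1) / N else 0)
        - incidence (fst p) (snd p) / N + q * (q+1) / N / N" for p
      using N(1) by (simp add: A_def E_def case_prod_unfold field_simps)
    then have "(\<Sum>p\<in>X\<times>X. A p * E p) = (\<Sum>x\<in>X. incidence x x - q * (q+1) / N)
        - N * (q * (q + 1)) / N + N * N * (q * (q+1) / N / N)"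
      by (simp add: sum.distrib sum_subtractf diag[of "\<lambda>x y. incidence x y - q * (q+1) / N"] total cardXX
          flip: sum_divide_distrib)
    also have "\<dots> = (q + 1) * s - N * (q * (q+1) / N)"
      using incidence_trace N by (simp add: sum_subtractf q_def s_def distrib_right)
    also have "\<dots> = (q + 1) * (s - q)" using N(1) by (simp add: right_diff_distrib left_diff_distrib mult.commute)
    finally show ?thesis .
  qed
  have AA: "(\<Sum>p\<in>X\<times>X. (A p)^2) = 2 * (q + 1) * q * (s - q)"
  proof -
    define k where "k = q * (q+1) / N"
    have k: "N * k = q * (q + 1)" using N(1) by (simp add: k_def)
    have "(A p)^2 = (incidence (fst p) (snd p))^2 - (2 * k) * incidence (fst p) (snd p) + k^2" for p
    proof -
      have Ap: "A p = incidence (fst p) (snd p) - k" by (simp add: A_def k_def case_prod_unfold)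
      show ?thesis unfolding Ap by (simp add: power2_eq_square algebra_simps)
    qed
    then have "(\<Sum>p\<in>X\<times>X. (A p)^2) = (\<Sum>p\<in>X\<times>X. (incidence (fst p) (snd p))^2)
       - (2 * k) * (\<Sum>p\<in>X\<times>X. incidence (fst p) (snd p)) + (\<Sum>p\<in>X\<times>X. k^2)"
      by (simp only: sum.distrib sum_subtractf sum_distrib_left)
    also have "\<dots> = (q + 1) * q * (2 * s + q * (q - 1)) - 2 * k * (N * (q * (q + 1))) + N * N * k^2"
      by (simp only: sq total sum_constant cardXX)
    also have "\<dots> = (q + 1) * q * (2 * s + q * (q - 1)) - 2 * (N * k) * (q * (q + 1)) + (N * k)^2"
      by (simp add: power2_eq_square)
    also have "\<dots> = (q + 1) * q * (2 * s + q * (q - 1)) - (q * (q+1))^2"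
      unfolding k by (simp add: power2_eq_square)
    also have "\<dots> = 2 * (q + 1) * q * (s - q)" by (simp add: power2_eq_square algebra_simps)
    finally show ?thesis .
  qed
  have EE: "(\<Sum>p\<in>X\<times>X. (E p)^2) = N - 1"
  proof -
    have "(E p)^2 = (if fst p = snd p then 1 - 2 / N else 0) + 1 / N / N" for p
      by (simp add: E_def case_prod_unfold power2_eq_square algebra_simps)
    then have "(\<Sum>p\<in>X\<times>X. (E p)^2) = (\<Sum>x\<in>X. 1 - 2 / N) + N * N * (1 / N / N)"
      by (simp add: sum.distrib diag[of "\<lambda>x y. 1 - 2/N"] cardXX)
    also have "\<dots> = N - 1" using N by (simp add: field_simps)
    finally show ?thesis .
  qed
  have "((q + 1) * (s - q))^2 \<le> 2 * (q + 1) * q * (s - q) * (N - 1)"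
    using Cauchy_Schwarz_ineq_sum[of A E "X \<times> X"] by (simp only: AE AA EE)
  then have "((q + 1) * (s - q)) * ((q + 1) * (s - q)) \<le> ((q + 1) * (s - q)) * (2 * q * (N - 1))"
    by (simp add: power2_eq_square algebra_simps)
  moreover have "(q + 1) * (s - q) > 0"
    using False by (intro mult_pos_pos) (simp_all add: q_def s_def)
  ultimately have "(q + 1) * (s - q) \<le> 2 * q * (N - 1)" by (simp only: mult_le_cancel_left_pos)
  then have "(q + 1) * s \<le> (q + 1) * q + 2 * q * (N - 1)" by (simp add: algebra_simps)
  then have "real ((CARD('k) + 1) * sigma) \<le> real ((CARD('k) + 1) * CARD('k) + 2 * CARD('k) * (card X - 1))"
    using card_gt_1 by (simp add: q_def N_def s_def of_nat_diff distrib_right)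
  then show ?thesis by (simp only: of_nat_le_iff)
qed

end

section \<open>Small degree forces a regular unipotent group\<close>

context SL2_action begin

text \<open>The unipotent group has order l^r, so its orbits, none of them a single point, have size
  divisible by l.\<close>

lemma prime_dvd_card:
  assumes "prime l" "CARD('k) = l ^ r" and moves: "\<And>x. x \<in> X \<Longrightarrow> \<exists>a. act (upper a) x \<noteq> x"
  shows "l dvd card X"
proof -
  have "l dvd sum (\<lambda>_. 1) X"
  proof (rule dvd_sum_orbits)
    fix x assume x: "x \<in> X"
    have "card (orb x) dvd l ^ r" using card_orb_stab[OF x] assms by (metis dvd_triv_left)
    then obtain i where i: "card (orb x) = l ^ i" using assms(1) by (auto simp: divides_primepow_nat)
    obtain a where a: "act (upper a) x \<noteq> x" using moves[OF x] by blast
    have "{x, act (upper a) x} \<subseteq> orb x" using orb_self[OF x] by (auto simp: orb_def)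
    then have "card {x, act (upper a) x} \<le> card (orb x)" by (rule card_mono[rotated]) (simp add: orb_def)
    then have "i \<noteq> 0" using a i by (cases "i = 0") auto
    then show "l dvd sum (\<lambda>_. 1) (orb x)" using i by simp
  qed (use act_closed in auto)
  then show ?thesis by simp
qed

end

context SL2_transitive_action begin

lemma two_sigma: "2 * sigma = 2 * card X + (CARD('k) - 1) * class_count X"
  using sum_fix_count_on[OF borel_invariant_X] by (simp add: sigma_def fix_count_upper)

text \<open>Inserting \<open>two_sigma\<close> into \<open>sigma_bound\<close> gives (q + 1) c \<le>
  2 (q + 1 + |X| - 1) < 4 (q + 1) for the class count c.\<close>

lemma class_count_le_3:
  assumes small: "card X \<le> CARD('k)"
  shows "class_count X \<le> 3"
proof -
  \<comment> \<open>This \<open>q\<close> is the order of the field minus one, and \<open>m\<close>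
    below is the degree minus one; truncated subtraction thus stays out of the estimate.\<close>
  define q where "q = CARD('k) - 1"
  have q: "CARD('k) = Suc q" using small card_gt_1 by (simp add: q_def)
  have "q > 0" using small card_gt_1 q by simp
  obtain m where m: "card X = Suc m" using card_gt_1 by (cases "card X") auto
  let ?s = "class_count X"
  have "(q + 2) * (2 * sigma) \<le> 2 * ((q + 2) * Suc q + 2 * Suc q * m)"
    using sigma_bound[OF small] m q by simp
  then have "(q + 2) * (2 * Suc m + q * ?s) \<le> 2 * ((q + 2) * Suc q + 2 * Suc q * m)"
    using two_sigma m q by simp
  then have "q * ((q + 2) * ?s) \<le> q * (2 * (q + 2 + m))"
    by (simp add: algebra_simps)
  then have "(q + 2) * ?s \<le> 2 * (q + 2 + m)" using nat_mult_le_cancel1[OF \<open>q > 0\<close>] by blast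
  also have "\<dots> < (q + 2) * 4" using m q small by simp
  finally have "?s < 4" by (simp only: mult_less_cancel1)
  then show ?thesis by simp
qed

text \<open>The class count c is at most 3, q divides 2 |X| - c, and l divides |X|. What has to be
  excluded is c = 2 for even q, by parity, and c = 3 for l = 3, by the size of orbits. With c = 0
  the divisibility forces |X| = q, and nontrivial unipotent elements have no fixed points.\<close>

lemma upper_regular:
  assumes l: "prime l" "CARD('k) = l ^ r" and small: "card X \<le> CARD('k)" and big: "CARD('k) > 9"
  shows "card X = CARD('k)" "x \<in> X \<Longrightarrow> act (upper a) x = x \<Longrightarrow> a = 0"
proof -
  let ?s = "class_count X" and ?q = "CARD('k)"
  have lX: "l dvd card X" by (rule prime_dvd_card[OF l upper_moves[OF _ small]])
  have pos: "?s < 2 * card X"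
    using class_count_less[OF borel_invariant_X] card_gt_1 upper_moves[OF _ small] by fastforce
  have dvd: "?q dvd 2 * card X - ?s" by (rule class_count_dvd(2)[OF borel_invariant_X])
  have lq: "l dvd ?q" using l(2) big by (cases r) auto
  have s3: "?s \<le> 3" by (rule class_count_le_3[OF small])
  have "?s = 0 \<and> card X = ?q"
  proof (cases "l = 2")
    case True
    then have "even ?q" using lq by simp
    then have "second_class = (1 :: 'k)" by (rule second_class_even)
    then have s: "?s = 2 * fix_count_on X 1" by (simp add: class_count_def)
    then have f: "fix_count_on X 1 \<le> 1" using s3 by simp
    \<comment> \<open>For even q the doubled relation loses a factor 2, so the divisibility of
      \<open>sigma\<close> itself is used.\<close>
    have "?q dvd sigma"
      using dvd_sum_fix_count_on[OF borel_invariant_X] by (simp add: sigma_def fix_count_upper)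
    moreover have "sigma = card X + (?q - 1) * fix_count_on X 1" using two_sigma s by simp
    ultimately have d: "?q dvd card X + (?q - 1) * fix_count_on X 1" by simp
    have "even (card X)" using lX True by simp
    have "fix_count_on X 1 = 0"
    proof (rule ccontr)
      assume "fix_count_on X 1 \<noteq> 0"
      then have "fix_count_on X 1 = 1" using f by simp
      then have "even (card X + (?q - 1))" using d \<open>even ?q\<close> by (metis dvd_trans mult.right_neutral)
      then have "even (?q - 1)" using \<open>even (card X)\<close> by simp
      then show False using \<open>even ?q\<close> big by simp
    qed
    then show ?thesis using d s small card_gt_1 by (auto dest: dvd_imp_le)
  next
    case False
    then have l3: "l \<ge> 3" using prime_ge_2_nat[OF l(1)] by simp
    have "odd l" using l(1) l3 by (simp add: prime_odd_nat)
    then have odd: "odd ?q" using l(2) by simp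
    have "l dvd 2 * card X - ?s" using dvd lq by (rule dvd_trans[rotated])
    then have "l dvd ?s" using lX pos
      by (metis dvd_diffD1 dvd_mult less_imp_le_nat)
    then have "?s = 0 \<or> ?s = 3" using s3 l3 by (auto dest: dvd_imp_le simp: le_Suc_eq numeral_3_eq_3)
    then show ?thesis
    proof
      assume s0: "?s = 0"
      then have "?q dvd card X" using dvd odd by (simp add: coprime_dvd_mult_right_iff)
      then show ?thesis using s0 small card_gt_1 by (auto dest: dvd_imp_le)
    next
      \<comment> \<open>Here 2 |X| = q + 3, so no orbit is free. A unipotent element that fixes a
        point fixes its whole orbit, so orbits have at most three points, which forces |X| \<le> 6
        and q \<le> 9. The action of A6, which is PSL(2, 9), on six points is of this kind.\<close>
      assume s: "?s = 3"
      obtain m where m: "2 * card X - 3 = ?q * m" using dvd s by (auto elim: dvdE)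
      have "?q * m < ?q * 2" using m small big by linarith
      then have "m < 2" by simp
      moreover have "m \<noteq> 0" using m pos s by (intro notI) simp
      ultimately have "m = 1" by simp
      then have X: "2 * card X = ?q + 3" using m pos s by simp
      have st: "?q \<le> 3 * card (stab x)" if x: "x \<in> X" for x
      proof -
        have "orb x \<subseteq> X" by (rule orb_subset[OF x])
        then have "card (orb x) \<le> card X" by (rule card_mono[OF finite_X])
        then have "card (orb x) < ?q" using X big by simp
        then have "card (stab x) \<noteq> 1" using card_orb_stab[OF x] by auto
        moreover have "0 \<in> stab x" using x by (simp add: stab_def act_upper_0)
        ultimately have "\<not> stab x \<subseteq> {0}" by (auto simp: subset_singleton_iff)
        then obtain a where a: "a \<in> stab x" "a \<noteq> 0" by blast
        have "orb x \<subseteq> {y\<in>X. act (upper a) y = y}"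
        proof
          fix y assume y: "y \<in> orb x"
          then have "a \<in> stab y" using stab_eq[OF x y] a by simp
          then show "y \<in> {y\<in>X. act (upper a) y = y}" using y orb_subset[OF x] by (auto simp: stab_def)
        qed
        then have "card (orb x) \<le> fix_count_on X a"
          unfolding fix_count_on_def by (rule card_mono[rotated]) (use finite_X in simp)
        also have "\<dots> \<le> ?s"
          using fix_count_on_class[OF borel_invariant_X a(2)] by (auto simp: class_count_def)
        finally have "card (orb x) \<le> 3" using s by simp
        then show ?thesis using card_orb_stab[OF x] by (metis mult_le_mono1)
      qed
      have "(\<Sum>x\<in>X. ?q) \<le> (\<Sum>x\<in>X. 3 * card (stab x))" by (intro sum_mono st)
      also have "\<dots> = 3 * sigma"
        by (simp add: sum_stab sigma_def fix_count_upper flip: sum_distrib_left)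
      finally have "card X * ?q \<le> 3 * sigma" by simp
      moreover have "2 * sigma = 4 * ?q"
        using two_sigma s X big by (simp add: algebra_simps)
      ultimately have "card X * ?q \<le> 6 * ?q" by simp
      then have "card X \<le> 6" using big by simp
      then show ?thesis using X big by simp
    qed
  qed
  then show "card X = ?q" and "x \<in> X \<Longrightarrow> act (upper a) x = x \<Longrightarrow> a = 0"
  proof -
    assume *: "?s = 0 \<and> card X = ?q"
    show "card X = ?q" using * by simp
    assume x: "x \<in> X" "act (upper a) x = x"
    show "a = 0"
    proof (rule ccontr)
      assume "a \<noteq> 0"
      then have "fix_count_on X a = 0"
        using fix_count_on_class[OF borel_invariant_X] * by (metis add_is_0 class_count_def)
      then show False using x finite_X by (auto simp: fix_count_on_def)
    qed
  qed
qed

end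

section \<open>The regular case\<close>

lemma card_quadratic_roots_le_2:
  fixes a b c :: "'k::idom"
  assumes "a \<noteq> 0" shows "finite {x. a * x^2 + b * x + c = 0}" "card {x. a * x^2 + b * x + c = 0} \<le> 2"
proof -
  have "{x. a * x^2 + b * x + c = 0} = {x. poly [:c, b, a:] x = 0}"
    by (auto simp: power2_eq_square algebra_simps)
  moreover have "[:c, b, a:] \<noteq> 0" "degree [:c, b, a:] = 2" using assms by auto
  ultimately show "finite {x. a * x^2 + b * x + c = 0}" "card {x. a * x^2 + b * x + c = 0} \<le> 2"
    using poly_roots_finite[of "[:c, b, a:]"] card_poly_roots_bound[of "[:c, b, a:]"] by auto
qed

lemma even_card_involution:
  assumes "finite A" "\<And>x. x \<in> A \<Longrightarrow> \<sigma> x \<in> A \<and> \<sigma> x \<noteq> x \<and> \<sigma> (\<sigma> x) = x"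
  shows "even (card A)"
  using assms
proof (induction "card A" arbitrary: A rule: less_induct)
  case less
  show ?case
  proof (cases "A = {}")
    case False
    then obtain x where x: "x \<in> A" by blast
    let ?B = "A - {x, \<sigma> x}"
    have sx: "\<sigma> x \<in> A" "\<sigma> x \<noteq> x" "\<sigma> (\<sigma> x) = x" using less.prems(2)[OF x] by auto
    have two: "card {x, \<sigma> x} = 2" using sx by auto
    have cA: "card A = card ?B + 2"
      using x sx two less.prems(1) card_Diff_subset[of "{x, \<sigma> x}" A] card_mono[of A "{x, \<sigma> x}"] by simp
    have "even (card ?B)"
    proof (rule less.hyps)
      show "card ?B < card A" using cA by simp
      fix y assume y: "y \<in> ?B"
      then have *: "\<sigma> y \<in> A" "\<sigma> y \<noteq> y" "\<sigma> (\<sigma> y) = y" using less.prems(2) by auto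
      moreover have "\<sigma> y \<noteq> x" "\<sigma> y \<noteq> \<sigma> x" using y * sx by (metis DiffE insertCI)+
      ultimately show "\<sigma> y \<in> ?B \<and> \<sigma> y \<noteq> y \<and> \<sigma> (\<sigma> y) = y" by simp
    qed (use less.prems in simp)
    then show ?thesis using cA by simp
  qed simp
qed

text \<open>
  The data of a permutation of \<open>F\<close> fixing \<open>0\<close> that plays the role of \<open>x \<mapsto> -1/x\<close> for
  the translations and the dilations by squares.
\<close>
locale affine_weyl =
  fixes f :: "'k::{field,finite} \<Rightarrow> 'k"
  assumes f0: "f 0 = 0"
    and f_scale: "s \<noteq> 0 \<Longrightarrow> f (s^2 * a) = f a / s^2"
    and f_braid: "s \<noteq> 0 \<Longrightarrow> f (1/s + f x) = s^2 * f (x - s) - s"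
    and f_invol: "f (f x) = x"
begin

lemma f_nonzero: "a \<noteq> 0 \<Longrightarrow> f a \<noteq> 0"
  using f0 f_invol by metis

text \<open>The braid relation at x = 0 with s = 1/a.\<close>

lemma f_neg: assumes "a \<noteq> 0" shows "a * f a + (-a) * f (-a) = -1"
proof -
  have "f (1/(1/a) + f 0) = (1/a)^2 * f (0 - 1/a) - 1/a"
    using assms by (intro f_braid) simp
  moreover have "f (0 - 1/a) = f (-a) / (1/a)^2"
    using f_scale[of "1/a" "-a"] assms by (simp add: power2_eq_square)
  ultimately have "f a = f (-a) - 1/a" using assms f0 by simp
  then have "f a - f (-a) = - 1/a" by simp
  moreover have "a * f a + (-a) * f (-a) = a * (f a - f (-a))" by (simp add: algebra_simps)
  ultimately show ?thesis using assms by simp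
qed

text \<open>A constant c must be -1/2 by \<open>f_neg\<close>, so f a = -1/(2 a), and the braid
  relation at s = 1 becomes one quadratic equation for all x outside {0, 1, 1/2}. For q = 5 its two
  roots are just the two remaining elements, in accordance with the action of PSL(2, 5) on five
  points.\<close>

lemma not_constant:
  assumes big: "CARD('k) > 5" and const: "\<And>a. a \<noteq> 0 \<Longrightarrow> a * f a = c"
  shows False
proof -
  have 1: "1 * f 1 = c" and 2: "(-1) * f (-1) = c" by (rule const, simp)+
  have cc: "c + c = -1" using f_neg[OF one_neq_zero] unfolding 1 2 .
  have two: "(2::'k) \<noteq> 0"
  proof
    assume "(2::'k) = 0"
    then have "c + c = 0" using mult_2[of c] by simp
    then show False using cc by simp
  qed
  have c: "c = -1/2"
  proof -
    have "2 * c = -1" using cc by (simp only: mult_2)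
    then show ?thesis using two by (simp add: field_simps)
  qed
  have f: "f a = -1 / (2 * a)" if "a \<noteq> 0" for a
    using const[OF that] that two by (simp add: c field_simps)
  have "2 * x^2 + (-2) * x + 1 = 0" if x: "x \<notin> {0, 1, 1/2}" for x :: 'k
  proof -
    have nz: "x \<noteq> 0" "x - 1 \<noteq> 0" "2 * x - 1 \<noteq> 0" using x two by (auto simp: field_simps)
    have "1 + f x = (2 * x - 1) / (2 * x)" using nz two by (simp add: f field_simps)
    then have z0: "1 + f x \<noteq> 0" using nz two by simp
    have z: "2 * (1 + f x) = (2 * x - 1) / x"
      using nz two by (simp add: f distrib_left diff_divide_distrib)
    have "f (1 + f x) = - x / (2 * x - 1)" unfolding f[OF z0] z by simp
    moreover have "f (1 + f x) = f (x - 1) - 1" using f_braid[of 1 x] by simp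
    ultimately have "- x / (2 * x - 1) = -1 / (2 * (x - 1)) - 1" using f[OF nz(2)] by simp
    then have "- x * (2 * (x - 1)) = (-1 - 2 * (x - 1)) * (2 * x - 1)"
      using nz two by (simp add: divide_simps)
    then show ?thesis by (simp add: power2_eq_square algebra_simps)
  qed
  then have "- {0, 1, 1/2} \<subseteq> {x::'k. 2 * x^2 + (-2) * x + 1 = 0}" by auto
  then have "card (- {0, 1, 1/2::'k}) \<le> 2"
    using card_quadratic_roots_le_2[OF two, of "-2" 1] card_mono order_trans by blast
  moreover have "card (- {0, 1, 1/2::'k}) \<ge> CARD('k) - 3"
  proof -
    have "card {0, 1, 1/2::'k} \<le> 3" by (simp add: card_insert_if)
    then show ?thesis unfolding Compl_eq_Diff_UNIV by (simp add: card_Diff_subset)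
  qed
  ultimately show False using big by simp
qed

definition sq :: "'k \<Rightarrow> bool" where "sq a \<longleftrightarrow> (\<exists>t. t \<noteq> 0 \<and> a = t^2)"

lemma sq_mult: "sq a \<Longrightarrow> sq b \<Longrightarrow> sq (a * b)"
  unfolding sq_def by (metis mult_eq_0_iff power_mult_distrib)

text \<open>If -1 is a square, f is odd and a * f a is constant by \<open>f_neg\<close>. Otherwise a
  * f a has one value on squares and another on nonsquares; for each pattern of square classes the
  braid relation at s = 1 is a quadratic equation, and counting roots leaves q \<le> 17. The
  congruence q = 3 modulo 4 does the rest.\<close>

lemma contradiction:
  assumes big: "CARD('k) > 11" and l: "prime l" "CARD('k) = l ^ r"
  shows False
proof (cases "\<exists>i::'k. i^2 = -1")
  case True
  then obtain i :: 'k where i: "i^2 = -1" by blast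
  have i0: "i \<noteq> 0" using i by auto
  have "a * f a + a * f a = -1" if "a \<noteq> 0" for a
  proof -
    \<comment> \<open>Scaling by i, with i^2 = -1. Characteristic 2 belongs to this case and is
      refuted by 2 (a * f a) = -1.\<close>
    have "f (-a) = - f a" using f_scale[OF i0, of a] i by simp
    then show ?thesis using f_neg[OF that] by simp
  qed
  then have two: "2 * (a * f a) = -1" if "a \<noteq> 0" for a
    using that by (metis mult_2)
  have "(2::'k) \<noteq> 0" using two[of 1] by auto
  then have half: "a * f a = -1/2" if "a \<noteq> 0" for a
    using two[OF that] by (simp add: field_simps)
  show False by (rule not_constant[OF _ half]) (use big in simp_all)
next
  case False
  then have neg1: "\<not> sq (-1)" by (auto simp: sq_def)
  have sq_cases: "sq (-a)" if a: "a \<noteq> 0" "\<not> sq a" for a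
  proof -
    obtain t where t: "t \<noteq> 0" "a = t^2 * second_class" using second_class_cases[OF a(1)] a by (auto simp: sq_def)
    obtain s where s: "s \<noteq> 0" "-1 = s^2 * (second_class::'k)"
      using second_class_cases[of "-1::'k"] neg1 by (auto simp: sq_def)
    have nu: "second_class = - 1 / s^2" using s by (simp add: field_simps)
    have "-a = (t/s)^2" unfolding t(2) nu by (simp add: power_divide)
    then show ?thesis using s t unfolding sq_def by (intro exI[of _ "t/s"]) simp
  qed
  have sq_neg: "\<not> sq (-a)" if sa: "sq a" for a
  proof
    assume "sq (-a)"
    obtain t where t: "t \<noteq> 0" "a = t^2" using sa by (auto simp: sq_def)
    then have "sq (1/a)" unfolding sq_def by (intro exI[of _ "1/t"]) (simp add: power_one_over)
    then have "sq (-a * (1/a))" using \<open>sq (-a)\<close> sq_mult by blast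
    then show False using neg1 t by simp
  qed
  define c where "c = f 1"
  define c' where "c' = - f (-1)"
  define G where "G b = (if b then c else c')" for b
  have g: "a * f a = G (sq a)" if a: "a \<noteq> 0" for a
  proof (cases "sq a")
    case True
    then obtain t where t: "t \<noteq> 0" "a = t^2" by (auto simp: sq_def)
    then have "f a = c / t^2" using f_scale[OF t(1), of 1] by (simp add: c_def)
    then show ?thesis using t True by (simp add: G_def)
  next
    case False
    then obtain t where t: "t \<noteq> 0" "-a = t^2" using sq_cases[OF a] by (auto simp: sq_def)
    then have "a = t^2 * (-1)" by (metis minus_minus mult_minus1_right)
    then have "f a = - c' / t^2" using f_scale[OF t(1), of "-1"] by (simp add: c'_def)
    then show ?thesis using t False \<open>a = t^2 * (-1)\<close> by (simp add: G_def)
  qed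
  have fG: "f a = G (sq a) / a" if a: "a \<noteq> 0" for a using g[OF a] a by (simp add: field_simps)
  have cc': "c \<noteq> c'"
  proof
    assume "c = c'"
    then have const: "a * f a = c" if "a \<noteq> 0" for a using g[OF that] by (simp add: G_def)
    show False by (rule not_constant[OF _ const]) (use big in simp_all)
  qed
  \<comment> \<open>The product a * f a is symmetric in a and f a, as f is an involution; since c
    and c' differ, it determines the square class.\<close>
  have sq_f: "sq (f a) \<longleftrightarrow> sq a" if a: "a \<noteq> 0" for a
  proof -
    have "G (sq (f a)) = G (sq a)"
      using g[OF a] g[OF f_nonzero[OF a]] f_invol[of a] by (simp add: mult.commute)
    then show ?thesis using cc' by (auto simp: G_def split: if_splits)
  qed
  have sq1: "sq 1" unfolding sq_def by (intro exI[of _ 1]) simp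
  have sqc: "sq c" using sq_f[of 1] sq1 by (simp add: c_def)
  have sqc': "sq c'"
  proof -
    have "\<not> sq (f (-1))" using sq_f[of "-1"] neg1 by simp
    then show ?thesis unfolding c'_def using sq_cases f_nonzero[of "-1"] by simp
  qed
  have sqG: "sq (G b)" for b using sqc sqc' by (simp add: G_def)
  \<comment> \<open>G takes square values only and -1 is a nonsquare, so the leading coefficients G
    b + 1 of the quadratics below never vanish.\<close>
  have G1: "G b + 1 \<noteq> 0" for b
  proof
    assume "G b + 1 = 0"
    then have "G b = -1" by (simp add: eq_neg_iff_add_eq_0)
    then show False using sqG[of b] neg1 by simp
  qed
  define E where "E = {x. x \<noteq> 0 \<and> x \<noteq> 1 \<and> 1 + f x \<noteq> 0}"
  \<comment> \<open>The braid relation at s = 1 evaluates f at x, 1 + f x and x - 1; once their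
    square classes are known, each value is c or c' divided by the argument.\<close>
  define pat where "pat x = (sq x, sq (1 + f x), sq (x - 1))" for x
  have quad: "(G b2 + 1) * x^2 + (G b1 - G b2 - G b3 - 1) * x + (- G b1 * (G b3 + 1)) = 0"
    if x: "x \<in> E" "pat x = (b1, b2, b3)" for x b1 b2 b3
  proof -
    have nz: "x \<noteq> 0" "x - 1 \<noteq> 0" "1 + f x \<noteq> 0" using x by (auto simp: E_def)
    have b: "sq x = b1" "sq (1 + f x) = b2" "sq (x - 1) = b3" using x by (auto simp: pat_def)
    have fx: "f x = G b1 / x" using fG[OF nz(1)] b by simp
    then have "1 + f x = (x + G b1) / x" using nz by (simp add: field_simps)
    then have nz': "x + G b1 \<noteq> 0" using nz by auto
    have "f (1 + f x) = G b2 * x / (x + G b1)"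
      using fG[OF nz(3)] b \<open>1 + f x = _\<close> by simp
    moreover have "f (1 + f x) = f (x - 1) - 1" using f_braid[of 1 x] by simp
    moreover have "f (x - 1) = G b3 / (x - 1)" using fG[OF nz(2)] b by simp
    ultimately have "G b2 * x / (x + G b1) = G b3 / (x - 1) - 1" by simp
    then have "G b2 * x * (x - 1) = (G b3 - (x - 1)) * (x + G b1)"
      using nz nz' by (simp add: divide_simps)
    then show ?thesis by (simp add: power2_eq_square algebra_simps)
  qed
  have le2: "card {x\<in>E. pat x = p} \<le> 2" for p
  proof -
    obtain b1 b2 b3 where p: "p = (b1, b2, b3)" by (cases p)
    have "{x\<in>E. pat x = p} \<subseteq>
        {x. (G b2 + 1) * x^2 + (G b1 - G b2 - G b3 - 1) * x + (- G b1 * (G b3 + 1)) = 0}"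
      using quad p by auto
    then show ?thesis
      using card_quadratic_roots_le_2[OF G1, of b2 "G b1 - G b2 - G b3 - 1" "- G b1 * (G b3 + 1)"]
        card_mono order_trans by blast
  qed
  text \<open>The roots of a uniform pattern solve \<open>x\<^sup>2 - x - G b = 0\<close>; their product \<open>- G b\<close> is no square.\<close>
  have le1: "card {x\<in>E. pat x = (b, b, b)} \<le> 1" for b
  proof -
    have "x = y" if xy: "x \<in> E" "pat x = (b, b, b)" "y \<in> E" "pat y = (b, b, b)" for x y
    proof (rule ccontr)
      assume ne: "x \<noteq> y"
      have red: "z^2 - z - G b = 0" if z: "z \<in> E" "pat z = (b, b, b)" for z
      proof -
        have "(G b + 1) * (z^2 - z - G b) = 0"
          using quad[OF z] by (simp add: algebra_simps)
        then show ?thesis using G1 by simp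
      qed
      have "(x - y) * (x + y - 1) = (x^2 - x - G b) - (y^2 - y - G b)"
        by (simp add: power2_eq_square algebra_simps)
      then have "(x - y) * (x + y - 1) = 0" using red[OF xy(1,2)] red[OF xy(3,4)] by simp
      then have "x + y - 1 = 0" using ne unfolding mult_eq_0_iff by simp
      then have y: "y = 1 - x" by (simp add: algebra_simps)
      have "x * y = - G b" using red[OF xy(1,2)] unfolding y by (simp add: power2_eq_square algebra_simps)
      moreover have "sq (x * y)"
      proof (cases b)
        case True then show ?thesis using xy by (simp add: pat_def sq_mult)
      next
        case False
        then have "sq (-x)" "sq (-y)" using xy sq_cases by (auto simp: pat_def E_def)
        then have "sq ((-x) * (-y))" by (rule sq_mult)
        then show ?thesis by simp
      qed
      ultimately show False using sq_neg[OF sqG[of b]] by simp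
    qed
    then show ?thesis by (intro card_le_Suc0_iff_eq[THEN iffD2, simplified One_nat_def[symmetric]]) auto
  qed
  have "card E = (\<Sum>p\<in>UNIV. card {x\<in>E. pat x = p})"
    using sum.group[of E UNIV pat "\<lambda>_. 1::nat"] by simp
  also have "\<dots> \<le> (\<Sum>p\<in>UNIV. if p = (True, True, True) \<or> p = (False, False, False) then 1 else 2)"
    using le1[of True] le1[of False] le2 by (intro sum_mono) auto
  \<comment> \<open>Two uniform patterns with at most one root each, and six others with at most
    two.\<close>
  also have "\<dots> = 14" by (simp add: UNIV_bool flip: UNIV_Times_UNIV)
  finally have E14: "card E \<le> 14" .
  have "- {0, 1, f (-1)} \<subseteq> E"
  proof
    fix x assume "x \<in> - {0, 1, f (-1)}"
    moreover have "x = f (-1)" if "1 + f x = 0"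
      using that f_invol[of x] by (metis add.commute eq_neg_iff_add_eq_0)
    ultimately show "x \<in> E" by (auto simp: E_def)
  qed
  then have "card (- {0, 1, f (-1)}) \<le> card E" by (intro card_mono) auto
  moreover have "card (- {0, 1, f (-1)}) \<ge> CARD('k) - 3"
  proof -
    have "card {0, 1, f (-1)} \<le> 3" by (simp add: card_insert_if)
    then show ?thesis unfolding Compl_eq_Diff_UNIV by (simp add: card_Diff_subset)
  qed
  ultimately have le17: "CARD('k) \<le> 17" using E14 by simp
  define S where "S = {a. sq a}"
  \<comment> \<open>Inversion pairs off the squares other than 1, since -1 is no square; hence (q -
    1)/2 is odd.\<close>
  have "even (card (S - {1}))"
  proof (rule even_card_involution[where \<sigma> = "\<lambda>x. 1/x"])
    fix x assume x: "x \<in> S - {1}"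
    then obtain t where t: "t \<noteq> 0" "x = t^2" by (auto simp: S_def sq_def)
    have "sq (1/x)" unfolding sq_def using t by (intro exI[of _ "1/t"]) (simp add: power_one_over)
    moreover have "1/x \<noteq> x"
    proof
      assume "1/x = x"
      then have "x^2 = 1^2" using t by (simp add: field_simps power2_eq_square)
      then show False using x neg1 unfolding power2_eq_iff by (auto simp: S_def)
    qed
    moreover have "1/x \<noteq> 1" using x t by simp
    ultimately show "1/x \<in> S - {1} \<and> 1/x \<noteq> x \<and> 1/(1/x) = x" using t by (simp add: S_def)
  qed simp
  moreover have "card S = card (S - {1}) + 1"
    using sq1 by (subst card.remove[of S 1]) (auto simp: S_def)
  ultimately have oddS: "odd (card S)" by simp
  have "- {0} = S \<union> uminus ` S"
  proof
    show "- {0} \<subseteq> S \<union> uminus ` S"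
      using sq_cases by (auto simp: S_def image_iff) (metis minus_minus)
    show "S \<union> uminus ` S \<subseteq> - {0}" by (auto simp: S_def sq_def)
  qed
  moreover have "card (S \<union> uminus ` S) = card S + card (uminus ` S)"
    using sq_neg by (intro card_Un_disjoint) (auto simp: S_def)
  moreover have "card (uminus ` S) = card S" by (intro card_image) simp
  moreover have "card (- {0::'k}) = CARD('k) - 1" by (simp add: Compl_eq_Diff_UNIV card_Diff_singleton)
  ultimately have "CARD('k) - 1 = 2 * card S" by simp
  then have "CARD('k) = 2 * card S + 1" using big by simp
  \<comment> \<open>With 12 \<le> q \<le> 17 and (q - 1)/2 odd only 15 is left, which is no prime
    power.\<close>
  then have "card S = 6 \<or> card S = 7 \<or> card S = 8" using big le17 by linarith
  then have "card S = 7" using oddS by auto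
  then have q15: "l ^ r = 15" using l \<open>CARD('k) = 2 * card S + 1\<close> by simp
  have "3 dvd l ^ r" "5 dvd l ^ r" unfolding q15 by simp_all
  moreover have "prime (3::nat)" "prime (5::nat)" by simp_all
  ultimately have "3 dvd l" "5 dvd l" by (meson prime_dvd_power)+
  then have "3 = l" "5 = l" using l(1) \<open>prime 3\<close> \<open>prime 5\<close> primes_dvd_imp_eq by blast+
  then show False by simp
qed

end

section \<open>The lower bound q + 1 on the degree\<close>

context SL2_transitive_action begin

text \<open>By regularity every point is \<open>act (upper a) x0\<close> for a unique a. The base
  point is chosen to be fixed by the torus, hence by \<open>weyl\<close> as well, so that
  \<open>weyl\<close> becomes a map f of the field with f 0 = 0 to which \<open>affine_weyl\<close>
  applies.\<close>

theorem card_ge_Suc_card_field: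
  assumes l: "prime l" "CARD('k) = l ^ r" and big: "CARD('k) > 11"
  shows "CARD('k) + 1 \<le> card X"
proof (rule ccontr)
  assume "\<not> ?thesis"
  then have small: "card X \<le> CARD('k)" by simp
  note reg = upper_regular[OF l small]
  have cX: "card X = CARD('k)" using reg(1) big by simp
  have free: "a = b" if "x \<in> X" "act (upper a) x = act (upper b) x" for a b x
  proof -
    have "act (upper (-b)) (act (upper a) x) = act (upper (-b)) (act (upper b) x)" using that by simp
    then have "act (upper (a - b)) x = x" using that(1) by (simp add: act_upper_add act_upper_0)
    then have "a - b = 0" using reg(2)[of x "a - b"] that(1) big by auto
    then show ?thesis by simp
  qed
  have reach: "\<exists>a. y = act (upper a) x" if "x \<in> X" "y \<in> X" for x y
  proof -
    have "card (range (\<lambda>a. act (upper a) x)) = card X"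
      using free[OF that(1)] cX by (subst card_image) (auto intro: injI)
    moreover have "range (\<lambda>a. act (upper a) x) \<subseteq> X" using that(1) act_closed by auto
    ultimately have "range (\<lambda>a. act (upper a) x) = X" using finite_X card_subset_eq by blast
    then show ?thesis using that(2) by blast
  qed
  have "\<not> (UNIV :: 'k set) \<subseteq> {0, 1, -1}"
  proof
    assume "(UNIV :: 'k set) \<subseteq> {0, 1, -1}"
    then have "CARD('k) \<le> card {0, 1, -1 :: 'k}" by (intro card_mono) auto
    also have "\<dots> \<le> 3" by (simp add: card_insert_if)
    finally show False using big by simp
  qed
  \<comment> \<open>With t^2 \<noteq> 1 the element \<open>torus t\<close> acts on the parameters as
    an affine map b \<mapsto> t^2 b + c, which has exactly one fixed point.\<close>
  then obtain t :: 'k where t: "t \<noteq> 0" "t \<noteq> 1" "t \<noteq> -1" by blast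
  have t2: "1 - t^2 \<noteq> 0"
  proof
    assume "1 - t^2 = 0"
    then have "t^2 = 1^2" by simp
    then show False using t unfolding power2_eq_iff by simp
  qed
  obtain y where y: "y \<in> X" using card_gt_1 by (metis card.empty ex_in_conv less_nat_zero_code)
  obtain c where c: "act (torus t) y = act (upper c) y" using reach[OF y] act_closed y t by fastforce
  \<comment> \<open>The parameter solves t^2 b + c = b.\<close>
  define x0 where "x0 = act (upper (c / (1 - t^2))) y"
  have x0: "x0 \<in> X" using y act_closed by (simp add: x0_def)
  have "t^2 * (c / (1 - t^2)) + c = c / (1 - t^2)" using t2 by (simp add: field_simps)
  then have tx0: "act (torus t) x0 = x0"
    unfolding x0_def using y t by (simp add: torus_upper c act_upper_add)
  have uniq: "x = x0" if x: "x \<in> X" "act (torus t) x = x" for x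
  proof -
    obtain b where b: "x = act (upper b) x0" using reach[OF x0 x(1)] by blast
    have "act (upper (t^2 * b)) x0 = act (upper b) x0"
      using x(2) x0 t by (simp add: b torus_upper tx0)
    then have "t^2 * b = b" by (rule free[OF x0])
    then have "(1 - t^2) * b = 0" by (simp add: algebra_simps)
    then show ?thesis using t2 x0 by (simp add: b act_upper_0)
  qed
  \<comment> \<open>The torus is abelian and \<open>weyl\<close> normalises it, so both preserve the
    unique fixed point of \<open>torus t\<close>.\<close>
  have torus_x0: "act (torus s) x0 = x0" if "s \<noteq> 0" for s
  proof (rule uniq)
    show "act (torus t) (act (torus s) x0) = act (torus s) x0"
      using that t x0 tx0 by (metis torus_torus mult.commute)
  qed (use that x0 act_closed in simp)
  have weyl_torus: "act weyl (act (torus s) x) = act (torus (1/s)) (act weyl x)" if "s \<noteq> 0" "x \<in> X" for s x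
  proof -
    have "weyl ** torus s = torus (1/s) ** weyl"
      using that(1) by (simp add: SL2_defs mat2_mult)
    then show ?thesis using that by (metis act_mult det_SL2(3,5) divide_eq_0_iff one_neq_zero)
  qed
  have weyl_x0: "act weyl x0 = x0"
  proof (rule uniq)
    show "act (torus t) (act weyl x0) = act weyl x0"
      using weyl_torus[of "1/t" x0] t x0 torus_x0[of "1/t"] by simp
  qed (use x0 act_closed in simp)
  define f where "f a = (SOME b. act weyl (act (upper a) x0) = act (upper b) x0)" for a
  have f: "act weyl (act (upper a) x0) = act (upper (f a)) x0" for a
    unfolding f_def by (rule someI_ex) (use reach[OF x0] act_closed x0 in simp)
  have fI: "f a = b" if "act weyl (act (upper a) x0) = act (upper b) x0" for a b
    using that f free[OF x0] by metis
  have ux: "act (upper a) x0 \<in> X" for a using x0 act_closed by simp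
  interpret affine_weyl f
  proof
    show "f 0 = 0" by (rule fI) (simp add: act_upper_0 x0 weyl_x0)
  next
    fix s a :: 'k assume s: "s \<noteq> 0"
    show "f (s^2 * a) = f a / s^2"
    proof (rule fI)
      have "act (upper (s^2 * a)) x0 = act (torus s) (act (upper a) x0)"
        using s x0 by (simp add: torus_upper torus_x0)
      then have "act weyl (act (upper (s^2 * a)) x0) = act (torus (1/s)) (act (upper (f a)) x0)"
        using s ux f by (simp add: weyl_torus)
      also have "\<dots> = act (upper (f a / s^2)) x0"
        using s x0 by (simp add: torus_upper torus_x0 power_one_over)
      finally show "act weyl (act (upper (s^2 * a)) x0) = act (upper (f a / s^2)) x0" .
    qed
  next
    fix s x :: 'k assume s: "s \<noteq> 0"
    show "f (1/s + f x) = s^2 * f (x - s) - s"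
    proof (rule fI)
      have "act weyl (act (upper (1/s + f x)) x0) = act weyl (act (upper (1/s)) (act weyl (act (upper x) x0)))"
        by (simp add: f act_upper_add x0)
      also have "\<dots> = act (weyl ** (upper (1/s) ** weyl)) (act (upper x) x0)"
        using ux by (simp add: act_mult act_closed)
      \<comment> \<open>The Bruhat decomposition of the left side, which up to sign is a lower
        unipotent matrix.\<close>
      also have "weyl ** (upper (1/s) ** weyl) = upper (-s) ** (torus s ** (weyl ** upper (-s)))"
        using s by (simp add: SL2_defs mat2_mult mat2_eq_iff)
      also have "act \<dots> (act (upper x) x0) = act (upper (-s)) (act (torus s) (act weyl (act (upper (-s)) (act (upper x) x0))))"
        using ux s by (simp add: act_mult act_closed)
      also have "act weyl (act (upper (-s)) (act (upper x) x0)) = act (upper (f (x - s))) x0"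
        by (simp add: act_upper_add x0 f)
      also have "act (upper (-s)) (act (torus s) (act (upper (f (x - s))) x0)) = act (upper (s^2 * f (x - s) - s)) x0"
        using s x0 by (simp add: torus_upper torus_x0 act_upper_add)
      finally show "act weyl (act (upper (1/s + f x)) x0) = act (upper (s^2 * f (x - s) - s)) x0" .
    qed
  next
    fix x :: 'k
    have "weyl ** weyl = (neg_one :: 'k^2^2)" by (simp add: SL2_defs mat2_mult)
    then have "act weyl (act weyl z) = z" if "z \<in> X" for z
      using that by (simp add: act_mult[symmetric] act_neg)
    then show "f (f x) = x" using f ux by (intro fI) metis
  qed
  show False by (rule contradiction[OF big l])
qed

end

section \<open>Line sums of bilinear forms\<close>

text \<open>These are the intersections of the hyperbola x y = -1 with the line \<rho> x + y = s;
  clearing the denominator gives a quadratic with leading coefficient \<rho>.\<close>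

lemma card_line_hyperbola_le_2:
  fixes \<rho> s :: "'k::field"
  assumes "\<rho> \<noteq> 0" shows "card {x \<in> -{0}. \<rho> * x - 1/x = s} \<le> 2"
proof -
  have "{x \<in> -{0}. \<rho> * x - 1/x = s} \<subseteq> {x. \<rho> * x^2 + (-s) * x + (-1) = 0}"
    by (auto simp: power2_eq_square algebra_simps)
  then show ?thesis
    using card_quadratic_roots_le_2[OF assms, of "-s" "-1"] card_mono order_trans by blast
qed

lemma sum_affine_image:
  fixes F :: "'k::{field,finite} \<Rightarrow> int"
  assumes "y \<noteq> 0" shows "(\<Sum>m\<in>-{0}. F (m * y + c)) = (\<Sum>z\<in>UNIV. F z) - F c"
proof -
  have "(\<Sum>m\<in>-{0}. F (m * y + c)) = (\<Sum>z\<in>-{c}. F z)"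
    by (rule sum.reindex_bij_witness[of _ "\<lambda>z. (z - c) / y" "\<lambda>m. m * y + c"]) (use assms in auto)
  also have "\<dots> = (\<Sum>z\<in>UNIV. F z) - F c"
    by (simp add: Compl_eq_Diff_UNIV sum_diff1)
  finally show ?thesis .
qed

text \<open>
  A hyperbola meets a line with direction \<open>\<rho>\<close> in a nonconstant number of points, so the
  averages of \<open>K\<close> over the lines of every direction vanish.
\<close>
lemma line_sum_zero:
  fixes K :: "'k::{field,finite} \<Rightarrow> 'k \<Rightarrow> int" and p :: int
  assumes p: "prime p" "p > 2" "p dvd int CARD('k) + 1"
    and row: "\<And>j. [(\<Sum>y\<in>UNIV. K j y) = 0] (mod p)"
    and hyp: "\<And>a b t. t \<noteq> 0 \<Longrightarrow> [(\<Sum>x\<in>-{0}. K (x - b) (- (t^2) / x - a)) = 0] (mod p)"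
    and \<rho>: "\<rho> \<noteq> 0"
  shows "[(\<Sum>j\<in>UNIV. K j (c - \<rho> * j)) = 0] (mod p)"
proof (rule ccontr)
  \<comment> \<open>The sum of K over the line \<rho> j + y = z.\<close>
  define F where "F z = (\<Sum>j\<in>UNIV. K j (z - \<rho> * j))" for z
  define q where "q = int CARD('k)"
  assume "\<not> ?thesis"
  then have Fc: "\<not> p dvd F c" by (simp add: F_def cong_0_iff)
  have q1: "[q = -1] (mod p)" using p(3) by (simp add: q_def cong_iff_dvd_diff)
  have Fsum: "[(\<Sum>z\<in>UNIV. F z) = 0] (mod p)"
  proof -
    have "(\<Sum>z\<in>UNIV. F z) = (\<Sum>j\<in>UNIV. \<Sum>z\<in>UNIV. K j (z - \<rho> * j))"
      unfolding F_def by (rule sum.swap)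
    also have "\<dots> = (\<Sum>j\<in>UNIV. \<Sum>y\<in>UNIV. K j y)"
    proof (rule sum.cong[OF refl])
      fix j show "(\<Sum>z\<in>UNIV. K j (z - \<rho> * j)) = (\<Sum>y\<in>UNIV. K j y)"
        by (rule sum.reindex_bij_witness[of _ "\<lambda>y. y + \<rho> * j" "\<lambda>z. z - \<rho> * j"]) auto
    qed
    also have "[\<dots> = (\<Sum>j\<in>(UNIV::'k set). 0)] (mod p)" by (rule cong_sum) (rule row)
    finally show ?thesis by simp
  qed
  \<comment> \<open>Sum \<open>hyp\<close> over all translates of the hyperbola in the direction of
    the lines: every point is replaced by the whole line through it, which turns K into F.\<close>
  have curve: "[(\<Sum>x\<in>-{0}. F (m * (\<rho> * x - 1/x) + d)) = 0] (mod p)" if m: "m \<noteq> 0" for m d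
  proof -
    have "F (m * (\<rho> * x - 1/x) + d) = (\<Sum>b\<in>UNIV. K (m*x - b) (- (m^2) / (m*x) - (- d - \<rho> * b)))"
      if x: "x \<in> -{0}" for x
      unfolding F_def
      by (rule sum.reindex_bij_witness[of _ "\<lambda>b. m*x - b" "\<lambda>j. m*x - j"])
        (use x m in \<open>auto simp: power2_eq_square algebra_simps\<close>)
    then have "(\<Sum>x\<in>-{0}. F (m * (\<rho> * x - 1/x) + d)) =
        (\<Sum>x\<in>-{0}. \<Sum>b\<in>UNIV. K (m*x - b) (- (m^2) / (m*x) - (- d - \<rho> * b)))"
      by (rule sum.cong[OF refl])
    also have "\<dots> = (\<Sum>b\<in>UNIV. \<Sum>x\<in>-{0}. K (m*x - b) (- (m^2) / (m*x) - (- d - \<rho> * b)))"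
      by (rule sum.swap)
    also have "\<dots> = (\<Sum>b\<in>UNIV. \<Sum>x\<in>-{0}. K (x - b) (- (m^2) / x - (- d - \<rho> * b)))"
    proof (rule sum.cong[OF refl])
      fix b
      show "(\<Sum>x\<in>-{0}. K (m*x - b) (- (m^2) / (m*x) - (- d - \<rho> * b))) =
          (\<Sum>x\<in>-{0}. K (x - b) (- (m^2) / x - (- d - \<rho> * b)))"
        by (rule sum.reindex_bij_witness[of _ "\<lambda>x. x / m" "\<lambda>x. m * x"]) (use m in auto)
    qed
    also have "[\<dots> = (\<Sum>b\<in>(UNIV::'k set). 0)] (mod p)" by (rule cong_sum) (rule hyp[OF m])
    finally show ?thesis by simp
  qed
  define r where "r s = card {x \<in> -{0}. \<rho> * x - 1/x = s}" for s
  \<comment> \<open>A further sum over the dilations m: an x on the line for s contributes (q - 1) F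
    c, any other x the sum of all values of F minus F c. Modulo p these are -2 F c and - F c, so the
    vanishing total is (2 - r s) F c.\<close>
  have "r s = 2" for s
  proof -
    have "(\<Sum>m\<in>-{0}. F (m * (\<rho> * x - 1/x - s) + c)) =
       (if \<rho> * x - 1/x = s then (q - 1) * F c else (\<Sum>z\<in>UNIV. F z) - F c)" for x
    proof (cases "\<rho> * x - 1/x = s")
      case True
      have "CARD('k) \<ge> 1" by (simp add: Suc_leI)
      then show ?thesis using True by (simp add: q_def Compl_eq_Diff_UNIV card_Diff_singleton of_nat_diff)
    next
      case False
      then have "\<rho> * x - 1/x - s \<noteq> 0" by simp
      then show ?thesis using False
        by (simp only: if_False) (rule sum_affine_image)
    qed
    moreover have "[(if \<rho> * x - 1/x = s then (q - 1) * F c else (\<Sum>z\<in>UNIV. F z) - F c) =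
       (if \<rho> * x - 1/x = s then -2 * F c else - F c)] (mod p)" for x
    proof -
      have "[(q - 1) * F c = (-1 - 1) * F c] (mod p)" by (intro cong_mult cong_diff q1 cong_refl)
      moreover have "[(\<Sum>z\<in>UNIV. F z) - F c = 0 - F c] (mod p)" by (intro cong_diff Fsum cong_refl)
      ultimately show ?thesis by simp
    qed
    ultimately have "[(\<Sum>x\<in>-{0}. \<Sum>m\<in>-{0}. F (m * (\<rho> * x - 1/x - s) + c)) =
        (\<Sum>x\<in>-{0}. if \<rho> * x - 1/x = s then -2 * F c else - F c)] (mod p)"
      by (intro cong_sum) simp
    moreover have "(\<Sum>x\<in>-{0}. if \<rho> * x - 1/x = s then -2 * F c else - F c) =
        (\<Sum>x\<in>-{0::'k}. - F c) + (\<Sum>x\<in>-{0}. if \<rho> * x - 1/x = s then - F c else 0)"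
      unfolding sum.distrib[symmetric] by (rule sum.cong) auto
    moreover have "(\<Sum>x\<in>-{0}. if \<rho> * x - 1/x = s then - F c else 0) = int (r s) * (- F c)"
      by (simp add: sum.If_cases r_def Int_def)
    moreover have "(\<Sum>x\<in>-{0::'k}. - F c) = (q - 1) * (- F c)"
      by (simp add: q_def Compl_eq_Diff_UNIV card_Diff_singleton of_nat_diff Suc_leI)
    ultimately have 1: "[(\<Sum>x\<in>-{0}. \<Sum>m\<in>-{0}. F (m * (\<rho> * x - 1/x - s) + c)) =
        (q - 1) * (- F c) + int (r s) * (- F c)] (mod p)" by (simp only:)
    have "(\<Sum>x\<in>-{0}. \<Sum>m\<in>-{0}. F (m * (\<rho> * x - 1/x - s) + c)) =
        (\<Sum>m\<in>-{0}. \<Sum>x\<in>-{0}. F (m * (\<rho> * x - 1/x - s) + c))" by (rule sum.swap)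
    also have "\<dots> = (\<Sum>m\<in>-{0}. \<Sum>x\<in>-{0}. F (m * (\<rho> * x - 1/x) + (c - m * s)))"
      by (simp add: algebra_simps)
    also have "[\<dots> = (\<Sum>m\<in>-{0::'k}. 0)] (mod p)" by (rule cong_sum, rule curve) simp
    finally have 2: "[(\<Sum>x\<in>-{0}. \<Sum>m\<in>-{0}. F (m * (\<rho> * x - 1/x - s) + c)) = 0] (mod p)" by simp
    have "[(q - 1) * (- F c) + int (r s) * (- F c) = (-1 - 1) * (- F c) + int (r s) * (- F c)] (mod p)"
      by (intro cong_add cong_mult cong_diff q1 cong_refl)
    then have "[(2 - int (r s)) * F c = 0] (mod p)"
      using cong_trans[OF cong_sym[OF 2] 1] by (simp add: algebra_simps cong_def)
    then have "p dvd (2 - int (r s)) * F c" by (simp add: cong_0_iff)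
    then have "p dvd 2 - int (r s)" using Fc p(1) by (simp add: prime_dvd_mult_iff)
    \<comment> \<open>Since 2 - r s lies between 0 and 2 and p is larger than 2, divisibility means
      equality.\<close>
    moreover have "r s \<le> 2" unfolding r_def by (rule card_line_hyperbola_le_2[OF \<rho>])
    ultimately show "r s = 2" using p(2) by (auto dest: zdvd_imp_le)
  qed
  \<comment> \<open>But each nonzero x lies on exactly one of the lines, so the r s add up to q -
    1.\<close>
  then have "(\<Sum>s\<in>UNIV. r s) = 2 * CARD('k)" by simp
  moreover have "(\<Sum>s\<in>UNIV. r s) = card (-{0::'k})"
    using sum.group[of "-{0::'k}" UNIV "\<lambda>x. \<rho> * x - 1/x" "\<lambda>_. 1::nat"] by (simp add: r_def)
  moreover have "card (-{0::'k}) < CARD('k)" by (intro psubset_card_mono) auto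
  ultimately show False by simp
qed

text \<open>Add the vanishing sums over the lines of all directions \<rho> \<noteq> 0 through the
  point (i, z). As q = -1 modulo p, the point itself contributes -2 times its value; every other j
  contributes minus its entry at z, because its row sums to zero. The vanishing column sum at z then
  leaves - K i z.\<close>

lemma bilinear_orbit_sums_zero:
  fixes K :: "'k::{field,finite} \<Rightarrow> 'k \<Rightarrow> int" and p :: int
  assumes p: "prime p" "p > 2" "p dvd int CARD('k) + 1"
    and row: "\<And>j. [(\<Sum>y\<in>UNIV. K j y) = 0] (mod p)"
    and col: "\<And>y. [(\<Sum>j\<in>UNIV. K j y) = 0] (mod p)"
    and hyp: "\<And>a b t. t \<noteq> 0 \<Longrightarrow> [(\<Sum>x\<in>-{0}. K (x - b) (- (t^2) / x - a)) = 0] (mod p)"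
  shows "p dvd K i z"
proof -
  define L where "L j y = K (j + i) y" for j y
  define q where "q = int CARD('k)"
  have q1: "[q = -1] (mod p)" using p(3) by (simp add: q_def cong_iff_dvd_diff)
  have rowL: "[(\<Sum>y\<in>UNIV. L j y) = 0] (mod p)" for j using row by (simp add: L_def)
  have colL: "[(\<Sum>j\<in>UNIV. L j y) = 0] (mod p)" for y
  proof -
    have "(\<Sum>j\<in>UNIV. L j y) = (\<Sum>j\<in>UNIV. K j y)" unfolding L_def
      by (rule sum.reindex_bij_witness[of _ "\<lambda>j. j - i" "\<lambda>j. j + i"]) auto
    then show ?thesis using col by simp
  qed
  have hypL: "[(\<Sum>x\<in>-{0}. L (x - b) (- (t^2) / x - a)) = 0] (mod p)" if "t \<noteq> 0" for a b t
    using hyp[OF that, of "b - i" a] by (simp add: L_def algebra_simps)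
  have "[(\<Sum>\<rho>\<in>-{0}. \<Sum>j\<in>UNIV. L j (z - \<rho> * j)) = (\<Sum>\<rho>\<in>-{0::'k}. 0)] (mod p)"
    by (rule cong_sum, rule line_sum_zero[OF p rowL hypL]) auto
  then have "[(\<Sum>j\<in>UNIV. \<Sum>\<rho>\<in>-{0}. L j (z - \<rho> * j)) = 0] (mod p)"
    by (subst sum.swap) simp
  moreover have "[(\<Sum>j\<in>UNIV. \<Sum>\<rho>\<in>-{0}. L j (z - \<rho> * j)) = (\<Sum>j\<in>UNIV. if j = 0 then (q - 1) * L 0 z else - L j z)] (mod p)"
  proof (rule cong_sum)
    fix j :: 'k
    show "[(\<Sum>\<rho>\<in>-{0}. L j (z - \<rho> * j)) = (if j = 0 then (q - 1) * L 0 z else - L j z)] (mod p)"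
    proof (cases "j = 0")
      case True
      then show ?thesis
        by (simp add: q_def Compl_eq_Diff_UNIV card_Diff_singleton of_nat_diff Suc_leI)
    next
      case False
      have "(\<Sum>\<rho>\<in>-{0}. L j (z - \<rho> * j)) = (\<Sum>\<rho>\<in>-{0}. L j (\<rho> * (-j) + z))" by simp
      also have "\<dots> = (\<Sum>y\<in>UNIV. L j y) - L j z" using False by (intro sum_affine_image) simp
      also have "[\<dots> = 0 - L j z] (mod p)" by (intro cong_diff rowL cong_refl)
      finally show ?thesis using False by simp
    qed
  qed
  ultimately have *: "[(\<Sum>j\<in>UNIV. if j = 0 then (q - 1) * L 0 z else - L j z) = 0] (mod p)"
    using cong_trans cong_sym by blast
  have "(\<Sum>j\<in>UNIV. if j = 0 then (q - 1) * L 0 z else - L j z) =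
      (\<Sum>j\<in>UNIV. (if j = 0 then q * L 0 z else 0) - L j z)"
    by (rule sum.cong) (auto simp: algebra_simps)
  also have "\<dots> = q * L 0 z - (\<Sum>j\<in>UNIV. L j z)" by (simp add: sum_subtractf)
  also have "[\<dots> = (-1) * L 0 z - 0] (mod p)" by (intro cong_diff cong_mult q1 colL cong_refl)
  finally have "[(-1) * L 0 z - 0 = 0] (mod p)" using * cong_trans cong_sym by blast
  then show ?thesis by (simp add: L_def cong_0_iff)
qed

section \<open>Projective coordinates and matrix coefficients\<close>

locale SL2_projective_action = SL2_action act X
  for act :: "'k::{field,finite}^2^2 \<Rightarrow> 'x \<Rightarrow> 'x" and X :: "'x set" +
  fixes pinf :: 'x and pt :: "'k \<Rightarrow> 'x"
  assumes pinf_closed: "pinf \<in> X"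
    and X_eq: "X = insert pinf (range pt)"
    and pt_inj: "inj pt" and pt_pinf: "pt a \<noteq> pinf"
    and upper_pinf: "act (upper a) pinf = pinf"
    and upper_pt: "act (upper a) (pt b) = pt (a + b)"
    and torus_pinf: "t \<noteq> 0 \<Longrightarrow> act (torus t) pinf = pinf"
    and torus_pt: "t \<noteq> 0 \<Longrightarrow> act (torus t) (pt b) = pt (t^2 * b)"
    and weyl_pinf: "act weyl pinf = pt 0" and weyl_pt_0: "act weyl (pt 0) = pinf"
    and weyl_pt: "a \<noteq> 0 \<Longrightarrow> act weyl (pt a) = pt (- 1 / a)"
    and transitive: "x \<in> X \<Longrightarrow> y \<in> X \<Longrightarrow> \<exists>A. det A = 1 \<and> act A x = y"

context SL2_action begin

text \<open>The orbit of the moved point has at least q + 1 points and so is all of X. As l does not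
  divide q + 1, the unipotent group fixes a point P, and only this one. The torus normalises the
  unipotent group and therefore fixes P. The other points are
  \<open>act (upper a) (act weyl P)\<close>, and the braid relation applied to P yields
  -1/a.\<close>

lemma ex_projective_coordinates:
  assumes l: "prime l" "CARD('k) = l ^ r" and big: "CARD('k) > 11" and cX: "card X = CARD('k) + 1"
    and nontriv: "x1 \<in> X" "det A1 = 1" "act A1 x1 \<noteq> x1"
  shows "\<exists>pinf pt. SL2_projective_action act X pinf pt"
proof -
  define Y where "Y = {act A x1 |A. det A = 1}"
  have YX: "Y \<subseteq> X" using nontriv(1) act_closed by (auto simp: Y_def)
  have "act (mat 1) x1 \<in> Y" "act A1 x1 \<in> Y" using nontriv by (auto simp: Y_def)
  then have Y2: "x1 \<in> Y" "act A1 x1 \<in> Y" using nontriv act_one by simp_all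
  interpret Y: SL2_transitive_action act Y
  proof
    show "finite Y" using YX finite_X finite_subset by blast
    show "act A x \<in> Y" if "det A = 1" "x \<in> Y" for A x
    proof -
      obtain B where "det B = 1" "x = act B x1" using \<open>x \<in> Y\<close> by (auto simp: Y_def)
      then have "act A x = act (A ** B) x1" "det (A ** B) = 1"
        using that nontriv(1) by (simp_all add: act_mult)
      then show ?thesis unfolding Y_def by blast
    qed
    show "act (mat 1) x = x" "act neg_one x = x" if "x \<in> Y" for x
      using that YX act_one act_neg by auto
    show "act (A ** B) x = act A (act B x)" if "det A = 1" "det B = 1" "x \<in> Y" for A B x
      using that YX act_mult by auto
    show "\<exists>A. det A = 1 \<and> act A x = y" if "x \<in> Y" "y \<in> Y" for x y
    proof -
      obtain B where B: "det B = 1" "x = act B x1" using \<open>x \<in> Y\<close> by (auto simp: Y_def)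
      obtain C where C: "det C = 1" "y = act C x1" using \<open>y \<in> Y\<close> by (auto simp: Y_def)
      obtain B' where B': "det B' = 1" "B ** B' = mat 1" "B' ** B = mat 1" using mat2_inverse[OF B(1)] .
      have "act B' (act B x1) = x1"
        using B B' nontriv(1) act_mult[of B' B x1] act_one by simp
      then have "act (C ** B') x = y"
        using B B' C nontriv(1) act_closed by (simp add: act_mult)
      then show ?thesis using B' C by (intro exI[of _ "C ** B'"]) simp
    qed
    have "card {x1, act A1 x1} \<le> card Y"
      using Y2 YX finite_X finite_subset by (intro card_mono) auto
    then show "1 < card Y" using nontriv(3) by simp
  qed
  have "CARD('k) + 1 \<le> card Y" by (rule Y.card_ge_Suc_card_field[OF l big])
  then have "Y = X" using cX YX finite_X card_mono[OF finite_X YX] by (intro card_subset_eq) simp_all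
  then interpret SL2_transitive_action act X using Y.SL2_transitive_action_axioms by simp
  have "\<exists>x\<in>X. \<forall>a. act (upper a) x = x"
  proof (rule ccontr)
    assume "\<not> ?thesis"
    then have "l dvd card X" by (intro prime_dvd_card[OF l]) blast
    moreover have "l dvd CARD('k)" using l(2) big by (cases r) auto
    ultimately have "l dvd 1" unfolding cX by (simp only: dvd_add_right_iff)
    then show False using l(1) by simp
  qed
  then obtain P where P: "P \<in> X" "\<And>a. act (upper a) P = P" by blast
  define pt where "pt a = act (upper a) (act weyl P)" for a
  have "\<exists>y\<in>X. y \<noteq> P"
  proof (rule ccontr)
    assume "\<not> ?thesis"
    then have "X = {P}" using P by blast
    then show False using card_gt_1 by simp
  qed
  then obtain A where A: "det A = 1" "act A P \<noteq> P" using transitive P(1) by blast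
  note fixed = card_if_upper_fixed[OF P A]
  have inj: "inj pt" and ne: "P \<notin> range pt" using fixed(2,3) by (simp_all add: pt_def[abs_def])
  have wP: "act weyl P \<in> X" using P act_closed by simp
  have ptX: "pt a \<in> X" for a using wP act_closed by (simp add: pt_def)
  have "card (insert P (range pt)) = card X"
    using ne inj cX by (simp add: card_image)
  moreover have "insert P (range pt) \<subseteq> X" using P ptX by auto
  ultimately have X_eq: "X = insert P (range pt)" using finite_X card_subset_eq by metis
  have up: "act (upper a) (pt b) = pt (a + b)" for a b
    using wP by (simp add: pt_def act_upper_add)
  have unique: "x = P" if x: "x \<in> X" "\<And>a. act (upper a) x = x" for x
  proof (rule ccontr)
    assume "x \<noteq> P"
    then obtain b where "x = pt b" using x X_eq by blast
    then have "pt (1 + b) = pt b" using x(2)[of 1] up by simp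
    then have "1 + b = b" by (rule injD[OF inj])
    then show False by simp
  qed
  have tP: "act (torus t) P = P" if t: "t \<noteq> 0" for t
  proof (rule unique)
    fix a
    have "act (torus t) (act (upper (a / t^2)) P) = act (upper (t^2 * (a / t^2))) (act (torus t) P)"
      by (rule torus_upper[OF t P(1)])
    then show "act (upper a) (act (torus t) P) = act (torus t) P" using t P(2) by simp
  qed (use P t act_closed in simp)
  have wt: "act (torus t) (act weyl P) = act weyl P" if t: "t \<noteq> 0" for t
  proof -
    have "torus t ** weyl = weyl ** torus (1/t)" using t by (simp add: SL2_defs mat2_mult)
    then have "act (torus t) (act weyl P) = act weyl (act (torus (1/t)) P)"
      using t P(1) act_mult[of "torus t" weyl P] act_mult[of weyl "torus (1/t)" P] by simp
    then show ?thesis using t tP by simp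
  qed
  have ww: "act weyl (act weyl P) = P"
  proof -
    have "weyl ** weyl = (neg_one :: 'k^2^2)" by (simp add: SL2_defs mat2_mult)
    then show ?thesis using P by (simp add: act_mult[symmetric] act_neg)
  qed
  have pt0: "pt 0 = act weyl P" using wP by (simp add: pt_def act_upper_0)
  have "SL2_projective_action act X P pt"
  proof (unfold_locales)
    show "act (torus t) (pt b) = pt (t^2 * b)" if "t \<noteq> 0" for t b
      using that wP by (simp add: pt_def torus_upper wt)
    show "act weyl (pt a) = pt (- 1 / a)" if a: "a \<noteq> 0" for a
    proof -
      have "weyl ** (upper a ** weyl) = upper (-1/a) ** (weyl ** (torus a ** upper (-1/a)))"
        using a by (simp add: SL2_defs mat2_mult mat2_eq_iff)
      then have "act (weyl ** (upper a ** weyl)) P = act (upper (-1/a) ** (weyl ** (torus a ** upper (-1/a)))) P"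
        by (simp only:)
      also have "\<dots> = act (upper (-1/a)) (act weyl P)"
        using a P tP act_closed by (simp add: act_mult)
      finally have "act (weyl ** (upper a ** weyl)) P = act (upper (-1/a)) (act weyl P)" .
      then show ?thesis using P wP by (simp add: act_mult act_closed pt_def)
    qed
  qed (use P X_eq inj ne up tP ww pt0 transitive in \<open>auto simp: image_iff\<close>)
  then show ?thesis by blast
qed

end

section \<open>Matrix coefficients on the projective line\<close>

context SL2_projective_action begin

lemma pt_closed: "pt a \<in> X" by (simp add: X_eq)

lemma card_X: "card X = CARD('k) + 1"
proof -
  have "pinf \<notin> range pt" using pt_pinf by (metis rangeE)
  then show ?thesis by (simp add: X_eq card_image pt_inj)
qed

lemma sum_X: "(\<Sum>x\<in>X. f x) = f pinf + (\<Sum>a\<in>UNIV. f (pt a))"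
proof -
  have "pinf \<notin> range pt" using pt_pinf by (metis rangeE)
  then show ?thesis by (simp add: X_eq sum.reindex[OF pt_inj] comp_def)
qed

lemma sum_act: "det A = 1 \<Longrightarrow> (\<Sum>x\<in>X. f (act A x)) = (\<Sum>x\<in>X. f x)"
  by (rule sum.reindex_bij_betw[OF act_bij])

text \<open>With D moving b to infinity and C moving infinity to c, the matrices
  \<open>C ** (upper a ** D)\<close> all send b to c, while they spread any other x exactly once
  over the points different from c. So the sum of \<open>inv\<close> over a consists of q T b c and
  of row sums minus T x c.\<close>

lemma average_over_upper:
  fixes T :: "'x \<Rightarrow> 'x \<Rightarrow> int" and p :: int
  assumes row: "\<And>x. x \<in> X \<Longrightarrow> [(\<Sum>y\<in>X. T x y) = 0] (mod p)"
    and inv: "\<And>A. det A = 1 \<Longrightarrow> [(\<Sum>x\<in>X. T x (act A x)) = 0] (mod p)"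
    and b: "b \<in> X" and c: "c \<in> X"
  shows "[int (card X) * T b c = (\<Sum>x\<in>X. T x c)] (mod p)"
proof -
  obtain D where D: "det D = 1" "act D b = pinf" using transitive[OF b pinf_closed] by blast
  obtain C where C: "det C = 1" "act C pinf = c" using transitive[OF pinf_closed c] by blast
  define S where "S x = (\<Sum>a\<in>UNIV. T x (act C (act (upper a) (act D x))))" for x
  have "S x = (\<Sum>y\<in>X. T x y) - T x c" if x: "x \<in> X" "x \<noteq> b" for x
  proof -
    have "act D x \<in> X" "act D x \<noteq> pinf" using x D act_inj[OF D(1) x(1) b] act_closed by auto
    then obtain e where e: "act D x = pt e" using X_eq by blast
    have "S x = (\<Sum>a\<in>UNIV. T x (act C (pt (a + e))))" by (simp add: S_def e upper_pt)
    also have "\<dots> = (\<Sum>a\<in>UNIV. T x (act C (pt a)))"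
      by (rule sum.reindex_bij_witness[of _ "\<lambda>a. a - e" "\<lambda>a. a + e"]) auto
    also have "\<dots> = (\<Sum>y\<in>X. T x (act C y)) - T x (act C pinf)" by (simp add: sum_X)
    also have "(\<Sum>y\<in>X. T x (act C y)) = (\<Sum>y\<in>X. T x y)" by (rule sum_act[OF C(1)])
    finally show ?thesis by (simp add: C)
  qed
  moreover have "S b = int CARD('k) * T b c" by (simp add: S_def D upper_pinf C)
  ultimately have S: "[S x = (if x = b then int (card X) * T b c else 0) - T x c] (mod p)" if "x \<in> X" for x
    using row[OF that] that by (auto simp: card_X algebra_simps cong_iff_dvd_diff)
  have "[(\<Sum>x\<in>X. S x) = (\<Sum>x\<in>X. (if x = b then int (card X) * T b c else 0) - T x c)] (mod p)"
    by (rule cong_sum[OF S])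
  moreover have "(\<Sum>x\<in>X. (if x = b then int (card X) * T b c else 0) - T x c) =
      int (card X) * T b c - (\<Sum>x\<in>X. T x c)"
    using b finite_X by (simp add: sum_subtractf)
  moreover have "[(\<Sum>x\<in>X. S x) = 0] (mod p)"
  proof -
    have "(\<Sum>x\<in>X. S x) = (\<Sum>a\<in>UNIV. \<Sum>x\<in>X. T x (act C (act (upper a) (act D x))))"
      unfolding S_def by (rule sum.swap)
    also have "\<dots> = (\<Sum>a\<in>UNIV. \<Sum>x\<in>X. T x (act (C ** (upper a ** D)) x))"
      using C D by (intro sum.cong refl) (simp add: act_mult act_closed)
    also have "[\<dots> = (\<Sum>a\<in>(UNIV::'k set). 0)] (mod p)"
      by (rule cong_sum, rule inv) (use C D in simp)
    finally show ?thesis by simp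
  qed
  ultimately have "[int (card X) * T b c - (\<Sum>x\<in>X. T x c) = 0] (mod p)"
    using cong_trans[OF cong_sym] by (simp only:)
  then show ?thesis by (simp add: cong_iff_dvd_diff)
qed

text \<open>For T x y = g x * f y the sums in \<open>inv\<close> are matrix coefficients of the
  permutation module. The conclusion says that modulo p the tensor T is a function of x plus a
  function of y, so that it vanishes on the heart. If p does not divide q + 1,
  \<open>average_over_upper\<close> alone gives this; otherwise it gives the vanishing column sums
  that the hyperbola argument requires.\<close>

theorem matrix_coefficients_separate:
  fixes T :: "'x \<Rightarrow> 'x \<Rightarrow> int" and p :: int
  assumes p: "prime p" "p > 2"
    and row: "\<And>x. x \<in> X \<Longrightarrow> [(\<Sum>y\<in>X. T x y) = 0] (mod p)"
    and inv: "\<And>A. det A = 1 \<Longrightarrow> [(\<Sum>x\<in>X. T x (act A x)) = 0] (mod p)"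
    and mem: "b \<in> X" "b' \<in> X" "c \<in> X" "c' \<in> X"
  shows "p dvd T b c - T b' c - (T b c' - T b' c')"
proof -
  have avg: "[int (card X) * T x y = (\<Sum>x\<in>X. T x y)] (mod p)" if "x \<in> X" "y \<in> X" for x y
    by (rule average_over_upper[OF row inv that])
  show ?thesis
  proof (cases "p dvd int (card X)")
    case False
    have "[int (card X) * T b c = int (card X) * T b' c] (mod p)" if "c \<in> X" for c
      by (rule cong_trans[OF avg cong_sym[OF avg]]) (use mem that in auto)
    then have "p dvd int (card X) * (T b c - T b' c)" if "c \<in> X" for c
      using that by (simp add: cong_iff_dvd_diff right_diff_distrib)
    then have dvd: "p dvd T b c - T b' c" if "c \<in> X" for c
      using that False p(1) by (simp add: prime_dvd_mult_iff)
    show ?thesis by (rule dvd_diff[OF dvd dvd]) (use mem in auto)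
  next
    case True
    have col: "[(\<Sum>x\<in>X. T x y) = 0] (mod p)" if "y \<in> X" for y
    proof -
      have "[int (card X) * T b y = 0] (mod p)" using True by (simp add: cong_0_iff)
      with cong_sym[OF avg[OF mem(1) that]] show ?thesis by (rule cong_trans)
    qed
    \<comment> \<open>T is normalised to vanish on the row and the column of \<open>pinf\<close>.
      All the vanishing sums persist, because p divides \<open>card X\<close>.\<close>
    define T' where "T' x y = T x y - T pinf y - (T x pinf - T pinf pinf)" for x y
    have n0: "[int (card X) * k = 0] (mod p)" for k using True by (simp add: cong_0_iff)
    have inv': "[(\<Sum>x\<in>X. T' x (act A x)) = 0] (mod p)" if A: "det A = 1" for A
    proof -
      have "(\<Sum>x\<in>X. T' x (act A x)) = (\<Sum>x\<in>X. T x (act A x)) - (\<Sum>y\<in>X. T pinf y)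
          - ((\<Sum>x\<in>X. T x pinf) - int (card X) * T pinf pinf)"
        using sum_act[OF A, of "T pinf"] by (simp add: T'_def sum_subtractf)
      also have "[\<dots> = 0 - 0 - (0 - 0)] (mod p)"
        by (intro cong_diff inv A row col n0 pinf_closed)
      finally show ?thesis by simp
    qed
    have row': "[(\<Sum>y\<in>X. T' x y) = 0] (mod p)" if x: "x \<in> X" for x
    proof -
      have "(\<Sum>y\<in>X. T' x y) = (\<Sum>y\<in>X. T x y) - (\<Sum>y\<in>X. T pinf y)
          - int (card X) * (T x pinf - T pinf pinf)"
        by (simp add: T'_def sum_subtractf)
      also have "[\<dots> = 0 - 0 - 0] (mod p)" by (intro cong_diff row x n0 pinf_closed)
      finally show ?thesis by simp
    qed
    have col': "[(\<Sum>x\<in>X. T' x y) = 0] (mod p)" if y: "y \<in> X" for y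
    proof -
      have "(\<Sum>x\<in>X. T' x y) = (\<Sum>x\<in>X. T x y) - int (card X) * T pinf y
          - ((\<Sum>x\<in>X. T x pinf) - int (card X) * T pinf pinf)"
        by (simp add: T'_def sum_subtractf)
      also have "[\<dots> = 0 - 0 - (0 - 0)] (mod p)" by (intro cong_diff col y n0 pinf_closed)
      finally show ?thesis by simp
    qed
    have T'0: "T' pinf y = 0" "T' x pinf = 0" for x y by (simp_all add: T'_def)
    have "p dvd T' (pt i) (pt z)" for i z
    proof (rule bilinear_orbit_sums_zero[of p "\<lambda>i z. T' (pt i) (pt z)"])
      show "p dvd int CARD('k) + 1" using True by (simp add: card_X add.commute)
      show "[(\<Sum>y\<in>UNIV. T' (pt j) (pt y)) = 0] (mod p)" for j
        using row'[OF pt_closed, of j] by (simp add: sum_X T'0)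
      show "[(\<Sum>j\<in>UNIV. T' (pt j) (pt y)) = 0] (mod p)" for y
        using col'[OF pt_closed, of y] by (simp add: sum_X T'0)
      show "[(\<Sum>x\<in>-{0}. T' (pt (x - b)) (pt (- (t^2) / x - a))) = 0] (mod p)" if t: "t \<noteq> 0" for a b t
      proof -
        \<comment> \<open>In coordinates x \<mapsto> - t^2 / (x + b) - a, whose graph is a
          translated hyperbola; its two points involving \<open>pinf\<close> contribute nothing, as
          T' vanishes there.\<close>
        define A where "A = upper (-a) ** (torus t ** (weyl ** upper b))"
        have A: "det A = 1" using t by (simp add: A_def)
        have actA: "act A x = act (upper (-a)) (act (torus t) (act weyl (act (upper b) x)))" if "x \<in> X" for x
          using that t by (simp add: A_def act_mult act_closed)
        have 0: "act A (pt (0 - b)) = pinf"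
          using t by (simp add: actA pt_closed upper_pt weyl_pt_0 torus_pinf upper_pinf)
        have 1: "act A (pt (x - b)) = pt (- (t^2) / x - a)" if "x \<noteq> 0" for x
          using t that by (simp add: actA pt_closed upper_pt weyl_pt torus_pt)
              (simp only: minus_diff_commute)
        have "(\<Sum>x\<in>X. T' x (act A x)) = (\<Sum>j\<in>UNIV. T' (pt j) (act A (pt j)))"
          by (simp add: sum_X T'0)
        also have "\<dots> = (\<Sum>x\<in>UNIV. T' (pt (x - b)) (act A (pt (x - b))))"
          by (rule sum.reindex_bij_witness[of _ "\<lambda>x. x - b" "\<lambda>j. j + b"]) auto
        also have "\<dots> = T' (pt (0 - b)) (act A (pt (0 - b))) + (\<Sum>x\<in>-{0}. T' (pt (x - b)) (act A (pt (x - b))))"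
          using sum.remove[of UNIV "0::'k" "\<lambda>x. T' (pt (x - b)) (act A (pt (x - b)))"] by (simp add: Compl_eq_Diff_UNIV)
        also have "\<dots> = (\<Sum>x\<in>-{0}. T' (pt (x - b)) (act A (pt (x - b))))" unfolding 0 by (simp add: T'0)
        also have "\<dots> = (\<Sum>x\<in>-{0}. T' (pt (x - b)) (pt (- (t^2) / x - a)))"
          by (intro sum.cong refl) (simp only: 1 Compl_iff singleton_iff simp_thms)
        finally show ?thesis using inv'[OF A] by simp
      qed
    qed (use p in auto)
    then have dvd: "p dvd T' x y" if "x \<in> X" "y \<in> X" for x y
      using that unfolding X_eq by (auto simp: T'0)
    have "T b c - T b' c - (T b c' - T b' c') = T' b c - T' b' c - (T' b c' - T' b' c')"
      by (simp add: T'_def)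
    then show ?thesis using dvd[OF mem(1,3)] dvd[OF mem(2,3)] dvd[OF mem(1,4)] dvd[OF mem(2,4)]
      by (simp only: dvd_diff)
  qed
qed

end

section \<open>Endomorphism rings\<close>

lemma End_algI:
  assumes "f \<in> carrier V \<rightarrow>\<^sub>E carrier V"
    and "\<And>x y. x \<in> carrier V \<Longrightarrow> y \<in> carrier V \<Longrightarrow> f (x \<oplus>\<^bsub>V\<^esub> y) = f x \<oplus>\<^bsub>V\<^esub> f y"
    and "\<And>c x. c \<in> carrier F \<Longrightarrow> x \<in> carrier V \<Longrightarrow> f (c \<odot>\<^bsub>V\<^esub> x) = c \<odot>\<^bsub>V\<^esub> f x"
  shows "f \<in> carrier (End_alg F V)"
  using assms by (simp add: End_alg_def)

lemma End_algD:
  assumes "f \<in> carrier (End_alg F V)"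
  shows "f \<in> carrier V \<rightarrow>\<^sub>E carrier V"
    and "x \<in> carrier V \<Longrightarrow> f x \<in> carrier V"
    and "x \<in> carrier V \<Longrightarrow> y \<in> carrier V \<Longrightarrow> f (x \<oplus>\<^bsub>V\<^esub> y) = f x \<oplus>\<^bsub>V\<^esub> f y"
    and "c \<in> carrier F \<Longrightarrow> x \<in> carrier V \<Longrightarrow> f (c \<odot>\<^bsub>V\<^esub> x) = c \<odot>\<^bsub>V\<^esub> f x"
  using assms by (auto simp: End_alg_def)

lemma End_alg_eqI:
  assumes "f \<in> carrier (End_alg F V)" "g \<in> carrier (End_alg F V)"
    and "\<And>x. x \<in> carrier V \<Longrightarrow> f x = g x"
  shows "f = g"
  using assms by (auto simp: End_alg_def intro: PiE_ext)

lemma End_alg_apply: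
  assumes "x \<in> carrier V"
  shows "(f \<otimes>\<^bsub>End_alg F V\<^esub> g) x = f (g x)"
    and "(f \<oplus>\<^bsub>End_alg F V\<^esub> g) x = f x \<oplus>\<^bsub>V\<^esub> g x"
    and "\<one>\<^bsub>End_alg F V\<^esub> x = x" and "\<zero>\<^bsub>End_alg F V\<^esub> x = \<zero>\<^bsub>V\<^esub>"
    and "(c \<odot>\<^bsub>End_alg F V\<^esub> f) x = c \<odot>\<^bsub>V\<^esub> f x"
  using assms by (simp_all add: End_alg_def compose_def)

locale vector_space_over = F: field F + V: module F V
  for F :: "('c, 'm) ring_scheme" and V :: "('c, 'v, 'n) module_scheme"
begin

abbreviation E where "E \<equiv> End_alg F V"

lemma smult_zero_right: "c \<in> carrier F \<Longrightarrow> c \<odot>\<^bsub>V\<^esub> \<zero>\<^bsub>V\<^esub> = \<zero>\<^bsub>V\<^esub>"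
  by (rule V.smult_r_null)

lemma End_zero: "f \<in> carrier E \<Longrightarrow> f \<zero>\<^bsub>V\<^esub> = \<zero>\<^bsub>V\<^esub>"
  using End_algD(4)[of f F V "\<zero>\<^bsub>F\<^esub>" "\<zero>\<^bsub>V\<^esub>"] End_algD(2)[of f F V "\<zero>\<^bsub>V\<^esub>"]
  by (simp add: V.smult_l_null)

lemma End_minus:
  assumes "f \<in> carrier E" "x \<in> carrier V" shows "f (\<ominus>\<^bsub>V\<^esub> x) = \<ominus>\<^bsub>V\<^esub> f x"
proof -
  have "f (\<ominus>\<^bsub>V\<^esub> x) \<oplus>\<^bsub>V\<^esub> f x = f (\<ominus>\<^bsub>V\<^esub> x \<oplus>\<^bsub>V\<^esub> x)"
    using assms by (simp add: End_algD(3))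
  also have "\<dots> = \<zero>\<^bsub>V\<^esub>" using assms by (simp add: V.l_neg End_zero)
  finally show ?thesis
    using assms by (intro V.minus_equality[symmetric]) (simp_all add: End_algD(2))
qed

lemma mult_closed: "f \<in> carrier E \<Longrightarrow> g \<in> carrier E \<Longrightarrow> f \<otimes>\<^bsub>E\<^esub> g \<in> carrier E"
  by (rule End_algI) (auto simp: End_alg_apply End_algD(2-4) PiE_iff extensional_def, simp add: End_alg_def compose_def)

lemma add_closed: "f \<in> carrier E \<Longrightarrow> g \<in> carrier E \<Longrightarrow> f \<oplus>\<^bsub>E\<^esub> g \<in> carrier E"
  by (rule End_algI)
    (auto simp: End_alg_apply End_algD(2-4) PiE_iff extensional_def V.smult_r_distr V.a_ac,
     simp add: End_alg_def)

lemma smult_closed: "c \<in> carrier F \<Longrightarrow> f \<in> carrier E \<Longrightarrow> c \<odot>\<^bsub>E\<^esub> f \<in> carrier E"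
  by (rule End_algI)
    (auto simp: End_alg_apply End_algD(2-4) PiE_iff extensional_def V.smult_r_distr
      F.m_comm V.smult_assoc1[symmetric], simp add: End_alg_def)

lemma one_closed: "\<one>\<^bsub>E\<^esub> \<in> carrier E"
  by (rule End_algI) (auto simp: End_alg_apply PiE_iff extensional_def, simp add: End_alg_def)

lemma zero_closed: "\<zero>\<^bsub>E\<^esub> \<in> carrier E"
  by (rule End_algI) (auto simp: End_alg_apply PiE_iff extensional_def smult_zero_right, simp add: End_alg_def)

lemmas End_closed = mult_closed add_closed smult_closed one_closed zero_closed

lemma abelian_group_End: "abelian_group E"
proof (rule abelian_groupI)
  show "\<exists>g\<in>carrier E. g \<oplus>\<^bsub>E\<^esub> f = \<zero>\<^bsub>E\<^esub>" if f: "f \<in> carrier E" for f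
  proof
    let ?g = "(\<ominus>\<^bsub>F\<^esub> \<one>\<^bsub>F\<^esub>) \<odot>\<^bsub>E\<^esub> f"
    show g: "?g \<in> carrier E" using f by (simp add: End_closed)
    show "?g \<oplus>\<^bsub>E\<^esub> f = \<zero>\<^bsub>E\<^esub>"
    proof (rule End_alg_eqI[where F = F])
      fix x assume x: "x \<in> carrier V"
      then show "(?g \<oplus>\<^bsub>E\<^esub> f) x = \<zero>\<^bsub>E\<^esub> x"
        using f by (simp add: End_alg_apply End_algD(2) V.smult_l_minus V.l_neg)
    qed (use g f in \<open>simp_all add: End_closed\<close>)
  qed
qed (auto intro!: End_alg_eqI[of _ F V] simp: End_closed End_alg_apply End_algD(2) V.a_ac)

sublocale E: ring E
proof (rule ringI)
  show "abelian_group E" by (rule abelian_group_End)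
  show "Group.monoid E"
    by (rule monoidI) (auto intro!: End_alg_eqI[of _ F V] simp: End_closed End_alg_apply End_algD(2))
qed (auto intro!: End_alg_eqI[of _ F V] simp: End_closed End_alg_apply End_algD(2,3))

lemma module_End: "Module.module F E"
  by (rule moduleI)
    (auto intro!: End_alg_eqI[of _ F V] F.cring_axioms abelian_group_End
      simp: End_closed End_alg_apply End_algD(2-4) V.smult_l_distr V.smult_r_distr V.smult_assoc1)

lemma smult_mult:
  assumes "c \<in> carrier F" "f \<in> carrier E" "g \<in> carrier E"
  shows "(c \<odot>\<^bsub>E\<^esub> f) \<otimes>\<^bsub>E\<^esub> g = c \<odot>\<^bsub>E\<^esub> (f \<otimes>\<^bsub>E\<^esub> g)"
    and "f \<otimes>\<^bsub>E\<^esub> (c \<odot>\<^bsub>E\<^esub> g) = c \<odot>\<^bsub>E\<^esub> (f \<otimes>\<^bsub>E\<^esub> g)"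
  using assms by (auto intro!: End_alg_eqI[of _ F V] simp: End_closed End_alg_apply End_algD(2-4))

lemma finite_End: assumes "finite (carrier V)" shows "finite (carrier E)"
  by (rule finite_subset[OF _ finite_PiE[OF assms, of "\<lambda>_. carrier V"]])
    (use assms in \<open>auto simp: End_alg_def\<close>)

end

section \<open>Normal subalgebras\<close>

text \<open>The adjugate: for determinant 1 an inverse given by a polynomial formula.\<close>

definition adj :: "'k::field^2^2 \<Rightarrow> 'k^2^2" where
  "adj A = mat2 (A$2$2) (- (A$1$2)) (- (A$2$1)) (A$1$1)"

lemma adj_mat2: "adj (mat2 a b c d) = mat2 d (-b) (-c) a"
  by (simp add: adj_def mat2_def)

lemma det_adj [simp]: "det (adj A) = det A"
  by (cases A rule: mat2_cases) (simp add: adj_mat2 det_mat2)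

lemma adj_mult: "adj (A ** B) = adj B ** adj A"
  by (cases A rule: mat2_cases, cases B rule: mat2_cases)
    (simp add: adj_mat2 mat2_mult mat2_eq_iff algebra_simps)

lemma adj_inverse: "det A = 1 \<Longrightarrow> A ** adj A = mat 1" "det A = 1 \<Longrightarrow> adj A ** A = mat 1"
  by (cases A rule: mat2_cases, simp add: adj_mat2 mat2_mult det_mat2 mat_1_mat2 mat2_eq_iff algebra_simps)+

lemma adj_special [simp]: "adj (mat 1) = mat 1" "adj neg_one = neg_one"
  by (simp_all add: SL2_defs adj_mat2)

text \<open>\<open>simple\<close> and \<open>scalar\<close> express absolute simplicity of V, and
  \<open>dim_le\<close> says that its dimension is at most q. Normality of R is required under SL(2,
  q) only, with \<open>adj\<close> supplying the inverses.\<close>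

locale SL2_normal_subalgebra = vector_space_over F V
  for F :: "('c, 'm) ring_scheme" and V :: "('c, 'v, 'n) module_scheme" +
  fixes \<sigma> :: "'k::{field,finite}^2^2 \<Rightarrow> 'v \<Rightarrow> 'v" and R :: "('v \<Rightarrow> 'v) set" and l r :: nat
  assumes finite_F: "finite (carrier F)" and finite_V: "finite (carrier V)"
    and \<sigma>_closed: "det A = 1 \<Longrightarrow> \<sigma> A \<in> carrier E"
    and \<sigma>_one: "\<sigma> (mat 1) = \<one>\<^bsub>E\<^esub>" and \<sigma>_neg: "\<sigma> neg_one = \<one>\<^bsub>E\<^esub>"
    and \<sigma>_mult: "det A = 1 \<Longrightarrow> det B = 1 \<Longrightarrow> \<sigma> (A ** B) = \<sigma> A \<otimes>\<^bsub>E\<^esub> \<sigma> B"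
    and prime_l: "prime l" and card_k: "CARD('k) = l ^ r" and big: "CARD('k) > 11"
    and dim_le: "card (carrier V) \<le> card (carrier F) ^ CARD('k)"
    and V_nontrivial: "carrier V \<noteq> {\<zero>\<^bsub>V\<^esub>}"
    and simple: "W \<subseteq> carrier V \<Longrightarrow> \<zero>\<^bsub>V\<^esub> \<in> W \<Longrightarrow> (\<And>x y. x \<in> W \<Longrightarrow> y \<in> W \<Longrightarrow> x \<oplus>\<^bsub>V\<^esub> y \<in> W) \<Longrightarrow>
        (\<And>c x. c \<in> carrier F \<Longrightarrow> x \<in> W \<Longrightarrow> c \<odot>\<^bsub>V\<^esub> x \<in> W) \<Longrightarrow>
        (\<And>A x. det A = 1 \<Longrightarrow> x \<in> W \<Longrightarrow> \<sigma> A x \<in> W) \<Longrightarrow> W = {\<zero>\<^bsub>V\<^esub>} \<or> W = carrier V"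
    and scalar: "z \<in> carrier E \<Longrightarrow> (\<And>A. det A = 1 \<Longrightarrow> \<sigma> A \<otimes>\<^bsub>E\<^esub> z = z \<otimes>\<^bsub>E\<^esub> \<sigma> A) \<Longrightarrow>
        \<exists>c\<in>carrier F. z = c \<odot>\<^bsub>E\<^esub> \<one>\<^bsub>E\<^esub>"
    and subring_R: "subring R E"
    and R_smult: "c \<in> carrier F \<Longrightarrow> u \<in> R \<Longrightarrow> c \<odot>\<^bsub>E\<^esub> u \<in> R"
    and R_conj: "det A = 1 \<Longrightarrow> u \<in> R \<Longrightarrow> \<sigma> A \<otimes>\<^bsub>E\<^esub> u \<otimes>\<^bsub>E\<^esub> \<sigma> (adj A) \<in> R"
begin

lemmas R_sub = subringE(1)[OF subring_R]
lemmas R_zero = subringE(2)[OF subring_R]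
lemmas R_one = subringE(3)[OF subring_R]
lemmas R_minus = subringE(5)[OF subring_R]
lemmas R_mult = subringE(6)[OF subring_R]
lemmas R_add = subringE(7)[OF subring_R]

lemma R_E: "u \<in> R \<Longrightarrow> u \<in> carrier E" using R_sub by blast

lemma finite_R: "finite R" using finite_subset[OF R_sub finite_End[OF finite_V]] .

lemma \<sigma>_inverse:
  "det A = 1 \<Longrightarrow> \<sigma> A \<otimes>\<^bsub>E\<^esub> \<sigma> (adj A) = \<one>\<^bsub>E\<^esub>" "det A = 1 \<Longrightarrow> \<sigma> (adj A) \<otimes>\<^bsub>E\<^esub> \<sigma> A = \<one>\<^bsub>E\<^esub>"
  using \<sigma>_mult[of A "adj A"] \<sigma>_mult[of "adj A" A] by (simp_all add: adj_inverse \<sigma>_one)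

definition conj :: "'k^2^2 \<Rightarrow> ('v \<Rightarrow> 'v) \<Rightarrow> 'v \<Rightarrow> 'v" where
  "conj A u = \<sigma> A \<otimes>\<^bsub>E\<^esub> u \<otimes>\<^bsub>E\<^esub> \<sigma> (adj A)"

lemma conj_R: "det A = 1 \<Longrightarrow> u \<in> R \<Longrightarrow> conj A u \<in> R" by (simp add: conj_def R_conj)

lemma conj_E: "det A = 1 \<Longrightarrow> u \<in> carrier E \<Longrightarrow> conj A u \<in> carrier E"
  by (simp add: conj_def \<sigma>_closed)

lemma conj_one: "u \<in> carrier E \<Longrightarrow> conj (mat 1) u = u"
  by (simp add: conj_def \<sigma>_one)

lemma conj_neg: "u \<in> carrier E \<Longrightarrow> conj neg_one u = u"
  by (simp add: conj_def \<sigma>_neg)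

lemma conj_comp: "det A = 1 \<Longrightarrow> det B = 1 \<Longrightarrow> u \<in> carrier E \<Longrightarrow> conj (A ** B) u = conj A (conj B u)"
  by (simp add: conj_def \<sigma>_mult adj_mult \<sigma>_closed E.m_assoc)

lemma conj_inverse: "det A = 1 \<Longrightarrow> u \<in> carrier E \<Longrightarrow> conj A (conj (adj A) u) = u"
   "det A = 1 \<Longrightarrow> u \<in> carrier E \<Longrightarrow> conj (adj A) (conj A u) = u"
  by (simp_all flip: conj_comp add: adj_inverse conj_one)

lemma conj_add: "det A = 1 \<Longrightarrow> u \<in> carrier E \<Longrightarrow> v \<in> carrier E \<Longrightarrow> conj A (u \<oplus>\<^bsub>E\<^esub> v) = conj A u \<oplus>\<^bsub>E\<^esub> conj A v"
  by (simp add: conj_def \<sigma>_closed E.r_distr E.l_distr)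

lemma conj_mult:
  assumes "det A = 1" "u \<in> carrier E" "v \<in> carrier E"
  shows "conj A (u \<otimes>\<^bsub>E\<^esub> v) = conj A u \<otimes>\<^bsub>E\<^esub> conj A v"
proof -
  have "conj A u \<otimes>\<^bsub>E\<^esub> conj A v = \<sigma> A \<otimes>\<^bsub>E\<^esub> (u \<otimes>\<^bsub>E\<^esub> ((\<sigma> (adj A) \<otimes>\<^bsub>E\<^esub> \<sigma> A) \<otimes>\<^bsub>E\<^esub> (v \<otimes>\<^bsub>E\<^esub> \<sigma> (adj A))))"
    using assms by (simp add: conj_def \<sigma>_closed E.m_assoc del: E.one_closed)
  also have "\<dots> = conj A (u \<otimes>\<^bsub>E\<^esub> v)"
    using assms by (simp add: \<sigma>_inverse conj_def \<sigma>_closed E.m_assoc)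
  finally show ?thesis by simp
qed

lemma conj_zero: "det A = 1 \<Longrightarrow> conj A \<zero>\<^bsub>E\<^esub> = \<zero>\<^bsub>E\<^esub>"
  by (simp add: conj_def \<sigma>_closed)

lemma conj_apply: "det A = 1 \<Longrightarrow> u \<in> carrier E \<Longrightarrow> x \<in> carrier V \<Longrightarrow>
    conj A u (\<sigma> A x) = \<sigma> A (u x)"
proof -
  assume A: "det A = 1" and u: "u \<in> carrier E" and x: "x \<in> carrier V"
  have "conj A u (\<sigma> A x) = (\<sigma> A \<otimes>\<^bsub>E\<^esub> u \<otimes>\<^bsub>E\<^esub> \<sigma> (adj A) \<otimes>\<^bsub>E\<^esub> \<sigma> A) x"
    using x by (simp add: conj_def End_alg_apply)
  also have "\<dots> = \<sigma> A (u x)"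
    using A u x by (simp add: E.m_assoc \<sigma>_closed \<sigma>_inverse End_alg_apply)
  finally show ?thesis .
qed

section \<open>Annihilators, minimal ideals and simplicity of R\<close>

definition ann :: "('v \<Rightarrow> 'v) set \<Rightarrow> 'v set" where
  "ann S = {x \<in> carrier V. \<forall>u\<in>S. u x = \<zero>\<^bsub>V\<^esub>}"

lemma ann_zero: "S \<subseteq> carrier E \<Longrightarrow> \<zero>\<^bsub>V\<^esub> \<in> ann S"
  using End_zero by (auto simp: ann_def)

lemma ann_add:
  assumes "S \<subseteq> carrier E" "x \<in> ann S" "y \<in> ann S" shows "x \<oplus>\<^bsub>V\<^esub> y \<in> ann S"
proof -
  have "u (x \<oplus>\<^bsub>V\<^esub> y) = \<zero>\<^bsub>V\<^esub>" if "u \<in> S" for u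
  proof -
    have "u \<in> carrier E" using assms(1) that by blast
    then have "u (x \<oplus>\<^bsub>V\<^esub> y) = u x \<oplus>\<^bsub>V\<^esub> u y" using assms by (intro End_algD(3)) (auto simp: ann_def)
    moreover have "u x = \<zero>\<^bsub>V\<^esub>" "u y = \<zero>\<^bsub>V\<^esub>" using assms that by (auto simp: ann_def)
    ultimately show ?thesis by simp
  qed
  then show ?thesis using assms by (simp add: ann_def)
qed

lemma ann_smult:
  assumes "S \<subseteq> carrier E" "c \<in> carrier F" "x \<in> ann S" shows "c \<odot>\<^bsub>V\<^esub> x \<in> ann S"
proof -
  have "u (c \<odot>\<^bsub>V\<^esub> x) = \<zero>\<^bsub>V\<^esub>" if "u \<in> S" for u
  proof -
    have "u \<in> carrier E" using assms(1) that by blast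
    then have "u (c \<odot>\<^bsub>V\<^esub> x) = c \<odot>\<^bsub>V\<^esub> u x" using assms by (intro End_algD(4)) (auto simp: ann_def)
    moreover have "u x = \<zero>\<^bsub>V\<^esub>" using assms that by (auto simp: ann_def)
    ultimately show ?thesis using assms by (simp add: smult_zero_right)
  qed
  then show ?thesis using assms by (simp add: ann_def)
qed

lemma ann_antimono: "S \<subseteq> S' \<Longrightarrow> ann S' \<subseteq> ann S"
  by (auto simp: ann_def)

lemma ann_sub: "ann S \<subseteq> carrier V"
  by (auto simp: ann_def)

text \<open>The vectors killed by a conjugation-stable set form an invariant subspace, because w
  applied to \<open>\<sigma> A x\<close> is \<open>\<sigma> A\<close> applied to w' x for a
  conjugate w' of w. Simplicity of V leaves 0 or V, and V would make every element of S
  zero.\<close>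

lemma ann_conj_stable:
  assumes S: "S \<subseteq> carrier E" and stable: "\<And>A u. det A = 1 \<Longrightarrow> u \<in> S \<Longrightarrow> conj A u \<in> S"
    and nz: "u \<in> S" "u \<noteq> \<zero>\<^bsub>E\<^esub>"
  shows "ann S = {\<zero>\<^bsub>V\<^esub>}"
proof -
  have "ann S = {\<zero>\<^bsub>V\<^esub>} \<or> ann S = carrier V"
  proof (rule simple)
    show "ann S \<subseteq> carrier V" by (auto simp: ann_def)
    show "\<sigma> A x \<in> ann S" if A: "det A = 1" and x: "x \<in> ann S" for A x
    proof -
      have xV: "x \<in> carrier V" using x by (simp add: ann_def)
      have "w (\<sigma> A x) = \<zero>\<^bsub>V\<^esub>" if w: "w \<in> S" for w
      proof -
        have wE: "w \<in> carrier E" using w S by blast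
        have "w (\<sigma> A x) = conj A (conj (adj A) w) (\<sigma> A x)" using A wE by (simp add: conj_inverse)
        also have "\<dots> = \<sigma> A (conj (adj A) w x)" using A wE xV by (simp add: conj_apply conj_E)
        also have "conj (adj A) w x = \<zero>\<^bsub>V\<^esub>" using x stable[of "adj A" w] A w by (simp add: ann_def)
        finally show ?thesis using A by (simp add: End_zero \<sigma>_closed)
      qed
      then show ?thesis using xV A End_algD(2)[OF \<sigma>_closed] by (simp add: ann_def)
    qed
  qed (use S ann_zero ann_add ann_smult in auto)
  moreover have "ann S \<noteq> carrier V"
  proof
    assume "ann S = carrier V"
    then have "u x = \<zero>\<^bsub>V\<^esub>" if "x \<in> carrier V" for x using nz(1) that by (auto simp: ann_def)
    then have "u = \<zero>\<^bsub>E\<^esub>"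
      using nz(1) S by (intro End_alg_eqI[of _ F V]) (auto simp: End_alg_apply)
    then show False using nz(2) by simp
  qed
  ultimately show ?thesis by simp
qed

text \<open>Closure under negation is implied, since R contains -1.\<close>

definition two_sided :: "('v \<Rightarrow> 'v) set \<Rightarrow> bool" where
  "two_sided I \<longleftrightarrow> I \<subseteq> R \<and> \<zero>\<^bsub>E\<^esub> \<in> I \<and> (\<forall>x\<in>I. \<forall>y\<in>I. x \<oplus>\<^bsub>E\<^esub> y \<in> I) \<and>
     (\<forall>x\<in>I. \<forall>u\<in>R. u \<otimes>\<^bsub>E\<^esub> x \<in> I \<and> x \<otimes>\<^bsub>E\<^esub> u \<in> I)"

definition left_sided :: "('v \<Rightarrow> 'v) set \<Rightarrow> bool" where
  "left_sided L \<longleftrightarrow> L \<subseteq> R \<and> \<zero>\<^bsub>E\<^esub> \<in> L \<and> (\<forall>x\<in>L. \<forall>y\<in>L. x \<oplus>\<^bsub>E\<^esub> y \<in> L) \<and>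
     (\<forall>x\<in>L. \<forall>u\<in>R. u \<otimes>\<^bsub>E\<^esub> x \<in> L)"

lemma two_sided_left: "two_sided I \<Longrightarrow> left_sided I"
  by (simp add: two_sided_def left_sided_def)

lemma left_sided_diff:
  assumes "left_sided L" "x \<in> L" "y \<in> L" shows "x \<ominus>\<^bsub>E\<^esub> y \<in> L"
proof -
  have LR: "L \<subseteq> R" using assms by (simp add: left_sided_def)
  have "\<ominus>\<^bsub>E\<^esub> y = (\<ominus>\<^bsub>E\<^esub> \<one>\<^bsub>E\<^esub>) \<otimes>\<^bsub>E\<^esub> y"
    using assms LR R_E by (simp add: E.l_minus subset_iff)
  also have "\<dots> \<in> L" using assms R_minus[OF R_one] by (auto simp: left_sided_def)
  finally show ?thesis using assms by (simp add: a_minus_def left_sided_def)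
qed

definition minimal_ideal :: "('v \<Rightarrow> 'v) set \<Rightarrow> bool" where
  "minimal_ideal I \<longleftrightarrow> two_sided I \<and> I \<noteq> {\<zero>\<^bsub>E\<^esub>} \<and>
     (\<forall>J. two_sided J \<longrightarrow> J \<subseteq> I \<longrightarrow> J \<noteq> {\<zero>\<^bsub>E\<^esub>} \<longrightarrow> J = I)"

lemma ex_minimal_ideal:
  assumes "two_sided I" "I \<noteq> {\<zero>\<^bsub>E\<^esub>}"
  shows "\<exists>J. minimal_ideal J \<and> J \<subseteq> I"
proof -
  let ?P = "\<lambda>J. two_sided J \<and> J \<noteq> {\<zero>\<^bsub>E\<^esub>} \<and> J \<subseteq> I"
  have "?P I" using assms by simp
  from ex_has_least_nat[of ?P, OF this, of card]
  obtain J where J: "?P J" and least: "\<And>K. ?P K \<Longrightarrow> card J \<le> card K" by blast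
  have "K = J" if K: "two_sided K" "K \<subseteq> J" "K \<noteq> {\<zero>\<^bsub>E\<^esub>}" for K
  proof (rule card_seteq)
    show "finite J" using J finite_R finite_subset by (auto simp: two_sided_def)
    show "card J \<le> card K" using least K J by blast
  qed (rule K(2))
  then show ?thesis using J by (auto simp: minimal_ideal_def)
qed

lemma two_sided_conj:
  assumes I: "two_sided I" and A: "det A = 1" shows "two_sided (conj A ` I)"
proof -
  have IR: "I \<subseteq> R" using I by (simp add: two_sided_def)
  have u: "u \<otimes>\<^bsub>E\<^esub> conj A x \<in> conj A ` I" "conj A x \<otimes>\<^bsub>E\<^esub> u \<in> conj A ` I"
    if x: "x \<in> I" and u: "u \<in> R" for x u
  proof -
    have u': "conj (adj A) u \<in> R" using u A by (simp add: conj_R)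
    have "conj A (conj (adj A) u \<otimes>\<^bsub>E\<^esub> x) = u \<otimes>\<^bsub>E\<^esub> conj A x"
      and "conj A (x \<otimes>\<^bsub>E\<^esub> conj (adj A) u) = conj A x \<otimes>\<^bsub>E\<^esub> u"
      using A u x u' IR R_E by (simp_all add: conj_mult conj_inverse subset_iff)
    moreover have "conj (adj A) u \<otimes>\<^bsub>E\<^esub> x \<in> I" "x \<otimes>\<^bsub>E\<^esub> conj (adj A) u \<in> I"
      using I x u' by (simp_all add: two_sided_def)
    ultimately show "u \<otimes>\<^bsub>E\<^esub> conj A x \<in> conj A ` I" "conj A x \<otimes>\<^bsub>E\<^esub> u \<in> conj A ` I"
      by (metis imageI)+
  qed
  have add: "conj A x \<oplus>\<^bsub>E\<^esub> conj A y \<in> conj A ` I" if "x \<in> I" "y \<in> I" for x y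
  proof -
    have "conj A (x \<oplus>\<^bsub>E\<^esub> y) = conj A x \<oplus>\<^bsub>E\<^esub> conj A y"
      using that A IR R_E by (simp add: conj_add subset_iff)
    moreover have "x \<oplus>\<^bsub>E\<^esub> y \<in> I" using I that by (simp add: two_sided_def)
    ultimately show ?thesis by (metis imageI)
  qed
  have "\<zero>\<^bsub>E\<^esub> \<in> conj A ` I"
    using I conj_zero[OF A] by (metis imageI two_sided_def)
  then show ?thesis
    using u add IR A conj_R unfolding two_sided_def by (auto simp: subset_iff)
qed

lemma conj_image_comp: "det A = 1 \<Longrightarrow> det B = 1 \<Longrightarrow> I \<subseteq> R \<Longrightarrow> conj (A ** B) ` I = conj A ` conj B ` I"
  using R_E by (force simp: image_image conj_comp subset_iff)

lemma conj_image_id: "I \<subseteq> R \<Longrightarrow> conj (mat 1) ` I = I" "I \<subseteq> R \<Longrightarrow> conj neg_one ` I = I"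
  using R_E by (force simp: conj_one conj_neg subset_iff)+

lemma minimal_ideal_conj:
  assumes I: "minimal_ideal I" and A: "det A = 1" shows "minimal_ideal (conj A ` I)"
proof -
  have ts: "two_sided I" and IR: "I \<subseteq> R" and nz: "I \<noteq> {\<zero>\<^bsub>E\<^esub>}"
    using I by (auto simp: minimal_ideal_def two_sided_def)
  have round_trip: "conj A ` conj (adj A) ` K = K" "conj (adj A) ` conj A ` K = K" if "K \<subseteq> R" for K
    using that A by (simp_all add: conj_image_comp[symmetric] adj_inverse conj_image_id)
  have zero_img: "conj B ` {\<zero>\<^bsub>E\<^esub>} = {\<zero>\<^bsub>E\<^esub>}" if "det B = 1" for B using that by (simp add: conj_zero)
  have "J = conj A ` I" if J: "two_sided J" "J \<subseteq> conj A ` I" "J \<noteq> {\<zero>\<^bsub>E\<^esub>}" for J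
  proof -
    have JR: "J \<subseteq> R" using J by (simp add: two_sided_def)
    have "conj (adj A) ` J = I"
    proof -
      have "two_sided (conj (adj A) ` J)" using J A by (simp add: two_sided_conj)
      moreover have "conj (adj A) ` J \<subseteq> I" using J(2) round_trip(2)[OF IR] by blast
      moreover have "conj (adj A) ` J \<noteq> {\<zero>\<^bsub>E\<^esub>}" using round_trip(1)[OF JR] J(3) zero_img[OF A] by auto
      ultimately show ?thesis using I by (simp add: minimal_ideal_def)
    qed
    then show ?thesis using round_trip(1)[OF JR] by simp
  qed
  moreover have "conj A ` I \<noteq> {\<zero>\<^bsub>E\<^esub>}"
    using round_trip(2)[OF IR] nz zero_img[of "adj A"] A by auto
  ultimately show ?thesis using two_sided_conj[OF ts A] by (simp add: minimal_ideal_def)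
qed

text \<open>The product lies in the ideal I \<inter> J, which is zero by minimality of both.\<close>

lemma minimal_ideals_orthogonal:
  assumes "minimal_ideal I" "minimal_ideal J" "I \<noteq> J" "x \<in> I" "y \<in> J"
  shows "x \<otimes>\<^bsub>E\<^esub> y = \<zero>\<^bsub>E\<^esub>"
proof -
  have ts: "two_sided I" "two_sided J" using assms by (auto simp: minimal_ideal_def)
  have "two_sided (I \<inter> J)" using ts by (auto simp: two_sided_def)
  then have "I \<inter> J = {\<zero>\<^bsub>E\<^esub>}"
    using assms(1-3) unfolding minimal_ideal_def by (metis Int_lower1 Int_lower2)
  moreover have "x \<otimes>\<^bsub>E\<^esub> y \<in> I \<inter> J" using ts assms(4,5) by (auto simp: two_sided_def)
  ultimately show ?thesis by blast
qed

text \<open>The counting form of the fact that a proper inclusion of subspaces raises the dimension: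
  the vectors c v + x with x in U are pairwise distinct.\<close>

lemma card_subspace_extend:
  assumes sub: "U \<subseteq> U'" "U' \<subseteq> carrier V"
    and add: "\<And>x y. x \<in> U' \<Longrightarrow> y \<in> U' \<Longrightarrow> x \<oplus>\<^bsub>V\<^esub> y \<in> U'"
    and sm: "\<And>c x. c \<in> carrier F \<Longrightarrow> x \<in> U' \<Longrightarrow> c \<odot>\<^bsub>V\<^esub> x \<in> U'"
    and addU: "\<And>x y. x \<in> U \<Longrightarrow> y \<in> U \<Longrightarrow> x \<oplus>\<^bsub>V\<^esub> y \<in> U"
    and smU: "\<And>c x. c \<in> carrier F \<Longrightarrow> x \<in> U \<Longrightarrow> c \<odot>\<^bsub>V\<^esub> x \<in> U"
    and v: "v \<in> U'" "v \<notin> U"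
  shows "card (carrier F) * card U \<le> card U'"
proof -
  have vV: "v \<in> carrier V" and UV: "\<And>x. x \<in> U \<Longrightarrow> x \<in> carrier V" using v sub by auto
  have "inj_on (\<lambda>(c, x). c \<odot>\<^bsub>V\<^esub> v \<oplus>\<^bsub>V\<^esub> x) (carrier F \<times> U)"
  proof (rule inj_onI, clarify)
    fix c x d y assume c: "c \<in> carrier F" and x: "x \<in> U" and d: "d \<in> carrier F" and y: "y \<in> U"
      and eq: "c \<odot>\<^bsub>V\<^esub> v \<oplus>\<^bsub>V\<^esub> x = d \<odot>\<^bsub>V\<^esub> v \<oplus>\<^bsub>V\<^esub> y"
    have my: "\<ominus>\<^bsub>V\<^esub> x \<in> U"
    proof -
      have "(\<ominus>\<^bsub>F\<^esub> \<one>\<^bsub>F\<^esub>) \<odot>\<^bsub>V\<^esub> x = \<ominus>\<^bsub>V\<^esub> x" using UV[OF x] by (simp add: V.smult_l_minus)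
      then show ?thesis using smU[of "\<ominus>\<^bsub>F\<^esub> \<one>\<^bsub>F\<^esub>" x] x by simp
    qed
    have diff: "(c \<ominus>\<^bsub>F\<^esub> d) \<odot>\<^bsub>V\<^esub> v = y \<oplus>\<^bsub>V\<^esub> \<ominus>\<^bsub>V\<^esub> x"
    proof -
      have "(c \<ominus>\<^bsub>F\<^esub> d) \<odot>\<^bsub>V\<^esub> v = c \<odot>\<^bsub>V\<^esub> v \<oplus>\<^bsub>V\<^esub> \<ominus>\<^bsub>V\<^esub> (d \<odot>\<^bsub>V\<^esub> v)"
        using c d vV by (simp add: a_minus_def V.smult_l_distr V.smult_l_minus)
      also have "c \<odot>\<^bsub>V\<^esub> v = (d \<odot>\<^bsub>V\<^esub> v \<oplus>\<^bsub>V\<^esub> y) \<oplus>\<^bsub>V\<^esub> \<ominus>\<^bsub>V\<^esub> x"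
        using c d vV UV[OF x] UV[OF y] eq[symmetric] by (simp add: V.a_assoc V.r_neg)
      also have "(d \<odot>\<^bsub>V\<^esub> v \<oplus>\<^bsub>V\<^esub> y) \<oplus>\<^bsub>V\<^esub> \<ominus>\<^bsub>V\<^esub> x \<oplus>\<^bsub>V\<^esub> \<ominus>\<^bsub>V\<^esub> (d \<odot>\<^bsub>V\<^esub> v) = (d \<odot>\<^bsub>V\<^esub> v \<oplus>\<^bsub>V\<^esub> \<ominus>\<^bsub>V\<^esub> (d \<odot>\<^bsub>V\<^esub> v)) \<oplus>\<^bsub>V\<^esub> (y \<oplus>\<^bsub>V\<^esub> \<ominus>\<^bsub>V\<^esub> x)"
        using d vV UV[OF x] UV[OF y] by (simp add: V.a_ac)
      also have "\<dots> = y \<oplus>\<^bsub>V\<^esub> \<ominus>\<^bsub>V\<^esub> x"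
        using d vV UV[OF x] UV[OF y] by (simp add: V.r_neg)
      finally show ?thesis .
    qed
    have "c \<ominus>\<^bsub>F\<^esub> d = \<zero>\<^bsub>F\<^esub>"
    proof (rule ccontr)
      assume "c \<ominus>\<^bsub>F\<^esub> d \<noteq> \<zero>\<^bsub>F\<^esub>"
      then have unit: "c \<ominus>\<^bsub>F\<^esub> d \<in> Units F" using c d by (simp add: F.field_Units)
      have "inv\<^bsub>F\<^esub> (c \<ominus>\<^bsub>F\<^esub> d) \<odot>\<^bsub>V\<^esub> ((c \<ominus>\<^bsub>F\<^esub> d) \<odot>\<^bsub>V\<^esub> v) \<in> U"
        unfolding diff using x y my addU smU unit by simp
      moreover have "inv\<^bsub>F\<^esub> (c \<ominus>\<^bsub>F\<^esub> d) \<odot>\<^bsub>V\<^esub> ((c \<ominus>\<^bsub>F\<^esub> d) \<odot>\<^bsub>V\<^esub> v) = v"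
        using unit vV c d by (simp add: V.smult_assoc1[symmetric])
      ultimately show False using v(2) by simp
    qed
    then have "c = d" using c d by simp
    moreover have "x = y" using eq \<open>c = d\<close> d vV UV[OF x] UV[OF y] by simp
    ultimately show "c = d \<and> x = y" by simp
  qed
  moreover have "(\<lambda>(c, x). c \<odot>\<^bsub>V\<^esub> v \<oplus>\<^bsub>V\<^esub> x) ` (carrier F \<times> U) \<subseteq> U'"
    using add sm v sub by auto
  moreover have "finite U'" using sub finite_V finite_subset by blast
  ultimately have "card (carrier F \<times> U) \<le> card U'" by (rule card_inj_on_le)
  then show ?thesis by (simp add: card_cartesian_product)
qed

text \<open>Release the ideals one at a time from the family that has to annihilate. When J is
  released, the images of its elements become annihilated, by orthogonality; a nonzero vector among
  them was not annihilated before, or the whole family would kill it. So each release gains a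
  dimension.\<close>

lemma card_orthogonal_family:
  assumes fin: "finite \<J>" and min: "\<And>J. J \<in> \<J> \<Longrightarrow> minimal_ideal J" and ann0: "ann (\<Union>\<J>) = {\<zero>\<^bsub>V\<^esub>}"
  shows "card (carrier F) ^ card \<J> \<le> card (carrier V)"
proof -
  have sub: "\<Union>\<K> \<subseteq> carrier E" if "\<K> \<subseteq> \<J>" for \<K>
    using that min R_E by (fastforce simp: minimal_ideal_def two_sided_def)
  have "card (carrier F) ^ card \<S> \<le> card (ann (\<Union>(\<J> - \<S>)))" if "finite \<S>" "\<S> \<subseteq> \<J>" for \<S>
    using that
  proof (induction \<S> rule: finite_induct)
    case empty
    then show ?case using ann0 by simp
  next
    case (insert J \<S>)
    have J: "J \<in> \<J>" "J \<notin> \<S>" using insert by auto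
    have subs: "\<Union>(\<J> - \<S>) \<subseteq> carrier E" "\<Union>(\<J> - insert J \<S>) \<subseteq> carrier E" by (rule sub; blast)+
    obtain u where u: "u \<in> J" "u \<noteq> \<zero>\<^bsub>E\<^esub>"
      using min[OF J(1)] by (auto simp: minimal_ideal_def two_sided_def)
    have uE: "u \<in> carrier E" using u J(1) sub[of \<J>] by blast
    have "\<exists>x\<in>carrier V. u x \<noteq> \<zero>\<^bsub>V\<^esub>"
    proof (rule ccontr)
      assume "\<not> ?thesis"
      then have "u = \<zero>\<^bsub>E\<^esub>" using uE by (intro End_alg_eqI[of _ F V]) (auto simp: End_alg_apply)
      then show False using u by simp
    qed
    then obtain x where x: "x \<in> carrier V" "u x \<noteq> \<zero>\<^bsub>V\<^esub>" by blast
    have kill: "w (u x) = \<zero>\<^bsub>V\<^esub>" if "w \<in> J'" "J' \<in> \<J>" "J' \<noteq> J" for w J'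
    proof -
      have "w \<otimes>\<^bsub>E\<^esub> u = \<zero>\<^bsub>E\<^esub>"
        using minimal_ideals_orthogonal min that J u(1) by blast
      then show ?thesis using x End_alg_apply(1)[OF x(1), of F w u] by (simp add: End_alg_apply)
    qed
    have ux: "u x \<in> carrier V" using uE x by (simp add: End_algD(2))
    have in': "u x \<in> ann (\<Union>(\<J> - insert J \<S>))" using kill ux by (auto simp: ann_def)
    have notin: "u x \<notin> ann (\<Union>(\<J> - \<S>))"
    proof
      assume "u x \<in> ann (\<Union>(\<J> - \<S>))"
      then have "w (u x) = \<zero>\<^bsub>V\<^esub>" if "w \<in> J" for w using that J by (auto simp: ann_def)
      then have "u x \<in> ann (\<Union>\<J>)" using kill ux by (auto simp: ann_def)
      then show False using ann0 x by simp
    qed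
    have "card (carrier F) * card (ann (\<Union>(\<J> - \<S>))) \<le> card (ann (\<Union>(\<J> - insert J \<S>)))"
      by (rule card_subspace_extend[OF ann_antimono ann_sub ann_add[OF subs(2)] ann_smult[OF subs(2)]
          ann_add[OF subs(1)] ann_smult[OF subs(1)] in' notin]) auto
    moreover have "card (carrier F) ^ card \<S> \<le> card (ann (\<Union>(\<J> - \<S>)))" using insert by simp
    ultimately show ?case
      using insert by simp (meson le_trans mult_le_mono2)
  qed
  from this[OF fin] show ?thesis by (simp add: ann_def)
qed

lemma minimal_ideal_stable:
  assumes I: "minimal_ideal I" and A: "det A = 1" shows "conj A ` I = I"
proof -
  have IR: "I \<subseteq> R" using I by (simp add: minimal_ideal_def two_sided_def)
  define \<J> where "\<J> = {conj B ` I |B. det B = 1}"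
  have min: "minimal_ideal J" if "J \<in> \<J>" for J using that minimal_ideal_conj[OF I] by (auto simp: \<J>_def)
  have JR: "J \<subseteq> R" if "J \<in> \<J>" for J using min[OF that] by (simp add: minimal_ideal_def two_sided_def)
  have fin: "finite \<J>" using JR finite_R by (intro finite_subset[of \<J> "Pow R"]) auto
  have closed: "conj B ` J \<in> \<J>" if B: "det B = 1" and J: "J \<in> \<J>" for B J
  proof -
    obtain C where C: "det C = 1" "J = conj C ` I" using J by (auto simp: \<J>_def)
    then have "conj B ` J = conj (B ** C) ` I" using B IR by (simp add: conj_image_comp)
    then show ?thesis using B C unfolding \<J>_def by (intro CollectI exI[of _ "B ** C"]) simp
  qed
  have I_in: "I \<in> \<J>" unfolding \<J>_def
    by (intro CollectI exI[of _ "mat 1"]) (simp add: conj_image_id IR)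
  obtain u where u: "u \<in> I" "u \<noteq> \<zero>\<^bsub>E\<^esub>"
    using I by (auto simp: minimal_ideal_def two_sided_def)
  have ann0: "ann (\<Union>\<J>) = {\<zero>\<^bsub>V\<^esub>}"
  proof (rule ann_conj_stable)
    show "\<Union>\<J> \<subseteq> carrier E" using JR R_sub by blast
    show "conj B w \<in> \<Union>\<J>" if "det B = 1" "w \<in> \<Union>\<J>" for B w
      using that closed by blast
    show "u \<in> \<Union>\<J>" using u I_in by blast
  qed (rule u(2))
  have "card (carrier F) ^ card \<J> \<le> card (carrier V)"
    by (rule card_orthogonal_family[OF fin min ann0])
  also have "\<dots> \<le> card (carrier F) ^ CARD('k)" by (rule dim_le)
  finally have pow: "card (carrier F) ^ card \<J> \<le> card (carrier F) ^ CARD('k)" .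
  have "card {\<zero>\<^bsub>F\<^esub>, \<one>\<^bsub>F\<^esub>} \<le> card (carrier F)" by (intro card_mono finite_F) auto
  then have "1 < card (carrier F)" by simp
  then have small: "card \<J> \<le> CARD('k)" using pow by (simp add: power_le_imp_le_exp)
  have "\<not> 1 < card \<J>"
  proof
    assume "1 < card \<J>"
    interpret T: SL2_transitive_action "\<lambda>A J. conj A ` J" \<J>
    proof
      show "\<exists>C. det C = 1 \<and> conj C ` J = J'" if "J \<in> \<J>" "J' \<in> \<J>" for J J'
      proof -
        obtain B where B: "det B = 1" "J = conj B ` I" using \<open>J \<in> \<J>\<close> by (auto simp: \<J>_def)
        obtain C where C: "det C = 1" "J' = conj C ` I" using \<open>J' \<in> \<J>\<close> by (auto simp: \<J>_def)
        have "conj (C ** adj B) ` J = conj C ` conj (adj B ** B) ` I"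
          using B C IR JR[OF \<open>J \<in> \<J>\<close>] by (simp add: conj_image_comp)
        then have "conj (C ** adj B) ` J = J'" using B C IR by (simp add: adj_inverse conj_image_id)
        then show ?thesis using B C by (intro exI[of _ "C ** adj B"]) simp
      qed
    qed (use fin closed JR conj_image_id conj_image_comp \<open>1 < card \<J>\<close> in auto)
    have "CARD('k) + 1 \<le> card \<J>" by (rule T.card_ge_Suc_card_field[OF prime_l card_k big])
    then show False using small by simp
  qed
  moreover have "card {I, conj A ` I} \<le> card \<J>" using I_in closed A fin by (intro card_mono) auto
  ultimately show ?thesis by (auto simp: card_insert_if split: if_splits)
qed

text \<open>A minimal ideal inside I is conjugation-stable, although I itself is not known to be,
  and the annihilator of I is contained in that of the smaller ideal.\<close>

lemma ann_two_sided:
  assumes "two_sided I" "I \<noteq> {\<zero>\<^bsub>E\<^esub>}" shows "ann I = {\<zero>\<^bsub>V\<^esub>}"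
proof -
  obtain J where J: "minimal_ideal J" "J \<subseteq> I" using ex_minimal_ideal[OF assms] by blast
  have JE: "J \<subseteq> carrier E" and IE: "I \<subseteq> carrier E"
    using J assms R_sub by (auto simp: minimal_ideal_def two_sided_def)
  obtain u where u: "u \<in> J" "u \<noteq> \<zero>\<^bsub>E\<^esub>"
    using J(1) by (auto simp: minimal_ideal_def two_sided_def)
  have "ann J = {\<zero>\<^bsub>V\<^esub>}"
    using minimal_ideal_stable[OF J(1)] by (intro ann_conj_stable[OF JE _ u]) blast
  then show ?thesis using ann_antimono[OF J(2)] ann_zero[OF IE] by blast
qed

text \<open>Brauer's lemma for a minimal left ideal M inside L. If M had square zero, its left
  annihilator in R would be a nonzero two-sided ideal killing the image of every element of M,
  against \<open>ann_two_sided\<close>.\<close>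

lemma ex_idempotent:
  assumes L: "left_sided L" "L \<noteq> {\<zero>\<^bsub>E\<^esub>}"
  shows "\<exists>e\<in>L. e \<otimes>\<^bsub>E\<^esub> e = e \<and> e \<noteq> \<zero>\<^bsub>E\<^esub>"
proof -
  let ?P = "\<lambda>M. left_sided M \<and> M \<noteq> {\<zero>\<^bsub>E\<^esub>} \<and> M \<subseteq> L"
  have "?P L" using assms by simp
  from ex_has_least_nat[of ?P, OF this, of card]
  obtain M where M: "?P M" and least: "\<And>K. ?P K \<Longrightarrow> card M \<le> card K" by blast
  have MR: "M \<subseteq> R" and M0: "\<zero>\<^bsub>E\<^esub> \<in> M" using M by (auto simp: left_sided_def)
  have ME: "x \<in> carrier E" if "x \<in> M" for x using that MR R_sub by blast
  have min: "K = M" if K: "left_sided K" "K \<subseteq> M" "K \<noteq> {\<zero>\<^bsub>E\<^esub>}" for K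
  proof (rule card_seteq)
    show "finite M" using MR finite_R finite_subset by blast
    show "card M \<le> card K" using least K M by blast
  qed (rule K(2))
  have "\<exists>x\<in>M. \<exists>y\<in>M. x \<otimes>\<^bsub>E\<^esub> y \<noteq> \<zero>\<^bsub>E\<^esub>"
  proof (rule ccontr)
    assume neg: "\<not> ?thesis"
    define A where "A = {u \<in> R. \<forall>x\<in>M. u \<otimes>\<^bsub>E\<^esub> x = \<zero>\<^bsub>E\<^esub>}"
    have MA: "M \<subseteq> A" using neg MR by (auto simp: A_def)
    obtain x where x: "x \<in> M" "x \<noteq> \<zero>\<^bsub>E\<^esub>" using M M0 by blast
    have "two_sided A"
      unfolding two_sided_def
    proof (intro conjI ballI)
      fix u w assume u: "u \<in> A" and w: "w \<in> R"
      have uE: "u \<in> carrier E" and wE: "w \<in> carrier E" and uR: "u \<in> R" using u w R_E by (auto simp: A_def)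
      show "w \<otimes>\<^bsub>E\<^esub> u \<in> A"
        using u uE wE w uR ME by (simp add: A_def R_mult E.m_assoc)
      have "w \<otimes>\<^bsub>E\<^esub> x \<in> M" if "x \<in> M" for x using M w that by (simp add: left_sided_def)
      then show "u \<otimes>\<^bsub>E\<^esub> w \<in> A"
        using u uE wE w uR ME by (simp add: A_def R_mult E.m_assoc)
    next
      fix u w assume "u \<in> A" "w \<in> A"
      then show "u \<oplus>\<^bsub>E\<^esub> w \<in> A" using ME R_E by (simp add: A_def R_add E.l_distr)
    qed (use ME R_zero in \<open>auto simp: A_def\<close>)
    moreover have "A \<noteq> {\<zero>\<^bsub>E\<^esub>}" using MA x by blast
    ultimately have annA: "ann A = {\<zero>\<^bsub>V\<^esub>}" by (rule ann_two_sided)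
    have "x v = \<zero>\<^bsub>V\<^esub>" if v: "v \<in> carrier V" for v
    proof -
      have "u (x v) = \<zero>\<^bsub>V\<^esub>" if "u \<in> A" for u
      proof -
        have "u \<otimes>\<^bsub>E\<^esub> x = \<zero>\<^bsub>E\<^esub>" using that x by (simp add: A_def)
        then show ?thesis using End_alg_apply(1)[OF v, of F u x] v by (simp add: End_alg_apply)
      qed
      then have "x v \<in> ann A" using ME[OF x(1)] v by (simp add: ann_def End_algD(2))
      then show ?thesis using annA by simp
    qed
    then have "x = \<zero>\<^bsub>E\<^esub>" using ME[OF x(1)] by (intro End_alg_eqI[of _ F V]) (auto simp: End_alg_apply)
    then show False using x by simp
  qed
  then obtain x y where xy: "x \<in> M" "y \<in> M" "x \<otimes>\<^bsub>E\<^esub> y \<noteq> \<zero>\<^bsub>E\<^esub>" by blast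
  have "(\<lambda>z. z \<otimes>\<^bsub>E\<^esub> y) ` M = M"
  proof (rule min)
    show "(\<lambda>z. z \<otimes>\<^bsub>E\<^esub> y) ` M \<subseteq> M" using M MR xy by (auto simp: left_sided_def)
    show "(\<lambda>z. z \<otimes>\<^bsub>E\<^esub> y) ` M \<noteq> {\<zero>\<^bsub>E\<^esub>}" using xy by blast
    show "left_sided ((\<lambda>z. z \<otimes>\<^bsub>E\<^esub> y) ` M)" unfolding left_sided_def
    proof (intro conjI ballI)
      show "(\<lambda>z. z \<otimes>\<^bsub>E\<^esub> y) ` M \<subseteq> R" using MR xy R_mult by auto
      show "\<zero>\<^bsub>E\<^esub> \<in> (\<lambda>z. z \<otimes>\<^bsub>E\<^esub> y) ` M"
        using M0 ME[OF xy(2)] by (intro image_eqI[of _ _ "\<zero>\<^bsub>E\<^esub>"]) simp_all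
    next
      fix a b assume "a \<in> (\<lambda>z. z \<otimes>\<^bsub>E\<^esub> y) ` M" "b \<in> (\<lambda>z. z \<otimes>\<^bsub>E\<^esub> y) ` M"
      then obtain z w where zw: "z \<in> M" "a = z \<otimes>\<^bsub>E\<^esub> y" "w \<in> M" "b = w \<otimes>\<^bsub>E\<^esub> y" by blast
      then show "a \<oplus>\<^bsub>E\<^esub> b \<in> (\<lambda>z. z \<otimes>\<^bsub>E\<^esub> y) ` M"
        using M ME xy by (intro image_eqI[of _ _ "z \<oplus>\<^bsub>E\<^esub> w"]) (simp_all add: E.l_distr left_sided_def)
    next
      fix a u assume "a \<in> (\<lambda>z. z \<otimes>\<^bsub>E\<^esub> y) ` M" "u \<in> R"
      then obtain z where z: "z \<in> M" "a = z \<otimes>\<^bsub>E\<^esub> y" by blast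
      then show "u \<otimes>\<^bsub>E\<^esub> a \<in> (\<lambda>z. z \<otimes>\<^bsub>E\<^esub> y) ` M"
        using M ME xy \<open>u \<in> R\<close> R_E by (intro image_eqI[of _ _ "u \<otimes>\<^bsub>E\<^esub> z"]) (simp_all add: E.m_assoc left_sided_def)
    qed
  qed
  then have "y \<in> (\<lambda>z. z \<otimes>\<^bsub>E\<^esub> y) ` M" using xy(2) by simp
  \<comment> \<open>By minimality, right multiplication by y maps M onto M, so that y = e y for some
    e in M. Its kernel N on M is zero, again by minimality, and contains e e - e.\<close>
  then obtain e where "y = e \<otimes>\<^bsub>E\<^esub> y" "e \<in> M" by (rule imageE)
  then have e: "e \<in> M" "e \<otimes>\<^bsub>E\<^esub> y = y" by simp_all
  have eE: "e \<in> carrier E" and yE: "y \<in> carrier E" using e xy ME by auto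
  define N where "N = {z \<in> M. z \<otimes>\<^bsub>E\<^esub> y = \<zero>\<^bsub>E\<^esub>}"
  have "left_sided N" unfolding left_sided_def
  proof (intro conjI ballI)
    fix z u assume "z \<in> N" "u \<in> R"
    then show "u \<otimes>\<^bsub>E\<^esub> z \<in> N" using M ME yE R_E by (simp add: N_def E.m_assoc left_sided_def)
  next
    fix z w assume "z \<in> N" "w \<in> N"
    then show "z \<oplus>\<^bsub>E\<^esub> w \<in> N" using M ME yE by (simp add: N_def E.l_distr left_sided_def)
  qed (use MR M0 yE in \<open>auto simp: N_def\<close>)
  moreover have "N \<noteq> M" using xy by (auto simp: N_def)
  ultimately have N0: "N = {\<zero>\<^bsub>E\<^esub>}" using min[of N] by (auto simp: N_def)
  have "e \<otimes>\<^bsub>E\<^esub> e \<ominus>\<^bsub>E\<^esub> e \<in> N"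
  proof -
    have "e \<otimes>\<^bsub>E\<^esub> e \<in> M" using M e MR by (auto simp: left_sided_def)
    then have "e \<otimes>\<^bsub>E\<^esub> e \<ominus>\<^bsub>E\<^esub> e \<in> M" using left_sided_diff M e by blast
    moreover have "(e \<otimes>\<^bsub>E\<^esub> e \<ominus>\<^bsub>E\<^esub> e) \<otimes>\<^bsub>E\<^esub> y = \<zero>\<^bsub>E\<^esub>"
      using eE yE e by (simp add: a_minus_def E.l_distr E.l_minus E.m_assoc E.r_neg)
    ultimately show ?thesis by (simp add: N_def)
  qed
  then have "e \<otimes>\<^bsub>E\<^esub> e = e" using N0 eE by simp
  moreover have "e \<noteq> \<zero>\<^bsub>E\<^esub>"
  proof
    assume "e = \<zero>\<^bsub>E\<^esub>"
    then have "y = \<zero>\<^bsub>E\<^esub>" using e yE by simp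
    then show False using xy ME by simp
  qed
  ultimately show ?thesis using e M by blast
qed

text \<open>Take an idempotent e of I with smallest left annihilator K e in I. A nonzero K e would
  contain an idempotent by which e could be enlarged, so K e is zero and e is a right unit of I.
  Then I annihilates every v - e v, and \<open>ann_two_sided\<close> makes e the identity.\<close>

lemma two_sided_trivial:
  assumes I: "two_sided I" "I \<noteq> {\<zero>\<^bsub>E\<^esub>}" shows "I = R"
proof -
  have IR: "I \<subseteq> R" and I0: "\<zero>\<^bsub>E\<^esub> \<in> I" using I by (auto simp: two_sided_def)
  have IE: "x \<in> carrier E" if "x \<in> I" for x using that IR R_sub by blast
  have left: "left_sided I" using I two_sided_left by simp
  have add: "x \<oplus>\<^bsub>E\<^esub> y \<in> I" if "x \<in> I" "y \<in> I" for x y using I that by (simp add: two_sided_def)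
  have mul: "x \<otimes>\<^bsub>E\<^esub> y \<in> I" if "x \<in> I" "y \<in> I" for x y using I that IR by (auto simp: two_sided_def)
  define K where "K e = {x \<in> I. x \<otimes>\<^bsub>E\<^esub> e = \<zero>\<^bsub>E\<^esub>}" for e
  let ?P = "\<lambda>e. e \<in> I \<and> e \<otimes>\<^bsub>E\<^esub> e = e"
  have "?P \<zero>\<^bsub>E\<^esub>" using I0 by simp
  from ex_has_least_nat[of ?P, OF this, of "\<lambda>e. card (K e)"]
  obtain e where e: "e \<in> I" "e \<otimes>\<^bsub>E\<^esub> e = e" and least: "\<And>f. ?P f \<Longrightarrow> card (K e) \<le> card (K f)" by blast
  have eE: "e \<in> carrier E" using e IE by simp
  have "K e = {\<zero>\<^bsub>E\<^esub>}"
  proof (rule ccontr)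
    assume ne: "K e \<noteq> {\<zero>\<^bsub>E\<^esub>}"
    have "left_sided (K e)" unfolding left_sided_def
    proof (intro conjI ballI)
      fix z u assume "z \<in> K e" "u \<in> R"
      then show "u \<otimes>\<^bsub>E\<^esub> z \<in> K e" using I IE eE R_E by (simp add: K_def E.m_assoc two_sided_def)
    next
      fix z w assume "z \<in> K e" "w \<in> K e"
      then show "z \<oplus>\<^bsub>E\<^esub> w \<in> K e" using add IE eE by (simp add: K_def E.l_distr)
    qed (use IR I0 eE in \<open>auto simp: K_def\<close>)
    then obtain f where f: "f \<in> K e" "f \<otimes>\<^bsub>E\<^esub> f = f" "f \<noteq> \<zero>\<^bsub>E\<^esub>" using ex_idempotent[OF _ ne] by blast
    have fI: "f \<in> I" and fe: "f \<otimes>\<^bsub>E\<^esub> e = \<zero>\<^bsub>E\<^esub>" using f by (auto simp: K_def)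
    have fE: "f \<in> carrier E" using fI IE by simp
    \<comment> \<open>The element e + f - e f. From f e = 0 it follows that g is idempotent and g e
      = e, so K g is contained in K e; the element f of K e is lost, because f g = f.\<close>
    define g where "g = e \<oplus>\<^bsub>E\<^esub> (f \<ominus>\<^bsub>E\<^esub> e \<otimes>\<^bsub>E\<^esub> f)"
    have gI: "g \<in> I" unfolding g_def
      using add e fI mul left_sided_diff[OF left] by simp
    have gE: "g \<in> carrier E" using gI IE by simp
    have ef: "f \<otimes>\<^bsub>E\<^esub> (e \<otimes>\<^bsub>E\<^esub> f) = \<zero>\<^bsub>E\<^esub>" using fe eE fE by (simp add: E.m_assoc[symmetric])
    have fg: "f \<otimes>\<^bsub>E\<^esub> g = f"
      unfolding g_def a_minus_def using eE fE fe f(2) ef by (simp add: E.r_distr E.r_minus)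
    have eef: "e \<otimes>\<^bsub>E\<^esub> (e \<otimes>\<^bsub>E\<^esub> f) = e \<otimes>\<^bsub>E\<^esub> f" using e(2) eE fE by (simp add: E.m_assoc[symmetric])
    have eg: "e \<otimes>\<^bsub>E\<^esub> g = e"
      unfolding g_def a_minus_def using eE fE e(2) eef by (simp add: E.r_distr E.r_minus E.r_neg)
    have gg: "g \<otimes>\<^bsub>E\<^esub> g = g"
    proof -
      have "g \<otimes>\<^bsub>E\<^esub> g = e \<otimes>\<^bsub>E\<^esub> g \<oplus>\<^bsub>E\<^esub> (f \<otimes>\<^bsub>E\<^esub> g \<ominus>\<^bsub>E\<^esub> e \<otimes>\<^bsub>E\<^esub> (f \<otimes>\<^bsub>E\<^esub> g))"
        using eE fE gE by (subst (1) g_def) (simp add: a_minus_def E.l_distr E.l_minus E.m_assoc)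
      also have "\<dots> = g" by (simp only: fg eg) (simp only: g_def)
      finally show ?thesis .
    qed
    have ge: "g \<otimes>\<^bsub>E\<^esub> e = e"
      unfolding g_def a_minus_def using eE fE fe e(2) by (simp add: E.l_distr E.l_minus E.m_assoc)
    have "K g \<subset> K e"
    proof
      show "K g \<subseteq> K e"
      proof
        fix x assume x: "x \<in> K g"
        then have xE: "x \<in> carrier E" using IE by (simp add: K_def)
        have "x \<otimes>\<^bsub>E\<^esub> e = x \<otimes>\<^bsub>E\<^esub> g \<otimes>\<^bsub>E\<^esub> e" using xE gE eE ge by (simp add: E.m_assoc)
        then show "x \<in> K e" using x eE by (simp add: K_def)
      qed
      have "f \<notin> K g" using fg f(3) by (simp add: K_def)
      then show "K g \<noteq> K e" using f(1) by blast
    qed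
    moreover have "finite (K e)" using IR finite_R finite_subset[of "K e" R] by (auto simp: K_def)
    ultimately have "card (K g) < card (K e)" by (rule psubset_card_mono[rotated])
    then show False using least[of g] gI gg by simp
  qed
  then have right_unit: "x \<otimes>\<^bsub>E\<^esub> e = x" if x: "x \<in> I" for x
  proof -
    have "x \<ominus>\<^bsub>E\<^esub> x \<otimes>\<^bsub>E\<^esub> e \<in> I" using left_sided_diff[OF left] x mul e by simp
    moreover have "(x \<ominus>\<^bsub>E\<^esub> x \<otimes>\<^bsub>E\<^esub> e) \<otimes>\<^bsub>E\<^esub> e = \<zero>\<^bsub>E\<^esub>"
      using IE[OF x] eE e(2) by (simp add: a_minus_def E.l_distr E.l_minus E.m_assoc E.r_neg)
    ultimately have "x \<ominus>\<^bsub>E\<^esub> x \<otimes>\<^bsub>E\<^esub> e \<in> K e" by (simp add: K_def)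
    then show ?thesis using \<open>K e = {\<zero>\<^bsub>E\<^esub>}\<close> IE[OF x] eE by simp
  qed
  have "e = \<one>\<^bsub>E\<^esub>"
  proof (rule End_alg_eqI[of _ F V])
    fix v assume v: "v \<in> carrier V"
    have ev: "e v \<in> carrier V" using eE v by (rule End_algD(2))
    have "x (v \<ominus>\<^bsub>V\<^esub> e v) = \<zero>\<^bsub>V\<^esub>" if x: "x \<in> I" for x
    proof -
      have "x (e v) = x v" using right_unit[OF x] End_alg_apply(1)[OF v, of F x e] by simp
      then show ?thesis
        using IE[OF x] v ev by (simp add: a_minus_def End_algD(2,3) End_minus V.r_neg)
    qed
    then have "v \<ominus>\<^bsub>V\<^esub> e v \<in> ann I" using v ev by (simp add: ann_def)
    then have "v \<ominus>\<^bsub>V\<^esub> e v = \<zero>\<^bsub>V\<^esub>" using ann_two_sided[OF I] by simp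
    moreover have "v \<ominus>\<^bsub>V\<^esub> e v \<oplus>\<^bsub>V\<^esub> e v = v"
      using v ev by (simp add: a_minus_def V.a_assoc V.l_neg)
    ultimately show "e v = \<one>\<^bsub>E\<^esub> v" using v ev by (simp add: End_alg_apply)
  qed (use eE in auto)
  then have "\<one>\<^bsub>E\<^esub> \<in> I" using e by simp
  then have "u \<in> I" if "u \<in> R" for u
    using I(1) that R_E[OF that] by (auto simp: two_sided_def dest!: bspec[of I _ "\<one>\<^bsub>E\<^esub>"])
  then show ?thesis using IR by blast
qed

section \<open>The centre of R\<close>

abbreviation A where "A \<equiv> E\<lparr>carrier := R\<rparr>"

definition Z where "Z = group_center A"

lemma Z_iff: "z \<in> Z \<longleftrightarrow> z \<in> R \<and> (\<forall>x\<in>R. z \<otimes>\<^bsub>E\<^esub> x = x \<otimes>\<^bsub>E\<^esub> z)"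
  by (simp add: Z_def group_center_def)

lemma Z_E: "z \<in> Z \<Longrightarrow> z \<in> carrier E"
  using R_E by (simp add: Z_iff)

lemma ring_A: "ring A" by (rule E.subring_is_ring[OF subring_R])

lemma ideal_two_sided:
  assumes "ideal I A" shows "two_sided I"
proof -
  interpret I: ideal I A by (rule assms)
  show ?thesis
    using I.a_subset I.I_l_closed I.I_r_closed
      additive_subgroup.zero_closed[OF ideal.axioms(1)[OF assms]]
      additive_subgroup.a_closed[OF ideal.axioms(1)[OF assms]]
    by (auto simp: two_sided_def)
qed

lemma one_neq_zero: "\<one>\<^bsub>E\<^esub> \<noteq> \<zero>\<^bsub>E\<^esub>"
proof
  assume eq: "\<one>\<^bsub>E\<^esub> = \<zero>\<^bsub>E\<^esub>"
  have "x = \<zero>\<^bsub>V\<^esub>" if "x \<in> carrier V" for x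
    using End_alg_apply(3)[OF that, of F] End_alg_apply(4)[OF that, of F] eq by simp
  then show False using V_nontrivial by blast
qed

text \<open>For central z the multiples R z form a nonzero two-sided ideal, which is therefore all
  of R.\<close>

lemma center_inverse:
  assumes z: "z \<in> Z" "z \<noteq> \<zero>\<^bsub>E\<^esub>"
  shows "\<exists>w\<in>Z. w \<otimes>\<^bsub>E\<^esub> z = \<one>\<^bsub>E\<^esub>"
proof -
  have zR: "z \<in> R" and zE: "z \<in> carrier E" and zc: "\<And>x. x \<in> R \<Longrightarrow> z \<otimes>\<^bsub>E\<^esub> x = x \<otimes>\<^bsub>E\<^esub> z"
    using z(1) Z_E by (auto simp: Z_iff)
  define I where "I = (\<lambda>x. x \<otimes>\<^bsub>E\<^esub> z) ` R"
  have "two_sided I" unfolding two_sided_def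
  proof (intro conjI ballI)
    show "I \<subseteq> R" using zR R_mult by (auto simp: I_def)
    show "\<zero>\<^bsub>E\<^esub> \<in> I" unfolding I_def using zE R_zero by (intro image_eqI[of _ _ "\<zero>\<^bsub>E\<^esub>"]) simp_all
    fix a assume "a \<in> I"
    then obtain x where x: "x \<in> R" "a = x \<otimes>\<^bsub>E\<^esub> z" by (auto simp: I_def)
    show "a \<oplus>\<^bsub>E\<^esub> b \<in> I" if b: "b \<in> I" for b
    proof -
      obtain y where y: "y \<in> R" "b = y \<otimes>\<^bsub>E\<^esub> z" using b by (auto simp: I_def)
      show ?thesis unfolding I_def using x y R_add R_E zE
        by (intro image_eqI[of _ _ "x \<oplus>\<^bsub>E\<^esub> y"]) (simp_all add: E.l_distr)
    qed
    fix u assume u: "u \<in> R"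
    show "u \<otimes>\<^bsub>E\<^esub> a \<in> I" unfolding I_def using x u R_mult R_E zE
      by (intro image_eqI[of _ _ "u \<otimes>\<^bsub>E\<^esub> x"]) (simp_all add: E.m_assoc)
    show "a \<otimes>\<^bsub>E\<^esub> u \<in> I" unfolding I_def using x u R_mult R_E zE zc[OF u]
      by (intro image_eqI[of _ _ "x \<otimes>\<^bsub>E\<^esub> u"]) (simp_all add: E.m_assoc)
  qed
  moreover have "z \<in> I" unfolding I_def using R_one zE by (intro image_eqI[of _ _ "\<one>\<^bsub>E\<^esub>"]) simp_all
  then have "I \<noteq> {\<zero>\<^bsub>E\<^esub>}" using z(2) by blast
  ultimately have "I = R" by (rule two_sided_trivial)
  then obtain w where w: "w \<in> R" "w \<otimes>\<^bsub>E\<^esub> z = \<one>\<^bsub>E\<^esub>" using R_one by (force simp: I_def)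
  have wE: "w \<in> carrier E" using w R_E by simp
  have "w \<otimes>\<^bsub>E\<^esub> x = x \<otimes>\<^bsub>E\<^esub> w" if x: "x \<in> R" for x
  proof -
    have xE: "x \<in> carrier E" using x R_E by simp
    have zw: "z \<otimes>\<^bsub>E\<^esub> w = \<one>\<^bsub>E\<^esub>" using zc[OF w(1)] w(2) by simp
    have "w \<otimes>\<^bsub>E\<^esub> x = w \<otimes>\<^bsub>E\<^esub> (x \<otimes>\<^bsub>E\<^esub> z) \<otimes>\<^bsub>E\<^esub> w"
      using wE xE zE zw by (simp add: E.m_assoc)
    also have "\<dots> = w \<otimes>\<^bsub>E\<^esub> z \<otimes>\<^bsub>E\<^esub> x \<otimes>\<^bsub>E\<^esub> w"
      using wE xE zE by (simp add: zc[OF x, symmetric] E.m_assoc)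
    finally show ?thesis using w(2) xE wE by simp
  qed
  then show ?thesis using w by (auto simp: Z_iff)
qed

lemma subring_Z: "subring Z E"
proof (rule E.subringI)
  show "Z \<subseteq> carrier E" using Z_E by blast
  show "\<one>\<^bsub>E\<^esub> \<in> Z" using R_one R_E by (simp add: Z_iff)
  show "\<ominus>\<^bsub>E\<^esub> z \<in> Z" if "z \<in> Z" for z
    using that R_minus R_E by (simp add: Z_iff E.l_minus E.r_minus)
  show "z \<otimes>\<^bsub>E\<^esub> w \<in> Z" if z: "z \<in> Z" and w: "w \<in> Z" for z w
  proof -
    have "z \<otimes>\<^bsub>E\<^esub> w \<otimes>\<^bsub>E\<^esub> x = x \<otimes>\<^bsub>E\<^esub> (z \<otimes>\<^bsub>E\<^esub> w)" if x: "x \<in> R" for x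
    proof -
      have E: "z \<in> carrier E" "w \<in> carrier E" "x \<in> carrier E" using z w x Z_E R_E by auto
      have "z \<otimes>\<^bsub>E\<^esub> w \<otimes>\<^bsub>E\<^esub> x = z \<otimes>\<^bsub>E\<^esub> (w \<otimes>\<^bsub>E\<^esub> x)" by (rule E.m_assoc[OF E])
      also have "w \<otimes>\<^bsub>E\<^esub> x = x \<otimes>\<^bsub>E\<^esub> w" using w x unfolding Z_iff by blast
      also have "z \<otimes>\<^bsub>E\<^esub> (x \<otimes>\<^bsub>E\<^esub> w) = (z \<otimes>\<^bsub>E\<^esub> x) \<otimes>\<^bsub>E\<^esub> w" by (rule E.m_assoc[OF E(1,3,2), symmetric])
      also have "z \<otimes>\<^bsub>E\<^esub> x = x \<otimes>\<^bsub>E\<^esub> z" using z x unfolding Z_iff by blast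
      also have "(x \<otimes>\<^bsub>E\<^esub> z) \<otimes>\<^bsub>E\<^esub> w = x \<otimes>\<^bsub>E\<^esub> (z \<otimes>\<^bsub>E\<^esub> w)" by (rule E.m_assoc[OF E(3,1,2)])
      finally show ?thesis .
    qed
    moreover have "z \<otimes>\<^bsub>E\<^esub> w \<in> R" using z w R_mult unfolding Z_iff by blast
    ultimately show ?thesis unfolding Z_iff by blast
  qed
  show "z \<oplus>\<^bsub>E\<^esub> w \<in> Z" if "z \<in> Z" "w \<in> Z" for z w
    using that R_add R_E by (simp add: Z_iff E.l_distr E.r_distr)
qed

lemma subfield_Z: "subfield Z E"
proof (rule E.subfieldI)
  show "subcring Z E"
    by (rule E.subcringI[OF subring_Z]) (unfold Z_iff, blast)
  show "Units (E\<lparr>carrier := Z\<rparr>) = Z - {\<zero>\<^bsub>E\<^esub>}"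
  proof
    show "Units (E\<lparr>carrier := Z\<rparr>) \<subseteq> Z - {\<zero>\<^bsub>E\<^esub>}"
      using one_neq_zero Z_E by (auto simp: Units_def)
    show "Z - {\<zero>\<^bsub>E\<^esub>} \<subseteq> Units (E\<lparr>carrier := Z\<rparr>)"
    proof
      fix z assume z: "z \<in> Z - {\<zero>\<^bsub>E\<^esub>}"
      then obtain w where w: "w \<in> Z" "w \<otimes>\<^bsub>E\<^esub> z = \<one>\<^bsub>E\<^esub>" using center_inverse by blast
      moreover have "z \<otimes>\<^bsub>E\<^esub> w = w \<otimes>\<^bsub>E\<^esub> z" using z w(1) Z_iff[of z] Z_iff[of w] by blast
      then have "z \<otimes>\<^bsub>E\<^esub> w = \<one>\<^bsub>E\<^esub>" using w by simp
      ultimately show "z \<in> Units (E\<lparr>carrier := Z\<rparr>)" using z by (auto simp: Units_def)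
    qed
  qed
qed

lemma conj_Z: assumes B: "det B = 1" and z: "z \<in> Z" shows "conj B z \<in> Z"
proof -
  have zE: "z \<in> carrier E" using z Z_E by simp
  have "conj B z \<otimes>\<^bsub>E\<^esub> x = x \<otimes>\<^bsub>E\<^esub> conj B z" if x: "x \<in> R" for x
  proof -
    have y: "conj (adj B) x \<in> R" using B x conj_R by simp
    have xx: "x = conj B (conj (adj B) x)" using B x R_E by (simp add: conj_inverse)
    have "conj B (z \<otimes>\<^bsub>E\<^esub> conj (adj B) x) = conj B (conj (adj B) x \<otimes>\<^bsub>E\<^esub> z)"
      using z y by (simp add: Z_iff)
    then show ?thesis
      using B zE y R_E by (simp add: conj_mult xx[symmetric])
  qed
  then show ?thesis using z B conj_R by (simp add: Z_iff)
qed

text \<open>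
  An automorphism of a finite field is determined by the image of a generator of the
  multiplicative group, which is a power of the generator; hence the automorphisms commute.
\<close>
lemma conj_Z_commute:
  assumes B: "det B = 1" and C: "det C = 1" and z: "z \<in> Z"
  shows "conj B (conj C z) = conj C (conj B z)"
proof -
  let ?K = "E\<lparr>carrier := Z\<rparr>"
  interpret K: field ?K by (rule E.subfield_iff(2)[OF subfield_Z])
  have "finite (carrier ?K)" by (rule finite_subset[OF _ finite_R]) (simp add: Z_iff subset_iff)
  from K.finite_field_mult_group_has_gen[OF this] obtain g where
    g: "g \<in> carrier (mult_of ?K)" "carrier (mult_of ?K) = {g [^]\<^bsub>?K\<^esub> i | i::nat. i \<in> UNIV}" by (rule bexE)
  have gZ: "g \<in> Z" "g \<noteq> \<zero>\<^bsub>E\<^esub>" using g by simp_all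
  have pow: "g [^]\<^bsub>?K\<^esub> i = g [^]\<^bsub>E\<^esub> i" for i :: nat
    by (simp add: nat_pow_def)
  have conj_pow: "conj D (w [^]\<^bsub>E\<^esub> i) = conj D w [^]\<^bsub>E\<^esub> i" if "det D = 1" "w \<in> carrier E" for D w and i :: nat
  proof (induction i)
    case 0
    then show ?case using that by (simp add: conj_def \<sigma>_closed \<sigma>_inverse)
  next
    case (Suc i)
    then show ?case using that by (simp add: conj_mult)
  qed
  have gen: "\<exists>i::nat. w = g [^]\<^bsub>E\<^esub> i" if w: "w \<in> Z" "w \<noteq> \<zero>\<^bsub>E\<^esub>" for w
  proof -
    have "w \<in> carrier (mult_of ?K)" using w by simp
    then show ?thesis unfolding g(2) pow by blast
  qed
  have nz: "conj D g \<noteq> \<zero>\<^bsub>E\<^esub>" if D: "det D = 1" for D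
  proof
    assume "conj D g = \<zero>\<^bsub>E\<^esub>"
    then have "conj (adj D) (conj D g) = \<zero>\<^bsub>E\<^esub>" using D by (simp add: conj_zero)
    then show False using D gZ Z_E by (simp add: conj_inverse)
  qed
  obtain i :: nat where i: "conj B g = g [^]\<^bsub>E\<^esub> i" using gen[OF conj_Z[OF B gZ(1)] nz[OF B]] by blast
  obtain j :: nat where j: "conj C g = g [^]\<^bsub>E\<^esub> j" using gen[OF conj_Z[OF C gZ(1)] nz[OF C]] by blast
  have gE: "g \<in> carrier E" using gZ Z_E by simp
  have comm: "conj B (conj C g) = conj C (conj B g)"
    using B C gE by (simp add: i j conj_pow E.nat_pow_pow mult.commute)
  show ?thesis
  proof (cases "z = \<zero>\<^bsub>E\<^esub>")
    case True then show ?thesis using B C by (simp add: conj_zero)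
  next
    case False
    then obtain m :: nat where m: "z = g [^]\<^bsub>E\<^esub> m" using gen[OF z] by blast
    show ?thesis
      unfolding m using B C gE by (simp add: conj_pow conj_E comm)
  qed
qed

lemma conj_Z_trivial:
  assumes B: "det B = 1" and z: "z \<in> Z" shows "conj B z = z"
proof -
  \<comment> \<open>The relation B C = D C B says that D is the commutator of B and C, so D acts
    trivially where conjugations commute.\<close>
  have commutator: "conj D w = w"
    if D: "det D = 1" "det B = 1" "det C = 1" "B ** C = D ** (C ** B)" and w: "w \<in> Z" for B C D w
  proof -
    define y where "y = conj (adj (C ** B)) w"
    have yZ: "y \<in> Z" using D w by (simp add: y_def conj_Z)
    have wy: "w = conj (C ** B) y" using D w Z_E by (simp add: y_def conj_inverse)
    have "conj D w = conj (D ** (C ** B)) y"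
      unfolding wy by (rule conj_comp[symmetric]) (use D yZ Z_E in simp_all)
    also have "\<dots> = conj (B ** C) y" by (simp only: D(4))
    also have "\<dots> = conj B (conj C y)" by (rule conj_comp) (use D yZ Z_E in simp_all)
    also have "\<dots> = conj C (conj B y)" by (rule conj_Z_commute) (use D yZ in simp_all)
    also have "\<dots> = conj (C ** B) y"
      by (rule conj_comp[symmetric]) (use D yZ Z_E in simp_all)
    finally show ?thesis using wy by simp
  qed
  have "\<not> (UNIV :: 'k set) \<subseteq> {0, 1, -1}"
  proof
    assume "(UNIV :: 'k set) \<subseteq> {0, 1, -1}"
    then have "CARD('k) \<le> card {0, 1, -1 :: 'k}" by (intro card_mono) auto
    also have "\<dots> \<le> 3" by (simp add: card_insert_if)
    finally show False using big by simp
  qed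
  then obtain t :: 'k where t: "t \<noteq> 0" "t \<noteq> 1" "t \<noteq> -1" by blast
  have t2: "t^2 - 1 \<noteq> 0"
  proof
    assume "t^2 - 1 = 0"
    then have "t^2 = 1^2" by simp
    then show False using t unfolding power2_eq_iff by simp
  qed
  show ?thesis
  proof (rule SL2_generated_lower[of "\<lambda>B. conj B z = z", OF _ _ _ B])
    show "conj (B ** C) z = z" if "det B = 1" "det C = 1" "conj B z = z" "conj C z = z" for B C
      using that z Z_E by (simp add: conj_comp)
    \<comment> \<open>The commutator of \<open>torus t\<close> and \<open>upper x\<close> is
      \<open>upper ((t^2 - 1) * x)\<close>; this is where t^2 \<noteq> 1 enters.\<close>
    show "conj (upper a) z = z" for a
      by (rule commutator[of "upper a" "torus t" "upper (a / (t^2 - 1))"])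
        (use t t2 z in \<open>simp_all add: SL2_defs det_mat2 mat2_mult mat2_eq_iff field_simps power2_eq_square\<close>)
    show "conj (lower a) z = z" for a
      by (rule commutator[of "lower a" "torus (1/t)" "lower (a / (t^2 - 1))"])
        (use t t2 z in \<open>simp_all add: SL2_defs det_mat2 mat2_mult mat2_eq_iff field_simps power2_eq_square\<close>)
  qed
qed

lemma center_scalar: "Z = {c \<odot>\<^bsub>E\<^esub> \<one>\<^bsub>E\<^esub> |c. c \<in> carrier F}"
proof
  show "Z \<subseteq> {c \<odot>\<^bsub>E\<^esub> \<one>\<^bsub>E\<^esub> |c. c \<in> carrier F}"
  proof
    fix z assume z: "z \<in> Z"
    have zE: "z \<in> carrier E" using z Z_E by simp
    have "\<exists>c\<in>carrier F. z = c \<odot>\<^bsub>E\<^esub> \<one>\<^bsub>E\<^esub>"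
    proof (rule scalar[OF zE])
      fix B :: "'k^2^2" assume B: "det B = 1"
      have "z \<otimes>\<^bsub>E\<^esub> \<sigma> B = conj B z \<otimes>\<^bsub>E\<^esub> \<sigma> B" using conj_Z_trivial[OF B z] by simp
      also have "\<dots> = \<sigma> B \<otimes>\<^bsub>E\<^esub> z"
        using B zE by (simp add: conj_def E.m_assoc \<sigma>_closed \<sigma>_inverse)
      finally show "\<sigma> B \<otimes>\<^bsub>E\<^esub> z = z \<otimes>\<^bsub>E\<^esub> \<sigma> B" by simp
    qed
    then show "z \<in> {c \<odot>\<^bsub>E\<^esub> \<one>\<^bsub>E\<^esub> |c. c \<in> carrier F}" by blast
  qed
  show "{c \<odot>\<^bsub>E\<^esub> \<one>\<^bsub>E\<^esub> |c. c \<in> carrier F} \<subseteq> Z"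
    using R_E by (auto simp: Z_iff R_smult R_one smult_mult)
qed

theorem central_simple: "central_simple_algebra F A"
proof -
  interpret A: ring A by (rule ring_A)
  have "submodule R F E"
    by (rule module.submoduleI[OF module_End]) (use R_sub R_zero R_minus R_add R_smult in auto)
  then have modA: "Module.module F A"
    by (rule submodule.submodule_is_module[OF _ module_End])
  have "assoc_algebra F A"
    using ring_A modA smult_mult R_E by (auto simp: assoc_algebra_def)
  \<comment> \<open>R is finite and spans itself, with an indicator function as
    coefficients.\<close>
  moreover have "finitely_spanned F A" unfolding finitely_spanned_def
  proof (intro exI[of _ R] conjI ballI)
    fix x assume x: "x \<in> carrier A"
    define c where "c s = (if s = x then \<one>\<^bsub>F\<^esub> else \<zero>\<^bsub>F\<^esub>)" for s
    interpret M: module F A by (rule modA)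
    have "(\<Oplus>\<^bsub>A\<^esub>s\<in>R. c s \<odot>\<^bsub>A\<^esub> s) = (\<Oplus>\<^bsub>A\<^esub>s\<in>R. if x = s then s else \<zero>\<^bsub>A\<^esub>)"
      by (rule A.finsum_cong')
        (use M.smult_one M.smult_l_null R_zero in \<open>auto simp: c_def\<close>)
    also have "\<dots> = x"
      by (rule A.add.finprod_singleton) (use x finite_R in auto)
    finally show "\<exists>c\<in>R \<rightarrow> carrier F. x = (\<Oplus>\<^bsub>A\<^esub>s\<in>R. c s \<odot>\<^bsub>A\<^esub> s)"
      by (intro bexI[of _ c]) (auto simp: c_def)
  qed (use finite_R in auto)
  moreover have "carrier A \<noteq> {\<zero>\<^bsub>A\<^esub>}" using one_neq_zero R_one by auto
  moreover have "I = {\<zero>\<^bsub>A\<^esub>} \<or> I = carrier A" if "ideal I A" for I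
    using two_sided_trivial[OF ideal_two_sided[OF that]] by auto
  moreover have "group_center A = {c \<odot>\<^bsub>A\<^esub> \<one>\<^bsub>A\<^esub> |c. c \<in> carrier F}"
    using center_scalar by (simp add: Z_def)
  ultimately show ?thesis using F.field_axioms by (auto simp: central_simple_algebra_def)
qed

end

section \<open>Linear functionals\<close>

context vector_space_over begin

definition subspace :: "'v set \<Rightarrow> bool" where
  "subspace W \<longleftrightarrow> W \<subseteq> carrier V \<and> \<zero>\<^bsub>V\<^esub> \<in> W \<and> (\<forall>x\<in>W. \<forall>y\<in>W. x \<oplus>\<^bsub>V\<^esub> y \<in> W) \<and>
     (\<forall>c\<in>carrier F. \<forall>x\<in>W. c \<odot>\<^bsub>V\<^esub> x \<in> W)"

lemma subspace_minus: assumes "subspace W" "x \<in> W" shows "\<ominus>\<^bsub>V\<^esub> x \<in> W"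
proof -
  have "x \<in> carrier V" using assms by (auto simp: subspace_def)
  then have "\<ominus>\<^bsub>V\<^esub> x = (\<ominus>\<^bsub>F\<^esub> \<one>\<^bsub>F\<^esub>) \<odot>\<^bsub>V\<^esub> x" by (simp add: V.smult_l_minus)
  moreover have "(\<ominus>\<^bsub>F\<^esub> \<one>\<^bsub>F\<^esub>) \<odot>\<^bsub>V\<^esub> x \<in> W"
    using assms F.add.inv_closed[OF F.one_closed] unfolding subspace_def a_inv_def by blast
  ultimately show ?thesis by simp
qed

lemma minus_zero: "\<ominus>\<^bsub>V\<^esub> \<zero>\<^bsub>V\<^esub> = \<zero>\<^bsub>V\<^esub>"
  by (rule V.minus_equality) simp_all

lemma subspace_diff: "subspace W \<Longrightarrow> x \<in> W \<Longrightarrow> y \<in> W \<Longrightarrow> x \<ominus>\<^bsub>V\<^esub> y \<in> W"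
  using subspace_minus by (simp add: a_minus_def subspace_def)

lemma subspace_line: "v \<in> carrier V \<Longrightarrow> subspace {c \<odot>\<^bsub>V\<^esub> v |c. c \<in> carrier F}"
  unfolding subspace_def
proof (intro conjI ballI)
  assume v: "v \<in> carrier V"
  show "\<zero>\<^bsub>V\<^esub> \<in> {c \<odot>\<^bsub>V\<^esub> v |c. c \<in> carrier F}"
    using v by (intro CollectI exI[of _ "\<zero>\<^bsub>F\<^esub>"]) (simp add: V.smult_l_null)
  fix x y assume "x \<in> {c \<odot>\<^bsub>V\<^esub> v |c. c \<in> carrier F}" "y \<in> {c \<odot>\<^bsub>V\<^esub> v |c. c \<in> carrier F}"
  then obtain c d where "c \<in> carrier F" "x = c \<odot>\<^bsub>V\<^esub> v" "d \<in> carrier F" "y = d \<odot>\<^bsub>V\<^esub> v" by blast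
  then show "x \<oplus>\<^bsub>V\<^esub> y \<in> {c \<odot>\<^bsub>V\<^esub> v |c. c \<in> carrier F}"
    using v by (intro CollectI exI[of _ "c \<oplus>\<^bsub>F\<^esub> d"]) (simp add: V.smult_l_distr)
next
  assume v: "v \<in> carrier V"
  fix d x assume d: "d \<in> carrier F" and "x \<in> {c \<odot>\<^bsub>V\<^esub> v |c. c \<in> carrier F}"
  then obtain c where "c \<in> carrier F" "x = c \<odot>\<^bsub>V\<^esub> v" by blast
  then show "d \<odot>\<^bsub>V\<^esub> x \<in> {c \<odot>\<^bsub>V\<^esub> v |c. c \<in> carrier F}"
    using v d by (intro CollectI exI[of _ "d \<otimes>\<^bsub>F\<^esub> c"]) (simp add: V.smult_assoc1)
qed auto

definition functional :: "('v \<Rightarrow> 'c) \<Rightarrow> bool" where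
  "functional \<phi> \<longleftrightarrow> (\<forall>x\<in>carrier V. \<phi> x \<in> carrier F) \<and>
     (\<forall>x\<in>carrier V. \<forall>y\<in>carrier V. \<phi> (x \<oplus>\<^bsub>V\<^esub> y) = \<phi> x \<oplus>\<^bsub>F\<^esub> \<phi> y) \<and>
     (\<forall>c\<in>carrier F. \<forall>x\<in>carrier V. \<phi> (c \<odot>\<^bsub>V\<^esub> x) = c \<otimes>\<^bsub>F\<^esub> \<phi> x)"

text \<open>A subspace that is maximal among those avoiding \<open>v\<close> is a hyperplane.\<close>
lemma functional_separation:
  assumes finV: "finite (carrier V)" and W: "subspace W" and v: "v \<in> carrier V" "v \<notin> W"
  shows "\<exists>\<phi>. functional \<phi> \<and> (\<forall>w\<in>W. \<phi> w = \<zero>\<^bsub>F\<^esub>) \<and> \<phi> v = \<one>\<^bsub>F\<^esub>"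
proof -
  let ?P = "\<lambda>U. subspace U \<and> W \<subseteq> U \<and> v \<notin> U"
  have bound: "\<forall>U. ?P U \<longrightarrow> card U < Suc (card (carrier V))"
    using finV by (auto simp: subspace_def less_Suc_eq_le intro: card_mono)
  have start: "?P W" using W v by simp
  from ex_has_greatest_nat[of ?P, OF start bound]
  obtain U where U: "subspace U" "W \<subseteq> U" "v \<notin> U" and max: "\<And>U'. ?P U' \<Longrightarrow> card U' \<le> card U" by blast
  have UV: "x \<in> carrier V" if "x \<in> U" for x using that U by (auto simp: subspace_def)
  have finU: "finite U" using U(1) finV finite_subset by (auto simp: subspace_def)
  have ex: "\<exists>c\<in>carrier F. x \<ominus>\<^bsub>V\<^esub> c \<odot>\<^bsub>V\<^esub> v \<in> U" if x: "x \<in> carrier V" for x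
  proof (cases "x \<in> U")
    case True
    then show ?thesis using v x by (intro bexI[of _ "\<zero>\<^bsub>F\<^esub>"]) (simp_all add: V.smult_l_null a_minus_def minus_zero)
  next
    case False
    \<comment> \<open>By maximality of U the subspace generated by U and x contains v; solving for x
      gives its coefficient.\<close>
    define U' where "U' = {w \<oplus>\<^bsub>V\<^esub> c \<odot>\<^bsub>V\<^esub> x |w c. w \<in> U \<and> c \<in> carrier F}"
    have "subspace U'" unfolding subspace_def
    proof (intro conjI ballI)
      show "U' \<subseteq> carrier V" using UV x by (auto simp: U'_def)
      show "\<zero>\<^bsub>V\<^esub> \<in> U'" unfolding U'_def using U(1) x
        by (intro CollectI exI[of _ "\<zero>\<^bsub>V\<^esub>"] exI[of _ "\<zero>\<^bsub>F\<^esub>"]) (simp add: V.smult_l_null subspace_def)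
      fix y z assume "y \<in> U'" "z \<in> U'"
      then obtain w c w' c' where *: "w \<in> U" "c \<in> carrier F" "y = w \<oplus>\<^bsub>V\<^esub> c \<odot>\<^bsub>V\<^esub> x"
        "w' \<in> U" "c' \<in> carrier F" "z = w' \<oplus>\<^bsub>V\<^esub> c' \<odot>\<^bsub>V\<^esub> x" by (auto simp: U'_def)
      then show "y \<oplus>\<^bsub>V\<^esub> z \<in> U'" unfolding U'_def using U(1) UV x
        by (intro CollectI exI[of _ "w \<oplus>\<^bsub>V\<^esub> w'"] exI[of _ "c \<oplus>\<^bsub>F\<^esub> c'"])
          (simp add: subspace_def V.smult_l_distr V.a_ac)
    next
      fix d y assume "d \<in> carrier F" "y \<in> U'"
      then obtain w c where *: "d \<in> carrier F" "w \<in> U" "c \<in> carrier F" "y = w \<oplus>\<^bsub>V\<^esub> c \<odot>\<^bsub>V\<^esub> x"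
        by (auto simp: U'_def)
      then show "d \<odot>\<^bsub>V\<^esub> y \<in> U'" unfolding U'_def using U(1) UV x
        by (intro CollectI exI[of _ "d \<odot>\<^bsub>V\<^esub> w"] exI[of _ "d \<otimes>\<^bsub>F\<^esub> c"])
          (simp add: subspace_def V.smult_r_distr V.smult_assoc1)
    qed
    have UU': "U \<subseteq> U'"
    proof
      fix w assume "w \<in> U"
      then show "w \<in> U'" unfolding U'_def using UV x
        by (intro CollectI exI[of _ w] exI[of _ "\<zero>\<^bsub>F\<^esub>"]) (simp add: V.smult_l_null)
    qed
    have "x \<in> U'" unfolding U'_def using U(1) x
      by (intro CollectI exI[of _ "\<zero>\<^bsub>V\<^esub>"] exI[of _ "\<one>\<^bsub>F\<^esub>"]) (simp add: subspace_def)
    then have "U \<subset> U'" using UU' False by blast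
    moreover have "finite U'" using \<open>subspace U'\<close> finV finite_subset by (auto simp: subspace_def)
    ultimately have "card U < card U'" by (rule psubset_card_mono[rotated])
    then have "v \<in> U'" using max[of U'] \<open>subspace U'\<close> UU' U(2) by fastforce
    then obtain w c where wc: "w \<in> U" "c \<in> carrier F" "v = w \<oplus>\<^bsub>V\<^esub> c \<odot>\<^bsub>V\<^esub> x" by (auto simp: U'_def)
    have "c \<noteq> \<zero>\<^bsub>F\<^esub>"
    proof
      assume "c = \<zero>\<^bsub>F\<^esub>"
      then have "v = w" using wc UV x by (simp add: V.smult_l_null)
      then show False using wc U(3) by simp
    qed
    then have c: "c \<in> Units F" using wc by (simp add: F.field_Units)
    have ic: "inv\<^bsub>F\<^esub> c \<in> carrier F" using c by simp
    have wV: "w \<in> carrier V" using wc UV by simp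
    have "inv\<^bsub>F\<^esub> c \<odot>\<^bsub>V\<^esub> v = inv\<^bsub>F\<^esub> c \<odot>\<^bsub>V\<^esub> w \<oplus>\<^bsub>V\<^esub> x"
      using c ic wc x wV by (simp add: V.smult_r_distr V.smult_assoc1[symmetric])
    then have "x \<ominus>\<^bsub>V\<^esub> inv\<^bsub>F\<^esub> c \<odot>\<^bsub>V\<^esub> v = \<ominus>\<^bsub>V\<^esub> (inv\<^bsub>F\<^esub> c \<odot>\<^bsub>V\<^esub> w)"
      using ic wV x by (simp add: a_minus_def V.minus_add V.a_ac V.r_neg1 V.r_neg2)
    moreover have "\<ominus>\<^bsub>V\<^esub> (inv\<^bsub>F\<^esub> c \<odot>\<^bsub>V\<^esub> w) \<in> U"
      using subspace_minus[OF U(1)] U(1) ic wc by (simp add: subspace_def)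
    ultimately show ?thesis using ic by (intro bexI[of _ "inv\<^bsub>F\<^esub> c"]) simp_all
  qed
  have uniq: "c = d" if x: "x \<in> carrier V" and c: "c \<in> carrier F" "x \<ominus>\<^bsub>V\<^esub> c \<odot>\<^bsub>V\<^esub> v \<in> U"
    and d: "d \<in> carrier F" "x \<ominus>\<^bsub>V\<^esub> d \<odot>\<^bsub>V\<^esub> v \<in> U" for x c d
  proof (rule ccontr)
    assume ne: "c \<noteq> d"
    then have unit: "d \<ominus>\<^bsub>F\<^esub> c \<in> Units F" using c d by (simp add: F.field_Units)
    have "(x \<ominus>\<^bsub>V\<^esub> c \<odot>\<^bsub>V\<^esub> v) \<ominus>\<^bsub>V\<^esub> (x \<ominus>\<^bsub>V\<^esub> d \<odot>\<^bsub>V\<^esub> v) \<in> U"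
      by (rule subspace_diff[OF U(1) c(2) d(2)])
    moreover have "(x \<ominus>\<^bsub>V\<^esub> c \<odot>\<^bsub>V\<^esub> v) \<ominus>\<^bsub>V\<^esub> (x \<ominus>\<^bsub>V\<^esub> d \<odot>\<^bsub>V\<^esub> v) = (d \<ominus>\<^bsub>F\<^esub> c) \<odot>\<^bsub>V\<^esub> v"
    proof -
      have "(x \<ominus>\<^bsub>V\<^esub> c \<odot>\<^bsub>V\<^esub> v) \<ominus>\<^bsub>V\<^esub> (x \<ominus>\<^bsub>V\<^esub> d \<odot>\<^bsub>V\<^esub> v)
          = (x \<oplus>\<^bsub>V\<^esub> \<ominus>\<^bsub>V\<^esub> x) \<oplus>\<^bsub>V\<^esub> (d \<odot>\<^bsub>V\<^esub> v \<oplus>\<^bsub>V\<^esub> \<ominus>\<^bsub>V\<^esub> (c \<odot>\<^bsub>V\<^esub> v))"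
        using x v c d by (simp add: a_minus_def V.minus_add V.a_ac)
      then show ?thesis using x v c d by (simp add: V.r_neg a_minus_def V.smult_l_distr V.smult_l_minus)
    qed
    ultimately have "(d \<ominus>\<^bsub>F\<^esub> c) \<odot>\<^bsub>V\<^esub> v \<in> U" by simp
    then have "inv\<^bsub>F\<^esub> (d \<ominus>\<^bsub>F\<^esub> c) \<odot>\<^bsub>V\<^esub> ((d \<ominus>\<^bsub>F\<^esub> c) \<odot>\<^bsub>V\<^esub> v) \<in> U"
      using U(1) unit by (simp add: subspace_def)
    moreover have "inv\<^bsub>F\<^esub> (d \<ominus>\<^bsub>F\<^esub> c) \<odot>\<^bsub>V\<^esub> ((d \<ominus>\<^bsub>F\<^esub> c) \<odot>\<^bsub>V\<^esub> v) = v"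
      using unit v c d by (simp add: V.smult_assoc1[symmetric])
    ultimately show False using U(3) by simp
  qed
  define \<phi> where "\<phi> x = (SOME c. c \<in> carrier F \<and> x \<ominus>\<^bsub>V\<^esub> c \<odot>\<^bsub>V\<^esub> v \<in> U)" for x
  have \<phi>: "\<phi> x \<in> carrier F" "x \<ominus>\<^bsub>V\<^esub> \<phi> x \<odot>\<^bsub>V\<^esub> v \<in> U" if "x \<in> carrier V" for x
    using someI_ex[of "\<lambda>c. c \<in> carrier F \<and> x \<ominus>\<^bsub>V\<^esub> c \<odot>\<^bsub>V\<^esub> v \<in> U"] ex[OF that] unfolding \<phi>_def by blast+
  have \<phi>I: "\<phi> x = c" if "x \<in> carrier V" "c \<in> carrier F" "x \<ominus>\<^bsub>V\<^esub> c \<odot>\<^bsub>V\<^esub> v \<in> U" for x c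
    using uniq \<phi> that by blast
  have "functional \<phi>" unfolding functional_def
  proof (intro conjI ballI)
    fix x y assume x: "x \<in> carrier V" and y: "y \<in> carrier V"
    have "(x \<ominus>\<^bsub>V\<^esub> \<phi> x \<odot>\<^bsub>V\<^esub> v) \<oplus>\<^bsub>V\<^esub> (y \<ominus>\<^bsub>V\<^esub> \<phi> y \<odot>\<^bsub>V\<^esub> v) \<in> U"
      using U(1) \<phi>(2)[OF x] \<phi>(2)[OF y] by (simp add: subspace_def)
    moreover have "(x \<ominus>\<^bsub>V\<^esub> \<phi> x \<odot>\<^bsub>V\<^esub> v) \<oplus>\<^bsub>V\<^esub> (y \<ominus>\<^bsub>V\<^esub> \<phi> y \<odot>\<^bsub>V\<^esub> v) = (x \<oplus>\<^bsub>V\<^esub> y) \<ominus>\<^bsub>V\<^esub> (\<phi> x \<oplus>\<^bsub>F\<^esub> \<phi> y) \<odot>\<^bsub>V\<^esub> v"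
      using x y v(1) \<phi>(1)[OF x] \<phi>(1)[OF y] by (simp add: a_minus_def V.smult_l_distr V.minus_add V.a_ac)
    ultimately show "\<phi> (x \<oplus>\<^bsub>V\<^esub> y) = \<phi> x \<oplus>\<^bsub>F\<^esub> \<phi> y" using x y \<phi>(1) by (intro \<phi>I) simp_all
  next
    fix c x assume c: "c \<in> carrier F" and x: "x \<in> carrier V"
    have "c \<odot>\<^bsub>V\<^esub> (x \<ominus>\<^bsub>V\<^esub> \<phi> x \<odot>\<^bsub>V\<^esub> v) \<in> U" using U(1) \<phi>(2)[OF x] c by (simp add: subspace_def)
    moreover have "c \<odot>\<^bsub>V\<^esub> (x \<ominus>\<^bsub>V\<^esub> \<phi> x \<odot>\<^bsub>V\<^esub> v) = c \<odot>\<^bsub>V\<^esub> x \<ominus>\<^bsub>V\<^esub> (c \<otimes>\<^bsub>F\<^esub> \<phi> x) \<odot>\<^bsub>V\<^esub> v"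
      using x c v(1) \<phi>(1)[OF x] by (simp add: a_minus_def V.smult_r_distr V.smult_r_minus V.smult_assoc1)
    ultimately show "\<phi> (c \<odot>\<^bsub>V\<^esub> x) = c \<otimes>\<^bsub>F\<^esub> \<phi> x" using x c \<phi>(1) by (intro \<phi>I) simp_all
  qed (use \<phi> in simp)
  moreover have "\<phi> w = \<zero>\<^bsub>F\<^esub>" if "w \<in> W" for w
    using that U(2) UV v(1) by (intro \<phi>I) (auto simp: V.smult_l_null a_minus_def minus_zero)
  moreover have "\<phi> v = \<one>\<^bsub>F\<^esub>"
    using v(1) U(1) by (intro \<phi>I) (simp_all add: a_minus_def V.r_neg subspace_def)
  ultimately show ?thesis by blast
qed

end

section \<open>The heart\<close>

lemma adj_adj: "adj (adj A) = A"
  by (cases A rule: mat2_cases) (simp add: adj_mat2)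

text \<open>
  Vectors of the heart are presented by integer valued functions with sum divisible by \<open>p\<close>,
  modulo the functions that are constant modulo \<open>p\<close>; this covers both cases of the definition
  of the heart, since a constant with vanishing sum is zero if \<open>p\<close> does not divide \<open>card B\<close>.
\<close>
locale heart_presentation =
  B: SL2_projective_action act B pinf pt + vector_space_over "residue_ring (int p)" V
  for act :: "'k::{field,finite}^2^2 \<Rightarrow> 'b \<Rightarrow> 'b" and B :: "'b set" and pinf pt
    and p :: nat and V :: "(int, 'v, 'n) module_scheme" +
  fixes cls :: "('b \<Rightarrow> int) \<Rightarrow> 'v" and \<sigma> :: "'k^2^2 \<Rightarrow> 'v \<Rightarrow> 'v" and l r :: nat
  assumes prime_p: "prime p" and odd_p: "odd p"
    and prime_l: "prime l" and card_k: "CARD('k) = l ^ r" and big: "CARD('k) > 11"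
    and cls_closed: "int p dvd sum f B \<Longrightarrow> cls f \<in> carrier V"
    and cls_surj: "v \<in> carrier V \<Longrightarrow> \<exists>f. int p dvd sum f B \<and> v = cls f"
    and cls_add: "int p dvd sum f B \<Longrightarrow> int p dvd sum g B \<Longrightarrow> cls (\<lambda>b. f b + g b) = cls f \<oplus>\<^bsub>V\<^esub> cls g"
    and cls_smult: "int p dvd sum f B \<Longrightarrow> c \<in> {0..int p - 1} \<Longrightarrow> cls (\<lambda>b. c * f b) = c \<odot>\<^bsub>V\<^esub> cls f"
    and cls_zero: "int p dvd sum f B \<Longrightarrow> cls f = \<zero>\<^bsub>V\<^esub> \<longleftrightarrow> (\<forall>b\<in>B. \<forall>b'\<in>B. int p dvd f b - f b')"
    and \<sigma>_closed: "det A = 1 \<Longrightarrow> \<sigma> A \<in> carrier (End_alg (residue_ring (int p)) V)"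
    and \<sigma>_cls: "det A = 1 \<Longrightarrow> int p dvd sum f B \<Longrightarrow> \<sigma> A (cls f) = cls (\<lambda>b. f (act (adj A) b))"
begin

section \<open>Functionals on the heart and absolute simplicity\<close>

abbreviation F where "F \<equiv> residue_ring (int p)"

lemma F_simps: "carrier F = {0..int p - 1}" "x \<oplus>\<^bsub>F\<^esub> y = (x + y) mod int p"
    "x \<otimes>\<^bsub>F\<^esub> y = (x * y) mod int p" "\<zero>\<^bsub>F\<^esub> = 0" "\<one>\<^bsub>F\<^esub> = 1"
  by (simp_all add: residue_ring_def)

lemma p_gt: "int p > 2"
proof -
  have "p \<ge> 2" "p \<noteq> 2" using prime_p odd_p prime_ge_2_nat by auto
  then show ?thesis by simp
qed

lemma mod_F: "c mod int p \<in> carrier F"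
  using p_gt pos_mod_bound[of "int p" c] by (simp add: F_simps)

lemma dvd_sum_diff: "int p dvd sum f B \<Longrightarrow> int p dvd sum g B \<Longrightarrow> int p dvd (\<Sum>b\<in>B. f b - g b)"
  by (simp add: sum_subtractf)

lemma dvd_sum_add: "int p dvd sum f B \<Longrightarrow> int p dvd sum g B \<Longrightarrow> int p dvd (\<Sum>b\<in>B. f b + g b)"
  by (simp add: sum.distrib)

lemma dvd_sum_mult: "int p dvd sum f B \<Longrightarrow> int p dvd (\<Sum>b\<in>B. c * f b)"
  by (simp flip: sum_distrib_left)

lemma dvd_sum_act: "det A = 1 \<Longrightarrow> int p dvd sum f B \<Longrightarrow> int p dvd (\<Sum>b\<in>B. f (act A b))"
  using B.sum_act[of A f] by simp

lemma cls_eqI: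
  assumes f: "int p dvd sum f B" and g: "int p dvd sum g B"
    and eq: "\<And>b b'. b \<in> B \<Longrightarrow> b' \<in> B \<Longrightarrow> int p dvd (f b - g b) - (f b' - g b')"
  shows "cls f = cls g"
proof -
  have "cls (\<lambda>b. f b - g b) = \<zero>\<^bsub>V\<^esub>"
    using eq by (subst cls_zero[OF dvd_sum_diff[OF f g]]) blast
  moreover have "cls (\<lambda>b. (f b - g b) + g b) = cls (\<lambda>b. f b - g b) \<oplus>\<^bsub>V\<^esub> cls g"
    by (rule cls_add[OF dvd_sum_diff[OF f g] g])
  ultimately show ?thesis using cls_closed[OF g] by simp
qed

lemma cls_cong:
  assumes f: "int p dvd sum f B" and g: "int p dvd sum g B"
    and eq: "\<And>b. b \<in> B \<Longrightarrow> int p dvd f b - g b"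
  shows "cls f = cls g"
  by (rule cls_eqI[OF f g]) (use eq in \<open>auto intro: dvd_diff\<close>)

lemma cls_mult: assumes f: "int p dvd sum f B" shows "cls (\<lambda>b. c * f b) = (c mod int p) \<odot>\<^bsub>V\<^esub> cls f"
proof -
  have "cls (\<lambda>b. c * f b) = cls (\<lambda>b. (c mod int p) * f b)"
  proof (rule cls_cong[OF dvd_sum_mult[OF f] dvd_sum_mult[OF f]])
    fix b
    have "c * f b - (c mod int p) * f b = (c - c mod int p) * f b" by (simp add: left_diff_distrib)
    then show "int p dvd c * f b - (c mod int p) * f b" by simp
  qed
  then show ?thesis using cls_smult[OF f] mod_F[of c] by (simp add: F_simps)
qed

text \<open>Point masses corrected at \<open>pinf\<close> to have sum zero. They span the functions
  of sum zero, and \<open>delta pinf\<close> vanishes, which normalises the coefficients of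
  functionals at \<open>pinf\<close>.\<close>

definition delta :: "'b \<Rightarrow> 'b \<Rightarrow> int" where
  "delta x = (\<lambda>b. (if b = x then 1 else 0) - (if b = pinf then 1 else 0))"

lemma dvd_delta: "x \<in> B \<Longrightarrow> int p dvd sum (delta x) B"
  using B.finite_X B.pinf_closed by (simp add: delta_def sum_subtractf)

text \<open>Modulo p, a function f of sum zero is the combination of the \<open>delta x\<close> with
  coefficients f x. A functional thus becomes a row of coefficients paired with f, and its values
  along an orbit become the sums of \<open>matrix_coefficients_separate\<close>.\<close>

lemma functional_cls:
  assumes \<phi>: "functional \<phi>" and f: "int p dvd sum f B"
  shows "\<phi> (cls f) = (\<Sum>x\<in>B. \<phi> (cls (delta x)) * f x) mod int p"
proof -
  have *: "int p dvd (\<Sum>b\<in>B. \<Sum>x\<in>S. f x * delta x b) \<and>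
      \<phi> (cls (\<lambda>b. \<Sum>x\<in>S. f x * delta x b)) = (\<Sum>x\<in>S. \<phi> (cls (delta x)) * f x) mod int p"
    if "finite S" "S \<subseteq> B" for S
    using that
  proof (induction S rule: finite_induct)
    case empty
    have "cls (\<lambda>b. 0) = \<zero>\<^bsub>V\<^esub>" by (subst cls_zero) simp_all
    moreover have "\<phi> \<zero>\<^bsub>V\<^esub> = 0"
    proof -
      have "\<phi> (0 \<odot>\<^bsub>V\<^esub> \<zero>\<^bsub>V\<^esub>) = (0 * \<phi> \<zero>\<^bsub>V\<^esub>) mod int p"
        using \<phi> p_gt unfolding functional_def F_simps by simp
      then show ?thesis using V.smult_l_null[OF V.zero_closed] by (simp add: F_simps)
    qed
    ultimately show ?case by simp
  next
    case (insert x S)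
    have x: "x \<in> B" using insert by simp
    have dx: "int p dvd (\<Sum>b\<in>B. f x * delta x b)" by (rule dvd_sum_mult[OF dvd_delta[OF x]])
    have IH: "int p dvd (\<Sum>b\<in>B. \<Sum>x\<in>S. f x * delta x b)"
      "\<phi> (cls (\<lambda>b. \<Sum>x\<in>S. f x * delta x b)) = (\<Sum>x\<in>S. \<phi> (cls (delta x)) * f x) mod int p"
      using insert by auto
    have "cls (\<lambda>b. \<Sum>x\<in>insert x S. f x * delta x b) = cls (\<lambda>b. f x * delta x b + (\<Sum>x\<in>S. f x * delta x b))"
      using insert by simp
    also have "\<dots> = cls (\<lambda>b. f x * delta x b) \<oplus>\<^bsub>V\<^esub> cls (\<lambda>b. \<Sum>x\<in>S. f x * delta x b)"
      by (rule cls_add[OF dx IH(1)])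
    also have "cls (\<lambda>b. f x * delta x b) = (f x mod int p) \<odot>\<^bsub>V\<^esub> cls (delta x)"
      by (rule cls_mult[OF dvd_delta[OF x]])
    finally have "\<phi> (cls (\<lambda>b. \<Sum>x\<in>insert x S. f x * delta x b)) =
        ((f x mod int p * \<phi> (cls (delta x))) mod int p + \<phi> (cls (\<lambda>b. \<Sum>x\<in>S. f x * delta x b))) mod int p"
      using \<phi> mod_F[of "f x"] cls_closed[OF dvd_delta[OF x]] cls_closed[OF IH(1)] V.smult_closed
      unfolding functional_def by (simp add: F_simps(2,3))
    also have "\<dots> = (\<Sum>x\<in>insert x S. \<phi> (cls (delta x)) * f x) mod int p"
      using insert by (simp add: IH(2) mod_simps mult.commute)
    finally show ?case
      using insert dx IH(1) dvd_sum_add[OF dx IH(1)] by simp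
  qed
  define g where "g = (\<lambda>b. \<Sum>x\<in>B. f x * delta x b)"
  have g: "int p dvd sum g B" "\<phi> (cls g) = (\<Sum>x\<in>B. \<phi> (cls (delta x)) * f x) mod int p"
    using *[OF B.finite_X order_refl] by (simp_all add: g_def)
  have "cls f = cls g"
  proof (rule cls_cong[OF f g(1)])
    fix b assume b: "b \<in> B"
    have "g b = (\<Sum>x\<in>B. if b = x then f x else 0) - (\<Sum>x\<in>B. f x * (if b = pinf then 1 else 0))"
      unfolding g_def delta_def sum_subtractf[symmetric]
      by (rule sum.cong) (auto simp: algebra_simps)
    also have "\<dots> = f b - (\<Sum>x\<in>B. f x) * (if b = pinf then 1 else 0)"
      using b B.finite_X by (simp add: sum_distrib_right)
    finally show "int p dvd f b - g b" using f by simp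
  qed
  then show ?thesis using g(2) by simp
qed

lemma functional_nonzero_coeff:
  assumes \<phi>: "functional \<phi>" and v: "v \<in> carrier V" "\<phi> v = 1"
  shows "\<exists>b\<in>B. \<not> int p dvd \<phi> (cls (delta b))"
proof (rule ccontr)
  assume *: "\<not> ?thesis"
  obtain f where f: "int p dvd sum f B" "v = cls f" using cls_surj[OF v(1)] by blast
  have "int p dvd (\<Sum>x\<in>B. \<phi> (cls (delta x)) * f x)" using * by (intro dvd_sum) auto
  then have "\<phi> v = 0" using functional_cls[OF \<phi> f(1)] f(2) by (simp add: mod_eq_0_iff_dvd)
  then show False using v by simp
qed

lemma functional_pinf: assumes "functional \<phi>" shows "\<phi> (cls (delta pinf)) = 0"
proof -
  have "cls (delta pinf) = \<zero>\<^bsub>V\<^esub>"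
    by (subst cls_zero[OF dvd_delta[OF B.pinf_closed]]) (simp add: delta_def)
  moreover have "\<phi> \<zero>\<^bsub>V\<^esub> = 0"
  proof -
    have "\<phi> (0 \<odot>\<^bsub>V\<^esub> \<zero>\<^bsub>V\<^esub>) = (0 * \<phi> \<zero>\<^bsub>V\<^esub>) mod int p"
      using assms p_gt unfolding functional_def F_simps by simp
    then show ?thesis using V.smult_l_null[OF V.zero_closed] by (simp add: F_simps)
  qed
  ultimately show ?thesis by simp
qed

text \<open>The values outside \<open>pinf\<close> determine a function of sum zero, which bounds
  the dimension by q whether or not p divides q + 1.\<close>

lemma finite_V: "finite (carrier V)" and card_V_le: "card (carrier V) \<le> card (carrier F) ^ CARD('k)"
proof -
  define ext where "ext h = (\<lambda>b. if b = pinf then - (\<Sum>x\<in>B - {pinf}. h x) else h b)" for h :: "'b \<Rightarrow> int"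
  have sum_ext: "sum (ext h) B = 0" for h
  proof -
    have "sum (ext h) B = ext h pinf + sum (ext h) (B - {pinf})"
      using B.finite_X B.pinf_closed by (rule sum.remove)
    also have "sum (ext h) (B - {pinf}) = sum h (B - {pinf})"
      by (rule sum.cong) (auto simp: ext_def)
    finally show ?thesis by (simp add: ext_def)
  qed
  let ?H = "(B - {pinf}) \<rightarrow>\<^sub>E {0..int p - 1}"
  have cover: "carrier V \<subseteq> (\<lambda>h. cls (ext h)) ` ?H"
  proof
    fix v assume "v \<in> carrier V"
    then obtain f where f: "int p dvd sum f B" "v = cls f" using cls_surj by blast
    define h where "h = (\<lambda>b\<in>B - {pinf}. f b mod int p)"
    have "cls f = cls (ext h)"
    proof (rule cls_cong[OF f(1)])
      show "int p dvd sum (ext h) B" by (simp add: sum_ext)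
      fix b assume b: "b \<in> B"
      show "int p dvd f b - ext h b"
      proof (cases "b = pinf")
        case False
        then show ?thesis using b by (simp add: ext_def h_def)
      next
        case True
        have "sum h (B - {pinf}) = (\<Sum>x\<in>B - {pinf}. f x mod int p)"
          by (rule sum.cong) (auto simp: h_def)
        moreover have "sum f B = f pinf + sum f (B - {pinf})"
          using B.finite_X B.pinf_closed by (rule sum.remove)
        moreover have "f pinf + sum f (B - {pinf}) = (f pinf + (\<Sum>x\<in>B - {pinf}. f x mod int p)) + (\<Sum>x\<in>B - {pinf}. f x - f x mod int p)"
          by (simp add: sum_subtractf)
        moreover have "int p dvd (\<Sum>x\<in>B - {pinf}. f x - f x mod int p)"
          by (intro dvd_sum) simp
        ultimately show ?thesis using f(1) True by (simp add: ext_def dvd_add_left_iff)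
      qed
    qed
    moreover have "h \<in> ?H" using mod_F by (auto simp: h_def F_simps)
    ultimately show "v \<in> (\<lambda>h. cls (ext h)) ` ?H" using f(2) by blast
  qed
  have finH: "finite ?H" using B.finite_X by (intro finite_PiE) auto
  show "finite (carrier V)" using cover finH finite_surj by blast
  have "card (carrier V) \<le> card ?H" by (rule surj_card_le[OF finH cover])
  also have "\<dots> = card {0..int p - 1} ^ card (B - {pinf})"
    using B.finite_X by (simp add: card_PiE)
  also have "card (B - {pinf}) = CARD('k)"
    using B.card_X B.pinf_closed B.finite_X by (simp add: card_Diff_singleton)
  finally show "card (carrier V) \<le> card (carrier F) ^ CARD('k)" by (simp add: F_simps)
qed

lemma V_nontrivial: "carrier V \<noteq> {\<zero>\<^bsub>V\<^esub>}"
proof -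
  have ptB: "pt 0 \<in> B" by (rule B.pt_closed)
  have "\<not> int p dvd delta (pt 0) (pt 0) - delta (pt 0) pinf"
  proof
    assume "int p dvd delta (pt 0) (pt 0) - delta (pt 0) pinf"
    then have "int p dvd 2" using B.pt_pinf[of 0] B.pt_pinf[of 0, symmetric] by (simp add: delta_def)
    then show False using p_gt zdvd_imp_le by fastforce
  qed
  then have "cls (delta (pt 0)) \<noteq> \<zero>\<^bsub>V\<^esub>"
    using cls_zero[OF dvd_delta[OF ptB]] ptB B.pinf_closed by blast
  then show ?thesis using cls_closed[OF dvd_delta[OF ptB]] by auto
qed

text \<open>A functional with coefficients g that vanishes on W and a vector f of W give the tensor
  g x * f y, all of whose matrix coefficients vanish. Separation then contradicts that both are
  nonzero.\<close>

lemma simple: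
  assumes W: "subspace W" and stable: "\<And>A x. det A = 1 \<Longrightarrow> x \<in> W \<Longrightarrow> \<sigma> A x \<in> W"
  shows "W = {\<zero>\<^bsub>V\<^esub>} \<or> W = carrier V"
proof (rule ccontr)
  assume neg: "\<not> ?thesis"
  have WV: "W \<subseteq> carrier V" "\<zero>\<^bsub>V\<^esub> \<in> W" using W by (auto simp: subspace_def)
  obtain w where w: "w \<in> W" "w \<noteq> \<zero>\<^bsub>V\<^esub>" using neg WV by blast
  obtain v where v: "v \<in> carrier V" "v \<notin> W" using neg WV by blast
  obtain \<phi> where \<phi>: "functional \<phi>" "\<And>w. w \<in> W \<Longrightarrow> \<phi> w = 0" "\<phi> v = 1"
    using functional_separation[OF finite_V W v] by (auto simp: F_simps)
  obtain f where f: "int p dvd sum f B" "w = cls f" using cls_surj w WV by blast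
  define g where "g x = \<phi> (cls (delta x))" for x
  have inv: "[(\<Sum>x\<in>B. g x * f (act A x)) = 0] (mod int p)" if A: "det A = 1" for A
  proof -
    have "\<sigma> (adj A) w = cls (\<lambda>b. f (act A b))"
      using \<sigma>_cls[of "adj A" f] A f by (simp add: adj_adj)
    moreover have "\<phi> (\<sigma> (adj A) w) = 0" using \<phi>(2) stable[of "adj A" w] A w by simp
    ultimately show ?thesis
      using functional_cls[OF \<phi>(1) dvd_sum_act[OF A f(1)]] by (simp add: g_def cong_def)
  qed
  have row: "[(\<Sum>y\<in>B. g x * f y) = 0] (mod int p)" for x
    using dvd_sum_mult[OF f(1), of "g x"] by (simp add: cong_0_iff)
  obtain b where b: "b \<in> B" "\<not> int p dvd g b"
    using functional_nonzero_coeff[OF \<phi>(1) v(1) \<phi>(3)] by (auto simp: g_def)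
  obtain c c' where c: "c \<in> B" "c' \<in> B" "\<not> int p dvd f c - f c'"
    using w(2) f cls_zero[OF f(1)] by blast
  have pp: "prime (int p)" using prime_p by simp
  have "int p dvd g b * f c - g pinf * f c - (g b * f c' - g pinf * f c')"
    by (rule B.matrix_coefficients_separate[where T = "\<lambda>x y. g x * f y", OF pp p_gt row inv b(1) B.pinf_closed c(1,2)])
  then have "int p dvd g b * (f c - f c')"
    using functional_pinf[OF \<phi>(1)] by (simp add: g_def right_diff_distrib)
  then show False using b c pp by (simp add: prime_dvd_mult_iff)
qed

text \<open>If z v is not a multiple of v, take a functional \<phi> with \<phi> (z v) = 1.
  Commutation makes all matrix coefficients of a tensor of rank two vanish, namely \<phi> paired
  with z v minus the composite of \<phi> and z paired with v. Separation turns this into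
  proportionality of z v and v. So every vector is an eigenvector, and one eigenspace, being
  invariant, is all of V.\<close>

lemma commuting_scalar:
  assumes z: "z \<in> carrier E" and comm: "\<And>A. det A = 1 \<Longrightarrow> \<sigma> A \<otimes>\<^bsub>E\<^esub> z = z \<otimes>\<^bsub>E\<^esub> \<sigma> A"
  shows "\<exists>c\<in>carrier F. z = c \<odot>\<^bsub>E\<^esub> \<one>\<^bsub>E\<^esub>"
proof -
  have comm': "\<sigma> A (z v) = z (\<sigma> A v)" if "det A = 1" "v \<in> carrier V" for A v
    using comm[OF that(1)] End_alg_apply(1)[OF that(2), of F "\<sigma> A" z] End_alg_apply(1)[OF that(2), of F z "\<sigma> A"] by simp
  have line: "\<exists>c\<in>carrier F. z v = c \<odot>\<^bsub>V\<^esub> v" if v: "v \<in> carrier V" for v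
  proof (rule ccontr)
    assume neg: "\<not> ?thesis"
    let ?W = "{c \<odot>\<^bsub>V\<^esub> v |c. c \<in> carrier F}"
    have zv: "z v \<in> carrier V" using z v by (rule End_algD(2))
    have "z v \<notin> ?W" using neg by blast
    then obtain \<phi> where \<phi>: "functional \<phi>" "\<And>w. w \<in> ?W \<Longrightarrow> \<phi> w = 0" "\<phi> (z v) = 1"
      using functional_separation[OF finite_V subspace_line[OF v] zv] by (auto simp: F_simps)
    obtain f where f: "int p dvd sum f B" "v = cls f" using cls_surj v by blast
    obtain f' where f': "int p dvd sum f' B" "z v = cls f'" using cls_surj zv by blast
    have \<psi>: "functional (\<lambda>x. \<phi> (z x))"
      using \<phi>(1) End_algD(2-4)[OF z] unfolding functional_def by simp
    define g where "g x = \<phi> (cls (delta x))" for x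
    define g' where "g' x = \<phi> (z (cls (delta x)))" for x
    have inv: "[(\<Sum>x\<in>B. g x * f' (act A x) - g' x * f (act A x)) = 0] (mod int p)" if A: "det A = 1" for A
    proof -
      have A': "det (adj A) = 1" using A by simp
      have "\<sigma> (adj A) v = cls (\<lambda>b. f (act A b))" "\<sigma> (adj A) (z v) = cls (\<lambda>b. f' (act A b))"
        using \<sigma>_cls[OF A' f(1)] \<sigma>_cls[OF A' f'(1)] f f' by (simp_all add: adj_adj)
      then have "cls (\<lambda>b. f' (act A b)) = z (cls (\<lambda>b. f (act A b)))" using comm'[OF A' v] by simp
      then have "(\<Sum>x\<in>B. g x * f' (act A x)) mod int p = (\<Sum>x\<in>B. g' x * f (act A x)) mod int p"
        using functional_cls[OF \<phi>(1) dvd_sum_act[OF A f'(1)]] functional_cls[OF \<psi> dvd_sum_act[OF A f(1)]]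
        by (simp add: g_def g'_def)
      then show ?thesis by (simp add: sum_subtractf cong_0_iff mod_eq_dvd_iff)
    qed
    have row: "[(\<Sum>y\<in>B. g x * f' y - g' x * f y) = 0] (mod int p)" for x
      using dvd_sum_diff[OF dvd_sum_mult[OF f'(1), of "g x"] dvd_sum_mult[OF f(1), of "g' x"]]
      by (simp add: cong_0_iff)
    obtain b where b: "b \<in> B" "\<not> int p dvd g b"
      using functional_nonzero_coeff[OF \<phi>(1) zv \<phi>(3)] by (auto simp: g_def)
    have pp: "prime (int p)" using prime_p by simp
    have sep: "int p dvd g b * (f' c - f' c') - g' b * (f c - f c')" if c: "c \<in> B" "c' \<in> B" for c c'
    proof -
      have "int p dvd (g b * f' c - g' b * f c) - (g pinf * f' c - g' pinf * f c)
          - ((g b * f' c' - g' b * f c') - (g pinf * f' c' - g' pinf * f c'))"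
        by (rule B.matrix_coefficients_separate[where T = "\<lambda>x y. g x * f' y - g' x * f y",
              OF pp p_gt row inv b(1) B.pinf_closed c])
      moreover have "g pinf = 0" "g' pinf = 0"
        using functional_pinf[OF \<phi>(1)] functional_pinf[OF \<psi>] by (simp_all add: g_def g'_def)
      ultimately show ?thesis by (simp add: algebra_simps)
    qed
    have "coprime (g b) (int p)" using b(2) pp by (metis coprime_commute prime_imp_coprime)
    then obtain i where i: "[g b * i = 1] (mod int p)" using cong_solve_coprime_int by blast
    \<comment> \<open>The quotient of g' b by g b modulo p, by which separation relates f' to f up
      to constants.\<close>
    define k where "k = i * g' b"
    have "cls f' = cls (\<lambda>b. k * f b)"
    proof (rule cls_eqI[OF f'(1) dvd_sum_mult[OF f(1)]])
      fix c c' assume c: "c \<in> B" "c' \<in> B"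
      have "int p dvd i * (g b * (f' c - f' c') - g' b * (f c - f c'))" using sep[OF c] by simp
      moreover have "int p dvd (1 - g b * i) * (f' c - f' c')"
        using i by (simp add: cong_iff_dvd_diff dvd_diff_commute)
      ultimately have "int p dvd i * (g b * (f' c - f' c') - g' b * (f c - f c')) + (1 - g b * i) * (f' c - f' c')"
        by (rule dvd_add)
      moreover have "i * (g b * (f' c - f' c') - g' b * (f c - f c')) + (1 - g b * i) * (f' c - f' c')
          = (f' c - k * f c) - (f' c' - k * f c')" by (simp add: k_def algebra_simps)
      ultimately show "int p dvd (f' c - k * f c) - (f' c' - k * f c')" by simp
    qed
    then have "z v = (k mod int p) \<odot>\<^bsub>V\<^esub> v" using cls_mult[OF f(1)] f f' by simp
    then show False using neg mod_F by blast
  qed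
  obtain v where v: "v \<in> carrier V" "v \<noteq> \<zero>\<^bsub>V\<^esub>" using V_nontrivial V.zero_closed by blast
  obtain c where c: "c \<in> carrier F" "z v = c \<odot>\<^bsub>V\<^esub> v" using line[OF v(1)] by blast
  define W where "W = {x \<in> carrier V. z x = c \<odot>\<^bsub>V\<^esub> x}"
  have "W = {\<zero>\<^bsub>V\<^esub>} \<or> W = carrier V"
  proof (rule simple)
    show "subspace W" unfolding subspace_def
    proof (intro conjI ballI)
      show "\<zero>\<^bsub>V\<^esub> \<in> W" using c by (simp add: W_def End_zero[OF z] smult_zero_right)
      show "x \<oplus>\<^bsub>V\<^esub> y \<in> W" if "x \<in> W" "y \<in> W" for x y
        using that c End_algD(3)[OF z] by (simp add: W_def V.smult_r_distr)
      show "d \<odot>\<^bsub>V\<^esub> x \<in> W" if d: "d \<in> carrier F" "x \<in> W" for d x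
        using d c End_algD(4)[OF z] F.m_comm[of c d] by (simp add: W_def V.smult_assoc1[symmetric])
    qed (auto simp: W_def)
    show "\<sigma> A x \<in> W" if A: "det A = 1" and x: "x \<in> W" for A x
    proof -
      have xV: "x \<in> carrier V" using x by (simp add: W_def)
      have "z (\<sigma> A x) = \<sigma> A (c \<odot>\<^bsub>V\<^esub> x)" using comm'[OF A xV] x by (simp add: W_def)
      also have "\<dots> = c \<odot>\<^bsub>V\<^esub> \<sigma> A x" by (rule End_algD(4)[OF \<sigma>_closed[OF A] c(1) xV])
      finally show ?thesis using End_algD(2)[OF \<sigma>_closed[OF A] xV] by (simp add: W_def)
    qed
  qed
  moreover have "v \<in> W" using v c by (simp add: W_def)
  ultimately have W: "W = carrier V" using v by blast
  have "z = c \<odot>\<^bsub>E\<^esub> \<one>\<^bsub>E\<^esub>"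
  proof (rule End_alg_eqI[of _ F V])
    show "z \<in> carrier E" by (rule z)
    show "c \<odot>\<^bsub>E\<^esub> \<one>\<^bsub>E\<^esub> \<in> carrier E" by (rule smult_closed[OF c(1) one_closed])
    fix x assume x: "x \<in> carrier V"
    then have "z x = c \<odot>\<^bsub>V\<^esub> x" using W by (auto simp: W_def)
    then show "z x = (c \<odot>\<^bsub>E\<^esub> \<one>\<^bsub>E\<^esub>) x" using x by (simp add: End_alg_apply)
  qed
  then show ?thesis using c by blast
qed

lemma \<sigma>_ext:
  assumes "f \<in> carrier E" "g \<in> carrier E" "\<And>h. int p dvd sum h B \<Longrightarrow> f (cls h) = g (cls h)"
  shows "f = g"
  using assms cls_surj by (intro End_alg_eqI[of _ F V]) blast+

theorem normal_subalgebra_central_simple: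
  assumes R: "subring R E" "\<And>c u. c \<in> carrier F \<Longrightarrow> u \<in> R \<Longrightarrow> c \<odot>\<^bsub>E\<^esub> u \<in> R"
    and R_conj: "\<And>A u. det A = 1 \<Longrightarrow> u \<in> R \<Longrightarrow> \<sigma> A \<otimes>\<^bsub>E\<^esub> u \<otimes>\<^bsub>E\<^esub> \<sigma> (adj A) \<in> R"
  shows "central_simple_algebra F (E\<lparr>carrier := R\<rparr>)"
proof -
  interpret N: SL2_normal_subalgebra F V \<sigma> R l r
  proof (intro SL2_normal_subalgebra.intro SL2_normal_subalgebra_axioms.intro)
    show "\<exists>c\<in>carrier F. z = c \<odot>\<^bsub>E\<^esub> \<one>\<^bsub>E\<^esub>"
      if "z \<in> carrier E" "\<And>A. det A = 1 \<Longrightarrow> \<sigma> A \<otimes>\<^bsub>E\<^esub> z = z \<otimes>\<^bsub>E\<^esub> \<sigma> A" for z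
      using that by (rule commuting_scalar)
    show "vector_space_over F V" by (rule vector_space_over_axioms)
    show "c \<odot>\<^bsub>E\<^esub> u \<in> R" if "c \<in> carrier F" "u \<in> R" for c u using that by (rule R(2))
    show "\<sigma> A \<otimes>\<^bsub>E\<^esub> u \<otimes>\<^bsub>E\<^esub> \<sigma> (adj A) \<in> R" if "det A = 1" "u \<in> R" for A u
      using that by (rule R_conj)
    show "finite (carrier F)" by (simp add: F_simps)
    show "finite (carrier V)" by (rule finite_V)
    show "\<sigma> A \<in> carrier E" if "det A = 1" for A using \<sigma>_closed that .
    show "\<sigma> (mat 1) = \<one>\<^bsub>E\<^esub>"
    proof (rule \<sigma>_ext)
      fix h assume h: "int p dvd sum h B"
      have "cls (\<lambda>b. h (act (mat 1) b)) = cls h"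
        using dvd_sum_act[OF _ h, of "mat 1"] h B.act_one by (intro cls_cong) simp_all
      then show "\<sigma> (mat 1) (cls h) = \<one>\<^bsub>E\<^esub> (cls h)"
        using \<sigma>_cls[OF _ h, of "mat 1"] cls_closed[OF h] by (simp add: End_alg_apply)
    qed (use \<sigma>_closed one_closed in simp_all)
    show "\<sigma> neg_one = \<one>\<^bsub>E\<^esub>"
    proof (rule \<sigma>_ext)
      fix h assume h: "int p dvd sum h B"
      have "cls (\<lambda>b. h (act neg_one b)) = cls h"
        using dvd_sum_act[OF _ h, of neg_one] h B.act_neg by (intro cls_cong) simp_all
      then show "\<sigma> neg_one (cls h) = \<one>\<^bsub>E\<^esub> (cls h)"
        using \<sigma>_cls[OF _ h, of neg_one] cls_closed[OF h] by (simp add: End_alg_apply)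
    qed (use \<sigma>_closed one_closed in simp_all)
    show "\<sigma> (A ** C) = \<sigma> A \<otimes>\<^bsub>E\<^esub> \<sigma> C" if A: "det A = 1" and C: "det C = 1" for A C
    proof (rule \<sigma>_ext)
      fix h assume h: "int p dvd sum h B"
      have AC: "det (A ** C) = 1" using A C by simp
      have C': "det (adj C) = 1" and A': "det (adj A) = 1" using A C by simp_all
      have hC: "int p dvd (\<Sum>b\<in>B. h (act (adj C) b))" by (rule dvd_sum_act[OF C' h])
      have "\<sigma> (A ** C) (cls h) = cls (\<lambda>b. h (act (adj (A ** C)) b))" by (rule \<sigma>_cls[OF AC h])
      also have "\<dots> = cls (\<lambda>b. h (act (adj C) (act (adj A) b)))"
      proof (rule cls_cong)
        show "int p dvd (\<Sum>b\<in>B. h (act (adj (A ** C)) b))" using AC by (intro dvd_sum_act h) simp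
        show "int p dvd (\<Sum>b\<in>B. h (act (adj C) (act (adj A) b)))" by (rule dvd_sum_act[OF A' hC])
        show "int p dvd h (act (adj (A ** C)) b) - h (act (adj C) (act (adj A) b))" if "b \<in> B" for b
          using that A' C' by (simp add: adj_mult B.act_mult)
      qed
      also have "\<dots> = \<sigma> A (\<sigma> C (cls h))" using \<sigma>_cls[OF A hC] \<sigma>_cls[OF C h] by simp
      finally show "\<sigma> (A ** C) (cls h) = (\<sigma> A \<otimes>\<^bsub>E\<^esub> \<sigma> C) (cls h)"
        using cls_closed[OF h] by (simp add: End_alg_apply)
    qed (use \<sigma>_closed A C mult_closed in simp_all)
    show "W = {\<zero>\<^bsub>V\<^esub>} \<or> W = carrier V"
      if "W \<subseteq> carrier V" "\<zero>\<^bsub>V\<^esub> \<in> W" "\<And>x y. x \<in> W \<Longrightarrow> y \<in> W \<Longrightarrow> x \<oplus>\<^bsub>V\<^esub> y \<in> W"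
        "\<And>c x. c \<in> carrier F \<Longrightarrow> x \<in> W \<Longrightarrow> c \<odot>\<^bsub>V\<^esub> x \<in> W"
        "\<And>A x. det A = 1 \<Longrightarrow> x \<in> W \<Longrightarrow> \<sigma> A x \<in> W" for W
      by (rule simple) (use that in \<open>simp_all add: subspace_def\<close>)
  qed (fact prime_l card_k big card_V_le V_nontrivial R(1))+
  show ?thesis by (rule N.central_simple)
qed

end

section \<open>Homomorphisms from SL(2)\<close>

lemma group_SL2: "Group.group (SL2 :: ('k::field^2^2) monoid)"
proof (rule groupI)
  fix A :: "'k^2^2" assume "A \<in> carrier SL2"
  then show "\<exists>C\<in>carrier SL2. C \<otimes>\<^bsub>SL2\<^esub> A = \<one>\<^bsub>SL2\<^esub>"
    by (intro bexI[of _ "adj A"]) (simp_all add: SL2_def adj_inverse)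
qed (simp_all add: SL2_def matrix_mul_assoc det_mul)

lemma normal_center:
  fixes G (structure)
  assumes "Group.group G" shows "group_center G \<lhd> G"
proof -
  interpret Group.group G by fact
  have sub: "subgroup (group_center G) G"
  proof (rule subgroupI)
    show "group_center G \<subseteq> carrier G" by (auto simp: group_center_def)
    have "\<one> \<in> group_center G" by (simp add: group_center_def)
    then show "group_center G \<noteq> {}" by blast
    fix z assume z: "z \<in> group_center G"
    then have zG: "z \<in> carrier G" and zc: "\<And>x. x \<in> carrier G \<Longrightarrow> z \<otimes> x = x \<otimes> z"
      by (auto simp: group_center_def)
    have "inv z \<otimes> x = x \<otimes> inv z" if x: "x \<in> carrier G" for x
    proof -
      have "inv z \<otimes> x = inv z \<otimes> (x \<otimes> z) \<otimes> inv z" using zG x by (simp add: m_assoc)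
      also have "\<dots> = inv z \<otimes> (z \<otimes> x) \<otimes> inv z" by (simp only: zc[OF x])
      also have "\<dots> = x \<otimes> inv z" using zG x by (simp add: m_assoc[symmetric])
      finally show ?thesis .
    qed
    then show "inv z \<in> group_center G" using zG by (simp add: group_center_def)
    fix w assume w: "w \<in> group_center G"
    then have wG: "w \<in> carrier G" and wc: "\<And>x. x \<in> carrier G \<Longrightarrow> w \<otimes> x = x \<otimes> w"
      by (auto simp: group_center_def)
    have "z \<otimes> w \<otimes> x = x \<otimes> (z \<otimes> w)" if x: "x \<in> carrier G" for x
    proof -
      have "z \<otimes> w \<otimes> x = z \<otimes> (w \<otimes> x)" using zG wG x by (rule m_assoc)
      also have "w \<otimes> x = x \<otimes> w" using x by (rule wc)
      also have "z \<otimes> (x \<otimes> w) = z \<otimes> x \<otimes> w" using m_assoc[OF zG x wG] by simp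
      also have "z \<otimes> x = x \<otimes> z" using x by (rule zc)
      finally show ?thesis using m_assoc[OF x zG wG] by simp
    qed
    then show "z \<otimes> w \<in> group_center G" using zG wG by (simp add: group_center_def)
  qed
  show ?thesis
  proof (rule normal_invI[OF sub])
    fix x h assume x: "x \<in> carrier G" and h: "h \<in> group_center G"
    then have "h \<in> carrier G" "h \<otimes> x = x \<otimes> h" by (auto simp: group_center_def)
    then have "x \<otimes> h \<otimes> inv x = h \<otimes> x \<otimes> inv x" by simp
    also have "\<dots> = h" using x \<open>h \<in> carrier G\<close> by (simp add: m_assoc)
    finally show "x \<otimes> h \<otimes> inv x \<in> group_center G" using h by simp
  qed
qed

text \<open>The computations are made with matrices, so the embedding of PSL(2, q) is inflated to
  SL(2, q). The central \<open>neg_one\<close> becomes trivial, whereas \<open>upper 1\<close> does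
  not commute with \<open>lower 1\<close> and stays nontrivial.\<close>

lemma ex_SL2_hom:
  assumes G: "subgroup G (BijGroup B)" and H: "subgroup H ((BijGroup B)\<lparr>carrier := G\<rparr>)"
    and iso: "(BijGroup B)\<lparr>carrier := H\<rparr> \<cong> (PSL2 :: ('k::field^2^2) set monoid)"
  shows "\<exists>\<tau> :: 'k^2^2 \<Rightarrow> 'b \<Rightarrow> 'b. (\<forall>A. det A = 1 \<longrightarrow> \<tau> A \<in> G) \<and>
     (\<forall>A C. det A = 1 \<longrightarrow> det C = 1 \<longrightarrow> \<tau> (A ** C) = \<tau> A \<otimes>\<^bsub>BijGroup B\<^esub> \<tau> C) \<and>
     \<tau> (mat 1) = \<one>\<^bsub>BijGroup B\<^esub> \<and> \<tau> neg_one = \<one>\<^bsub>BijGroup B\<^esub> \<and> \<tau> (upper 1) \<noteq> \<one>\<^bsub>BijGroup B\<^esub>"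
proof -
  let ?S = "SL2 :: ('k^2^2) monoid" and ?H = "(BijGroup B)\<lparr>carrier := H\<rparr>"
  let ?Z = "group_center ?S"
  interpret Bij: Group.group "BijGroup B" by (rule group_BijGroup)
  interpret GG: Group.group "(BijGroup B)\<lparr>carrier := G\<rparr>" by (rule Bij.subgroup_imp_group[OF G])
  have "Group.group (((BijGroup B)\<lparr>carrier := G\<rparr>)\<lparr>carrier := H\<rparr>)" by (rule GG.subgroup_imp_group[OF H])
  then interpret HH: Group.group ?H by simp
  interpret S: Group.group ?S by (rule group_SL2)
  interpret Z: normal ?Z ?S by (rule normal_center[OF group_SL2])
  have HG: "H \<subseteq> G" using subgroup.subset[OF H] by simp
  have P: "Group.group (PSL2 :: ('k^2^2) set monoid)" unfolding PSL2_def by (rule Z.factorgroup_is_group)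
  obtain \<psi> where \<psi>: "\<psi> \<in> Group.iso (PSL2 :: ('k^2^2) set monoid) ?H"
    using HH.iso_sym[OF iso] by (auto simp: is_iso_def)
  then have hom: "\<psi> \<in> hom PSL2 ?H" and bij: "bij_betw \<psi> (carrier PSL2) H" by (auto simp: Group.iso_def)
  have S_carrier: "A \<in> carrier ?S \<longleftrightarrow> det A = 1" for A by (simp add: SL2_def)
  have coset: "?Z #>\<^bsub>?S\<^esub> A \<in> carrier PSL2" if "det A = 1" for A
    using that S.rcosetsI[OF Z.subset, of A] by (simp add: PSL2_def FactGroup_def S_carrier)
  have one_P: "\<one>\<^bsub>PSL2\<^esub> = ?Z" by (simp add: PSL2_def FactGroup_def)
  have join: "?Z #>\<^bsub>?S\<^esub> A = ?Z" if "A \<in> ?Z" for A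
    using that Z.subset by (intro S.coset_join2 Z.subgroup_axioms) auto
  have neg_Z: "neg_one \<in> ?Z"
  proof -
    have "neg_one ** A = A ** neg_one" for A :: "'k^2^2"
      by (cases A rule: mat2_cases) (simp add: SL2_defs mat2_mult)
    then show ?thesis by (simp add: group_center_def SL2_def)
  qed
  have up_Z: "upper 1 \<notin> ?Z"
  proof
    assume "upper 1 \<in> ?Z"
    then have "upper 1 ** lower 1 = lower 1 ** (upper 1 :: 'k^2^2)" by (simp add: group_center_def SL2_def)
    then have "(1::'k) + 1 = 1" by (simp add: SL2_defs mat2_mult mat2_eq_iff)
    then show False by (simp only: add_cancel_left_right one_neq_zero)
  qed
  define \<tau> where "\<tau> A = \<psi> (?Z #>\<^bsub>?S\<^esub> A)" for A
  have psi_one: "\<psi> ?Z = \<one>\<^bsub>BijGroup B\<^esub>"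
    using group_hom.hom_one[OF group_hom.intro[OF P HH.group_axioms group_hom_axioms.intro[OF hom]]]
    by (simp add: one_P)
  have "\<tau> A \<in> G" if "det A = 1" for A
    using coset[OF that] bij HG by (auto simp: \<tau>_def bij_betw_def)
  moreover have "\<tau> (A ** C) = \<tau> A \<otimes>\<^bsub>BijGroup B\<^esub> \<tau> C" if "det A = 1" "det C = 1" for A C
  proof -
    have "?Z #>\<^bsub>?S\<^esub> (A ** C) = (?Z #>\<^bsub>?S\<^esub> A) <#>\<^bsub>?S\<^esub> (?Z #>\<^bsub>?S\<^esub> C)"
      using Z.rcos_sum[of A C] that by (simp add: S_carrier) (simp add: SL2_def)
    also have "\<dots> = (?Z #>\<^bsub>?S\<^esub> A) \<otimes>\<^bsub>PSL2\<^esub> (?Z #>\<^bsub>?S\<^esub> C)" by (simp add: PSL2_def FactGroup_def)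
    finally show ?thesis using hom_mult[OF hom coset[OF that(1)] coset[OF that(2)]] by (simp add: \<tau>_def)
  qed
  moreover have "\<tau> (mat 1) = \<one>\<^bsub>BijGroup B\<^esub>"
    using join[OF Z.one_closed] psi_one by (simp add: \<tau>_def SL2_def)
  moreover have "\<tau> neg_one = \<one>\<^bsub>BijGroup B\<^esub>" using join[OF neg_Z] psi_one by (simp add: \<tau>_def)
  moreover have "\<tau> (upper 1) \<noteq> \<one>\<^bsub>BijGroup B\<^esub>"
  proof
    assume "\<tau> (upper 1) = \<one>\<^bsub>BijGroup B\<^esub>"
    then have "\<psi> (?Z #>\<^bsub>?S\<^esub> upper 1) = \<psi> ?Z" by (simp add: \<tau>_def psi_one)
    moreover have "?Z \<in> carrier PSL2" using coset[of "mat 1"] join[OF Z.one_closed] by (simp add: SL2_def)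
    ultimately have "?Z #>\<^bsub>?S\<^esub> upper 1 = ?Z"
      using bij coset[of "upper 1"] by (auto simp: bij_betw_def dest: inj_onD)
    then show False using S.coset_join1[OF _ _ Z.subgroup_axioms, of "upper 1"] up_Z by (simp add: S_carrier)
  qed
  ultimately show ?thesis by blast
qed

section \<open>From SL(2, q) to the group G\<close>

lemma BijGroup_mult_apply:
  "s \<in> Bij B \<Longrightarrow> t \<in> Bij B \<Longrightarrow> b \<in> B \<Longrightarrow> (s \<otimes>\<^bsub>BijGroup B\<^esub> t) b = s (t b)"
  by (simp add: BijGroup_def compose_def)

lemma BijGroup_carrier: "carrier (BijGroup B) = Bij B"
  by (simp add: BijGroup_def)

lemma BijGroup_one_apply: "b \<in> B \<Longrightarrow> \<one>\<^bsub>BijGroup B\<^esub> b = b"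
  by (simp add: BijGroup_def)

lemma BijGroup_inverse:
  assumes "s \<in> Bij B" shows "inv\<^bsub>BijGroup B\<^esub> s \<in> Bij B"
    and "b \<in> B \<Longrightarrow> (inv\<^bsub>BijGroup B\<^esub> s) (s b) = b" "b \<in> B \<Longrightarrow> s ((inv\<^bsub>BijGroup B\<^esub> s) b) = b"
proof -
  interpret Bij: Group.group "BijGroup B" by (rule group_BijGroup)
  have sB: "s \<in> carrier (BijGroup B)" using assms by (simp add: BijGroup_carrier BijGroup_one_apply)
  show i: "inv\<^bsub>BijGroup B\<^esub> s \<in> Bij B" using Bij.inv_closed[OF sB] by (simp add: BijGroup_carrier BijGroup_one_apply)
  show "(inv\<^bsub>BijGroup B\<^esub> s) (s b) = b" if "b \<in> B"
    using fun_cong[OF Bij.l_inv[OF sB], of b] BijGroup_mult_apply[OF i assms that] that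
    by (simp add: BijGroup_carrier BijGroup_one_apply)
  show "s ((inv\<^bsub>BijGroup B\<^esub> s) b) = b" if "b \<in> B"
    using fun_cong[OF Bij.r_inv[OF sB], of b] BijGroup_mult_apply[OF assms i that] that
    by (simp add: BijGroup_carrier BijGroup_one_apply)
qed

text \<open>The two forms of the heart have different types, so both enter through a map
  \<open>cls\<close> presenting them by integer functions. The image of SL(2, q) lies in G, so a
  subalgebra normal under G is normal under this image; in this way the result for H passes to every
  larger G.\<close>

lemma central_simple_module_presented:
  fixes V :: "(int, 'v, 'n) module_scheme" and B :: "'b set"
  assumes l: "prime l" "CARD('k::{field,finite}) = l ^ r" and big: "CARD('k) > 11"
    and B: "finite B" "card B = CARD('k) + 1"
    and G: "subgroup G (BijGroup B)" and H: "subgroup H ((BijGroup B)\<lparr>carrier := G\<rparr>)"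
    and iso: "(BijGroup B)\<lparr>carrier := H\<rparr> \<cong> (PSL2 :: ('k^2^2) set monoid)"
    and p: "prime p" "odd p"
    and V: "Module.module (residue_ring (int p)) V"
    and cls_closed: "\<And>f. int p dvd sum f B \<Longrightarrow> cls f \<in> carrier V"
    and cls_surj: "\<And>v. v \<in> carrier V \<Longrightarrow> \<exists>f. int p dvd sum f B \<and> v = cls f"
    and cls_add: "\<And>f g. int p dvd sum f B \<Longrightarrow> int p dvd sum g B \<Longrightarrow> cls (\<lambda>b. f b + g b) = cls f \<oplus>\<^bsub>V\<^esub> cls g"
    and cls_smult: "\<And>f c. int p dvd sum f B \<Longrightarrow> c \<in> {0..int p - 1} \<Longrightarrow> cls (\<lambda>b. c * f b) = c \<odot>\<^bsub>V\<^esub> cls f"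
    and cls_zero: "\<And>f. int p dvd sum f B \<Longrightarrow> cls f = \<zero>\<^bsub>V\<^esub> \<longleftrightarrow> (\<forall>b\<in>B. \<forall>b'\<in>B. int p dvd f b - f b')"
    and cls_restrict: "\<And>f g. (\<And>b. b \<in> B \<Longrightarrow> f b = g b) \<Longrightarrow> cls f = cls g"
    and \<rho>_ext: "\<And>s. s \<in> Bij B \<Longrightarrow> \<rho> s \<in> extensional (carrier V)"
    and \<rho>_cls: "\<And>s f. s \<in> Bij B \<Longrightarrow> int p dvd sum f B \<Longrightarrow>
        \<rho> s (cls f) = cls (\<lambda>b. f ((inv\<^bsub>BijGroup B\<^esub> s) b))"
  shows "central_simple_module (residue_ring (int p)) V ((BijGroup B)\<lparr>carrier := G\<rparr>) \<rho>"
proof -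
  let ?F = "residue_ring (int p)" and ?E = "End_alg (residue_ring (int p)) V"
  interpret P: residues_prime p "residue_ring (int p)" by (unfold_locales) (rule p(1))
  have fieldF: "field ?F" by (rule P.is_field)
  interpret VS: vector_space_over ?F V
    by (intro vector_space_over.intro fieldF V)
  interpret Bij: Group.group "BijGroup B" by (rule group_BijGroup)
  have GB: "s \<in> Bij B" if "s \<in> G" for s
    using subgroup.subset[OF G] that by (auto simp: BijGroup_carrier)
  have dvd_act: "int p dvd (\<Sum>b\<in>B. f ((inv\<^bsub>BijGroup B\<^esub> s) b))" if "s \<in> Bij B" "int p dvd sum f B" for s f
  proof -
    have "bij_betw (inv\<^bsub>BijGroup B\<^esub> s) B B" using BijGroup_inverse(1)[OF that(1)] by (simp add: Bij_def)
    then show ?thesis using that(2) sum.reindex_bij_betw[of _ B B f] by metis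
  qed
  have \<rho>_closed: "\<rho> s \<in> carrier ?E" if s: "s \<in> Bij B" for s
  proof (rule End_algI)
    have "\<rho> s v \<in> carrier V" if "v \<in> carrier V" for v
      using cls_surj[OF that] \<rho>_cls[OF s] cls_closed dvd_act[OF s] by auto
    then show "\<rho> s \<in> carrier V \<rightarrow>\<^sub>E carrier V" using \<rho>_ext[OF s] by (simp add: PiE_def)
  next
    fix x y assume "x \<in> carrier V" "y \<in> carrier V"
    then obtain f g where f: "int p dvd sum f B" "x = cls f" and g: "int p dvd sum g B" "y = cls g"
      using cls_surj by blast
    have fg: "int p dvd (\<Sum>b\<in>B. f b + g b)" using f g by (simp add: sum.distrib)
    show "\<rho> s (x \<oplus>\<^bsub>V\<^esub> y) = \<rho> s x \<oplus>\<^bsub>V\<^esub> \<rho> s y"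
      unfolding f(2) g(2) cls_add[OF f(1) g(1), symmetric] \<rho>_cls[OF s fg] \<rho>_cls[OF s f(1)] \<rho>_cls[OF s g(1)]
      by (rule cls_add[OF dvd_act[OF s f(1)] dvd_act[OF s g(1)]])
  next
    fix c x assume c: "c \<in> carrier ?F" and "x \<in> carrier V"
    then obtain f where f: "int p dvd sum f B" "x = cls f" using cls_surj by blast
    have c': "c \<in> {0..int p - 1}" using c by (simp add: residue_ring_def)
    have cf: "int p dvd (\<Sum>b\<in>B. c * f b)" using f by (simp flip: sum_distrib_left)
    show "\<rho> s (c \<odot>\<^bsub>V\<^esub> x) = c \<odot>\<^bsub>V\<^esub> \<rho> s x"
      unfolding f(2) cls_smult[OF f(1) c', symmetric] \<rho>_cls[OF s cf] \<rho>_cls[OF s f(1)]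
      by (rule cls_smult[OF dvd_act[OF s f(1)] c'])
  qed
  have \<rho>_eqI: "u = w" if "u \<in> carrier ?E" "w \<in> carrier ?E" "\<And>f. int p dvd sum f B \<Longrightarrow> u (cls f) = w (cls f)" for u w
    using that cls_surj by (intro End_alg_eqI[of _ ?F V]) blast+
  have \<rho>_one: "\<rho> \<one>\<^bsub>BijGroup B\<^esub> = \<one>\<^bsub>?E\<^esub>"
  proof (rule \<rho>_eqI)
    have oB: "\<one>\<^bsub>BijGroup B\<^esub> \<in> Bij B" using Bij.one_closed by (simp add: BijGroup_carrier BijGroup_one_apply)
    show "\<rho> \<one>\<^bsub>BijGroup B\<^esub> \<in> carrier ?E" by (rule \<rho>_closed[OF oB])
    show "\<one>\<^bsub>?E\<^esub> \<in> carrier ?E" by (rule VS.one_closed)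
    fix f assume f: "int p dvd sum f B"
    have "\<rho> \<one>\<^bsub>BijGroup B\<^esub> (cls f) = cls f"
      unfolding \<rho>_cls[OF oB f] Bij.inv_one by (rule cls_restrict) (simp add: BijGroup_carrier BijGroup_one_apply)
    then show "\<rho> \<one>\<^bsub>BijGroup B\<^esub> (cls f) = \<one>\<^bsub>?E\<^esub> (cls f)" using cls_closed[OF f] by (simp add: End_alg_apply)
  qed
  have \<rho>_mult: "\<rho> (s \<otimes>\<^bsub>BijGroup B\<^esub> t) = \<rho> s \<otimes>\<^bsub>?E\<^esub> \<rho> t" if s: "s \<in> Bij B" and t: "t \<in> Bij B" for s t
  proof (rule \<rho>_eqI)
    have sB: "s \<in> carrier (BijGroup B)" and tB: "t \<in> carrier (BijGroup B)" using s t by (simp_all add: BijGroup_carrier)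
    have st: "s \<otimes>\<^bsub>BijGroup B\<^esub> t \<in> Bij B" using Bij.m_closed[OF sB tB] by (simp add: BijGroup_carrier BijGroup_one_apply)
    show "\<rho> (s \<otimes>\<^bsub>BijGroup B\<^esub> t) \<in> carrier ?E" by (rule \<rho>_closed[OF st])
    show "\<rho> s \<otimes>\<^bsub>?E\<^esub> \<rho> t \<in> carrier ?E" by (rule VS.mult_closed[OF \<rho>_closed[OF s] \<rho>_closed[OF t]])
    fix f assume f: "int p dvd sum f B"
    have "\<rho> (s \<otimes>\<^bsub>BijGroup B\<^esub> t) (cls f) = cls (\<lambda>b. f ((inv\<^bsub>BijGroup B\<^esub> t) ((inv\<^bsub>BijGroup B\<^esub> s) b)))"
      unfolding \<rho>_cls[OF st f] Bij.inv_mult_group[OF sB tB]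
      by (rule cls_restrict)
        (simp only: BijGroup_mult_apply[OF BijGroup_inverse(1)[OF t] BijGroup_inverse(1)[OF s]])
    also have "\<dots> = \<rho> s (\<rho> t (cls f))" unfolding \<rho>_cls[OF t f] \<rho>_cls[OF s dvd_act[OF t f]] ..
    finally show "\<rho> (s \<otimes>\<^bsub>BijGroup B\<^esub> t) (cls f) = (\<rho> s \<otimes>\<^bsub>?E\<^esub> \<rho> t) (cls f)"
      using cls_closed[OF f] by (simp add: End_alg_apply)
  qed
  have \<rho>_inv: "\<rho> s \<otimes>\<^bsub>?E\<^esub> \<rho> (inv\<^bsub>BijGroup B\<^esub> s) = \<one>\<^bsub>?E\<^esub>" "\<rho> (inv\<^bsub>BijGroup B\<^esub> s) \<otimes>\<^bsub>?E\<^esub> \<rho> s = \<one>\<^bsub>?E\<^esub>"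
    if s: "s \<in> Bij B" for s
  proof -
    have sB: "s \<in> carrier (BijGroup B)" using s by (simp add: BijGroup_carrier BijGroup_one_apply)
    show "\<rho> s \<otimes>\<^bsub>?E\<^esub> \<rho> (inv\<^bsub>BijGroup B\<^esub> s) = \<one>\<^bsub>?E\<^esub>"
      using \<rho>_mult[OF s BijGroup_inverse(1)[OF s]] \<rho>_one Bij.r_inv[OF sB] by simp
    show "\<rho> (inv\<^bsub>BijGroup B\<^esub> s) \<otimes>\<^bsub>?E\<^esub> \<rho> s = \<one>\<^bsub>?E\<^esub>"
      using \<rho>_mult[OF BijGroup_inverse(1)[OF s] s] \<rho>_one Bij.l_inv[OF sB] by simp
  qed
  have \<rho>_Units: "\<rho> s \<in> Units ?E" if s: "s \<in> Bij B" for s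
    unfolding Units_def using \<rho>_closed[OF s] \<rho>_closed[OF BijGroup_inverse(1)[OF s]] \<rho>_inv[OF s] by blast
  have inv_\<rho>: "inv\<^bsub>?E\<^esub> (\<rho> s) = \<rho> (inv\<^bsub>BijGroup B\<^esub> s)" if s: "s \<in> Bij B" for s
    by (rule VS.E.inv_unique'[symmetric, OF \<rho>_closed[OF s] \<rho>_closed[OF BijGroup_inverse(1)[OF s]] \<rho>_inv[OF s]])
  have rep: "linear_rep ?F V ((BijGroup B)\<lparr>carrier := G\<rparr>) \<rho>"
    unfolding linear_rep_def
  proof (intro conjI fieldF V Bij.subgroup_imp_group[OF G])
    show "\<rho> \<in> hom ((BijGroup B)\<lparr>carrier := G\<rparr>) (units_of ?E)"
      using \<rho>_Units \<rho>_mult GB by (auto simp: hom_def units_of_def)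
  qed
  obtain \<tau> :: "'k^2^2 \<Rightarrow> 'b \<Rightarrow> 'b" where \<tau>: "\<And>A. det A = 1 \<Longrightarrow> \<tau> A \<in> G"
      "\<And>A C. det A = 1 \<Longrightarrow> det C = 1 \<Longrightarrow> \<tau> (A ** C) = \<tau> A \<otimes>\<^bsub>BijGroup B\<^esub> \<tau> C"
      "\<tau> (mat 1) = \<one>\<^bsub>BijGroup B\<^esub>" "\<tau> neg_one = \<one>\<^bsub>BijGroup B\<^esub>" "\<tau> (upper 1) \<noteq> \<one>\<^bsub>BijGroup B\<^esub>"
    using ex_SL2_hom[OF G H iso] by blast
  have \<tau>B: "\<tau> A \<in> Bij B" if "det A = 1" for A using \<tau>(1) GB that by blast
  interpret act: SL2_action \<tau> B
  proof
    show "\<tau> A b \<in> B" if "det A = 1" "b \<in> B" for A b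
      using \<tau>B[OF that(1)] that(2) by (auto simp: Bij_def bij_betw_def)
    show "\<tau> (A ** C) b = \<tau> A (\<tau> C b)" if "det A = 1" "det C = 1" "b \<in> B" for A C b
      unfolding \<tau>(2)[OF that(1,2)]
      by (rule BijGroup_mult_apply[OF \<tau>B[OF that(1)] \<tau>B[OF that(2)] that(3)])
    show "\<tau> (mat 1) b = b" "\<tau> neg_one b = b" if "b \<in> B" for b
      using that by (simp_all add: \<tau>(3,4) BijGroup_one_apply)
  qed (rule B(1))
  \<comment> \<open>Elements of \<open>Bij B\<close> are extensional, so one that fixes every point
    of B is the identity.\<close>
  have "\<exists>b\<in>B. \<tau> (upper 1) b \<noteq> b"
  proof (rule ccontr)
    assume neg: "\<not> ?thesis"
    have "\<tau> (upper 1) = \<one>\<^bsub>BijGroup B\<^esub>"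
    proof (rule extensionalityI[of _ B])
      show "\<tau> (upper 1) \<in> extensional B" using \<tau>B[of "upper 1"] by (simp add: Bij_def)
    qed (use neg in \<open>auto simp: BijGroup_def\<close>)
    then show False using \<tau>(5) by simp
  qed
  then obtain b1 where b1: "b1 \<in> B" "\<tau> (upper 1) b1 \<noteq> b1" by blast
  obtain pinf pt where "SL2_projective_action \<tau> B pinf pt"
    using act.ex_projective_coordinates[OF l big B(2) b1(1) det_SL2(1) b1(2)] by blast
  then interpret proj: SL2_projective_action \<tau> B pinf pt .
  have \<tau>_inv: "inv\<^bsub>BijGroup B\<^esub> (\<tau> A) = \<tau> (adj A)" if A: "det A = 1" for A
  proof (rule Bij.inv_equality)
    show "\<tau> (adj A) \<otimes>\<^bsub>BijGroup B\<^esub> \<tau> A = \<one>\<^bsub>BijGroup B\<^esub>"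
      using \<tau>(2)[of "adj A" A] A \<tau>(3) by (simp add: adj_inverse)
    show "\<tau> A \<in> carrier (BijGroup B)" "\<tau> (adj A) \<in> carrier (BijGroup B)"
      using \<tau>B A by (simp_all add: BijGroup_carrier)
  qed
  interpret heart: heart_presentation \<tau> B pinf pt p V cls "\<lambda>A. \<rho> (\<tau> A)" l r
  proof (intro heart_presentation.intro heart_presentation_axioms.intro)
    show "\<rho> (\<tau> A) (cls f) = cls (\<lambda>b. f (\<tau> (adj A) b))" if "det A = 1" "int p dvd sum f B" for A f
      using \<rho>_cls[OF \<tau>B[OF that(1)] that(2)] \<tau>_inv[OF that(1)] by simp
  qed (fact proj.SL2_projective_action_axioms VS.vector_space_over_axioms p l big cls_closed cls_surj cls_add
      cls_smult cls_zero | rule \<rho>_closed[OF \<tau>B], assumption)+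
  show ?thesis unfolding central_simple_module_def
  proof (intro conjI rep allI impI)
    fix R assume "G_normal_subalgebra ?F V ((BijGroup B)\<lparr>carrier := G\<rparr>) \<rho> R"
    then have R: "subring R ?E" "submodule R ?F ?E"
      "\<And>g u. g \<in> G \<Longrightarrow> u \<in> R \<Longrightarrow> \<rho> g \<otimes>\<^bsub>?E\<^esub> u \<otimes>\<^bsub>?E\<^esub> inv\<^bsub>?E\<^esub> (\<rho> g) \<in> R"
      by (auto simp: G_normal_subalgebra_def)
    show "central_simple_algebra ?F (?E\<lparr>carrier := R\<rparr>)"
    proof (rule heart.normal_subalgebra_central_simple[OF R(1)])
      show "c \<odot>\<^bsub>?E\<^esub> u \<in> R" if "c \<in> carrier ?F" "u \<in> R" for c u
        by (rule submodule.smult_closed[OF R(2) that])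
      show "\<rho> (\<tau> A) \<otimes>\<^bsub>?E\<^esub> u \<otimes>\<^bsub>?E\<^esub> \<rho> (\<tau> (adj A)) \<in> R" if A: "det A = 1" and u: "u \<in> R" for A u
        using R(3)[OF \<tau>(1)[OF A] u] inv_\<rho>[OF \<tau>B[OF A]] \<tau>_inv[OF A] by simp
    qed
  qed
qed

section \<open>Permutation modules modulo a prime\<close>

context vector_space_over begin

lemma module_quot:
  assumes W: "subspace W"
  shows "Module.module F (quot_module V W)"
    and "\<And>x. x \<in> carrier V \<Longrightarrow> W +>\<^bsub>V\<^esub> x \<in> carrier (quot_module V W)"
    and "\<And>X. X \<in> carrier (quot_module V W) \<Longrightarrow> \<exists>x\<in>carrier V. X = W +>\<^bsub>V\<^esub> x"
    and "\<And>x y. x \<in> carrier V \<Longrightarrow> y \<in> carrier V \<Longrightarrow>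
      (W +>\<^bsub>V\<^esub> x) \<oplus>\<^bsub>quot_module V W\<^esub> (W +>\<^bsub>V\<^esub> y) = W +>\<^bsub>V\<^esub> (x \<oplus>\<^bsub>V\<^esub> y)"
    and "\<And>c x. c \<in> carrier F \<Longrightarrow> x \<in> carrier V \<Longrightarrow>
      c \<odot>\<^bsub>quot_module V W\<^esub> (W +>\<^bsub>V\<^esub> x) = W +>\<^bsub>V\<^esub> (c \<odot>\<^bsub>V\<^esub> x)"
    and "\<And>x. x \<in> carrier V \<Longrightarrow> W +>\<^bsub>V\<^esub> x = \<zero>\<^bsub>quot_module V W\<^esub> \<longleftrightarrow> x \<in> W"
proof -
  let ?Q = "quot_module V W"
  have WV: "W \<subseteq> carrier V" using W by (simp add: subspace_def)
  have sub: "subgroup W (add_monoid V)"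
  proof (rule group.subgroupI[OF V.a_group])
    show "W \<noteq> {}" using W by (auto simp: subspace_def)
    show "inv\<^bsub>add_monoid V\<^esub> x \<in> W" if "x \<in> W" for x
      using subspace_minus[OF W that] by (simp add: a_inv_def)
  qed (use W in \<open>auto simp: subspace_def\<close>)
  interpret S: abelian_subgroup W V
    by (rule abelian_subgroupI2[OF V.a_comm_group sub])
  show in_Q: "W +>\<^bsub>V\<^esub> x \<in> carrier ?Q" if "x \<in> carrier V" for x
    using V.a_rcosetsI[OF WV that] by (simp add: quot_module_def)
  show ex_Q: "\<exists>x\<in>carrier V. X = W +>\<^bsub>V\<^esub> x" if "X \<in> carrier ?Q" for X
    using that by (auto simp: quot_module_def A_RCOSETS_def')
  show add_Q: "(W +>\<^bsub>V\<^esub> x) \<oplus>\<^bsub>?Q\<^esub> (W +>\<^bsub>V\<^esub> y) = W +>\<^bsub>V\<^esub> (x \<oplus>\<^bsub>V\<^esub> y)"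
    if "x \<in> carrier V" "y \<in> carrier V" for x y
    using S.a_rcos_sum[OF that] by (simp add: quot_module_def)
  have shift: "W +>\<^bsub>V\<^esub> (w \<oplus>\<^bsub>V\<^esub> x) = W +>\<^bsub>V\<^esub> x" if w: "w \<in> W" and x: "x \<in> carrier V" for w x
  proof -
    have "w \<oplus>\<^bsub>V\<^esub> x \<in> W +>\<^bsub>V\<^esub> x" using w by (auto simp: a_r_coset_def')
    then show ?thesis using V.a_repr_independence[OF _ x sub] by simp
  qed
  \<comment> \<open>The union that defines the scalar multiple consists of equal cosets, one for
    each representative.\<close>
  show smult_Q: "c \<odot>\<^bsub>?Q\<^esub> (W +>\<^bsub>V\<^esub> x) = W +>\<^bsub>V\<^esub> (c \<odot>\<^bsub>V\<^esub> x)"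
    if c: "c \<in> carrier F" and x: "x \<in> carrier V" for c x
  proof -
    have "W +>\<^bsub>V\<^esub> (c \<odot>\<^bsub>V\<^esub> y) = W +>\<^bsub>V\<^esub> (c \<odot>\<^bsub>V\<^esub> x)" if y: "y \<in> W +>\<^bsub>V\<^esub> x" for y
    proof -
      obtain w where w: "w \<in> W" "y = w \<oplus>\<^bsub>V\<^esub> x" using y by (auto simp: a_r_coset_def')
      then have "c \<odot>\<^bsub>V\<^esub> y = c \<odot>\<^bsub>V\<^esub> w \<oplus>\<^bsub>V\<^esub> c \<odot>\<^bsub>V\<^esub> x" using WV c x by (auto simp: V.smult_r_distr)
      moreover have "c \<odot>\<^bsub>V\<^esub> w \<in> W" using W w c by (simp add: subspace_def)
      ultimately show ?thesis using shift c x by simp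
    qed
    moreover have "\<zero>\<^bsub>V\<^esub> \<oplus>\<^bsub>V\<^esub> x \<in> W +>\<^bsub>V\<^esub> x"
      using W unfolding a_r_coset_def' subspace_def by blast
    ultimately have "(\<Union>y\<in>W +>\<^bsub>V\<^esub> x. W +>\<^bsub>V\<^esub> (c \<odot>\<^bsub>V\<^esub> y)) = W +>\<^bsub>V\<^esub> (c \<odot>\<^bsub>V\<^esub> x)" by blast
    then show ?thesis by (simp add: quot_module_def)
  qed
  have zero_Q: "\<zero>\<^bsub>?Q\<^esub> = W" by (simp add: quot_module_def)
  show "W +>\<^bsub>V\<^esub> x = \<zero>\<^bsub>?Q\<^esub> \<longleftrightarrow> x \<in> W" if "x \<in> carrier V" for x
    unfolding zero_Q using V.a_coset_join1[OF _ that sub] V.a_coset_join2[OF that sub] by blast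
  have W0: "W = W +>\<^bsub>V\<^esub> \<zero>\<^bsub>V\<^esub>" using V.a_coset_join2[OF V.zero_closed sub] W by (simp add: subspace_def)
  have "abelian_group ?Q"
  proof (rule abelian_groupI)
    fix X Y Z assume "X \<in> carrier ?Q" "Y \<in> carrier ?Q" "Z \<in> carrier ?Q"
    then obtain x y z where xyz: "x \<in> carrier V" "X = W +>\<^bsub>V\<^esub> x" "y \<in> carrier V" "Y = W +>\<^bsub>V\<^esub> y"
      "z \<in> carrier V" "Z = W +>\<^bsub>V\<^esub> z" using ex_Q by metis
    then show "X \<oplus>\<^bsub>?Q\<^esub> Y \<oplus>\<^bsub>?Q\<^esub> Z = X \<oplus>\<^bsub>?Q\<^esub> (Y \<oplus>\<^bsub>?Q\<^esub> Z)" by (simp add: add_Q V.a_assoc)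
  next
    fix X Y assume "X \<in> carrier ?Q" "Y \<in> carrier ?Q"
    then obtain x y where xy: "x \<in> carrier V" "X = W +>\<^bsub>V\<^esub> x" "y \<in> carrier V" "Y = W +>\<^bsub>V\<^esub> y"
      using ex_Q by metis
    then show "X \<oplus>\<^bsub>?Q\<^esub> Y = Y \<oplus>\<^bsub>?Q\<^esub> X" "X \<oplus>\<^bsub>?Q\<^esub> Y \<in> carrier ?Q"
      by (simp_all add: add_Q V.a_comm in_Q)
  next
    show "\<zero>\<^bsub>?Q\<^esub> \<in> carrier ?Q" unfolding zero_Q by (subst W0) (simp add: in_Q)
    fix X assume "X \<in> carrier ?Q"
    then obtain x where x: "x \<in> carrier V" "X = W +>\<^bsub>V\<^esub> x" using ex_Q by blast
    show "\<zero>\<^bsub>?Q\<^esub> \<oplus>\<^bsub>?Q\<^esub> X = X" unfolding zero_Q x(2) by (subst (1) W0) (simp add: add_Q x(1))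
    have "(W +>\<^bsub>V\<^esub> \<ominus>\<^bsub>V\<^esub> x) \<oplus>\<^bsub>?Q\<^esub> X = \<zero>\<^bsub>?Q\<^esub>"
      unfolding zero_Q x(2) using x(1) W0 by (simp add: add_Q V.l_neg)
    then show "\<exists>Y\<in>carrier ?Q. Y \<oplus>\<^bsub>?Q\<^esub> X = \<zero>\<^bsub>?Q\<^esub>" using in_Q x(1) V.a_inv_closed by blast
  qed
  then show "Module.module F ?Q"
  proof (rule moduleI[OF F.cring_axioms])
    fix c d X assume "c \<in> carrier F" "d \<in> carrier F" "X \<in> carrier ?Q"
    then obtain x where x: "x \<in> carrier V" "X = W +>\<^bsub>V\<^esub> x" "c \<in> carrier F" "d \<in> carrier F" using ex_Q by blast
    then show "(c \<oplus>\<^bsub>F\<^esub> d) \<odot>\<^bsub>?Q\<^esub> X = c \<odot>\<^bsub>?Q\<^esub> X \<oplus>\<^bsub>?Q\<^esub> d \<odot>\<^bsub>?Q\<^esub> X"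
      "(c \<otimes>\<^bsub>F\<^esub> d) \<odot>\<^bsub>?Q\<^esub> X = c \<odot>\<^bsub>?Q\<^esub> (d \<odot>\<^bsub>?Q\<^esub> X)"
      by (simp_all add: smult_Q add_Q V.smult_l_distr V.smult_assoc1)
  next
    fix c X Y assume c: "c \<in> carrier F" and "X \<in> carrier ?Q" "Y \<in> carrier ?Q"
    then obtain x y where "x \<in> carrier V" "X = W +>\<^bsub>V\<^esub> x" "y \<in> carrier V" "Y = W +>\<^bsub>V\<^esub> y" using ex_Q by metis
    then show "c \<odot>\<^bsub>?Q\<^esub> (X \<oplus>\<^bsub>?Q\<^esub> Y) = c \<odot>\<^bsub>?Q\<^esub> X \<oplus>\<^bsub>?Q\<^esub> c \<odot>\<^bsub>?Q\<^esub> Y"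
      using c by (simp add: smult_Q add_Q V.smult_r_distr)
  next
    fix c X assume c: "c \<in> carrier F" and "X \<in> carrier ?Q"
    then obtain x where x: "x \<in> carrier V" "X = W +>\<^bsub>V\<^esub> x" using ex_Q by blast
    then show "c \<odot>\<^bsub>?Q\<^esub> X \<in> carrier ?Q" using c by (simp add: smult_Q in_Q)
  next
    fix X assume "X \<in> carrier ?Q"
    then obtain x where x: "x \<in> carrier V" "X = W +>\<^bsub>V\<^esub> x" using ex_Q by blast
    then show "\<one>\<^bsub>F\<^esub> \<odot>\<^bsub>?Q\<^esub> X = X" by (simp add: smult_Q)
  qed
qed

end

section \<open>The zero-sum module and the heart modulo p\<close>

locale residue_zero_sum =
  fixes p :: nat and B :: "'b set"
  assumes prime_p: "prime p" and finite_B: "finite B"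
begin

sublocale P: residues_prime p "residue_ring (int p)"
  by unfold_locales (rule prime_p)

abbreviation F where "F \<equiv> residue_ring (int p)"
abbreviation V where "V \<equiv> zero_sum_module F B"

lemma F_simps: "carrier F = {0..int p - 1}" "x \<oplus>\<^bsub>F\<^esub> y = (x + y) mod int p"
    "x \<otimes>\<^bsub>F\<^esub> y = (x * y) mod int p" "\<zero>\<^bsub>F\<^esub> = 0" "\<one>\<^bsub>F\<^esub> = 1"
  by (simp_all add: residue_ring_def)

lemma p_gt_1: "int p > 1"
  using prime_gt_1_nat[OF P.p_prime] by simp

lemma mod_F: "c mod int p \<in> {0..int p - 1}"
  using p_gt_1 pos_mod_bound[of "int p" c] by simp

lemma F_mod: "c \<in> {0..int p - 1} \<Longrightarrow> c mod int p = c"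
  by simp

lemma finsum_F:
  assumes "finite S" "h \<in> S \<rightarrow> carrier F" shows "finsum F h S = sum h S mod int p"
  using assms
proof (induction S rule: finite_induct)
  case empty
  then show ?case by (simp add: F_simps)
next
  case (insert x S)
  have "finsum F h (insert x S) = h x \<oplus>\<^bsub>F\<^esub> finsum F h S"
    using insert by (intro P.finsum_insert) auto
  then show ?case using insert by (simp add: F_simps mod_simps)
qed

lemma V_carrier: "carrier V = {h \<in> B \<rightarrow>\<^sub>E {0..int p - 1}. int p dvd sum h B}"
proof -
  have "finsum F h B = 0 \<longleftrightarrow> int p dvd sum h B" if "h \<in> B \<rightarrow>\<^sub>E {0..int p - 1}" for h
  proof -
    have "h \<in> B \<rightarrow> carrier F" using that by (auto simp: F_simps)
    then show ?thesis by (simp add: finsum_F finite_B mod_eq_0_iff_dvd)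
  qed
  then show ?thesis by (auto simp: zero_sum_module_def perm_module_def F_simps)
qed

lemma V_ops: "x \<oplus>\<^bsub>V\<^esub> y = (\<lambda>b\<in>B. (x b + y b) mod int p)" "c \<odot>\<^bsub>V\<^esub> x = (\<lambda>b\<in>B. (c * x b) mod int p)"
    "\<zero>\<^bsub>V\<^esub> = (\<lambda>b\<in>B. 0)"
  by (simp_all add: zero_sum_module_def perm_module_def F_simps)

text \<open>This is the presentation \<open>cls\<close> of the zero-sum module; for the heart it is
  followed by the coset map of the constants.\<close>

definition red :: "('b \<Rightarrow> int) \<Rightarrow> 'b \<Rightarrow> int" where "red f = (\<lambda>b\<in>B. f b mod int p)"

lemma red_closed: "int p dvd sum f B \<Longrightarrow> red f \<in> carrier V"
proof -
  assume f: "int p dvd sum f B"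
  have "sum (red f) B = (\<Sum>b\<in>B. f b mod int p)" by (rule sum.cong) (auto simp: red_def)
  then have "sum (red f) B mod int p = sum f B mod int p" by (simp add: mod_sum_eq)
  then have "int p dvd sum (red f) B" using f by (simp add: dvd_eq_mod_eq_0)
  then show ?thesis using mod_F by (auto simp: V_carrier red_def)
qed

lemma red_surj: assumes "v \<in> carrier V" shows "int p dvd sum v B" "v = red v"
  using assms F_mod by (auto simp: V_carrier red_def fun_eq_iff PiE_iff extensional_def)

lemma red_add: "red (\<lambda>b. f b + g b) = red f \<oplus>\<^bsub>V\<^esub> red g"
  by (auto simp: V_ops red_def mod_simps)

lemma red_smult: "red (\<lambda>b. c * f b) = c \<odot>\<^bsub>V\<^esub> red f"
  by (auto simp: V_ops red_def mod_simps)

lemma red_zero: "red (\<lambda>b. 0) = \<zero>\<^bsub>V\<^esub>"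
  by (simp add: V_ops red_def)

lemma red_eq_iff: "red f = red g \<longleftrightarrow> (\<forall>b\<in>B. int p dvd f b - g b)"
  by (auto simp: red_def fun_eq_iff mod_eq_dvd_iff)

lemma module_V: "Module.module F V"
proof (rule moduleI[OF P.cring_axioms])
  show "abelian_group V"
  proof (rule abelian_groupI)
    fix x y assume xy: "x \<in> carrier V" "y \<in> carrier V"
    note r = red_surj[OF xy(1)] red_surj[OF xy(2)]
    have "red (\<lambda>b. x b + y b) \<in> carrier V" using r by (intro red_closed) (simp add: sum.distrib)
    then show "x \<oplus>\<^bsub>V\<^esub> y \<in> carrier V" using r by (simp add: red_add)
    show "x \<oplus>\<^bsub>V\<^esub> y = y \<oplus>\<^bsub>V\<^esub> x" by (simp add: V_ops add.commute)
    fix z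
    show "x \<oplus>\<^bsub>V\<^esub> y \<oplus>\<^bsub>V\<^esub> z = x \<oplus>\<^bsub>V\<^esub> (y \<oplus>\<^bsub>V\<^esub> z)"
      by (auto simp: V_ops mod_simps add.assoc)
  next
    show "\<zero>\<^bsub>V\<^esub> \<in> carrier V" unfolding red_zero[symmetric] by (rule red_closed) simp
    fix x assume x: "x \<in> carrier V"
    note r = red_surj[OF x]
    have "red (\<lambda>b. 0 + x b) = x" using r by simp
    then show "\<zero>\<^bsub>V\<^esub> \<oplus>\<^bsub>V\<^esub> x = x" using r by (simp only: red_add red_zero)
    show "\<exists>y\<in>carrier V. y \<oplus>\<^bsub>V\<^esub> x = \<zero>\<^bsub>V\<^esub>"
    proof
      show "red (\<lambda>b. - x b) \<in> carrier V" using r by (intro red_closed) (simp add: sum_negf)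
      have "red (\<lambda>b. - x b + x b) = \<zero>\<^bsub>V\<^esub>" by (simp add: red_zero)
      then show "red (\<lambda>b. - x b) \<oplus>\<^bsub>V\<^esub> x = \<zero>\<^bsub>V\<^esub>" using r by (simp only: red_add)
    qed
  qed
next
  fix c x assume c: "c \<in> carrier F" and x: "x \<in> carrier V"
  note r = red_surj[OF x]
  have "red (\<lambda>b. c * x b) \<in> carrier V" using r by (intro red_closed) (simp flip: sum_distrib_left)
  then show "c \<odot>\<^bsub>V\<^esub> x \<in> carrier V" using r by (simp only: red_smult)
next
  fix x assume x: "x \<in> carrier V"
  have "red (\<lambda>b. 1 * x b) = x" using red_surj[OF x] by simp
  then show "\<one>\<^bsub>F\<^esub> \<odot>\<^bsub>V\<^esub> x = x" using red_surj[OF x] by (simp only: red_smult F_simps)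
qed (auto simp: V_ops F_simps mod_simps algebra_simps)

sublocale VS: vector_space_over F V
  by (intro vector_space_over.intro P.is_field module_V)

lemma const_maps_eq: "const_maps F B = {red (\<lambda>b. c) |c. True}"
proof -
  have "red (\<lambda>b. c) = (c mod int p) \<odot>\<^bsub>perm_module F B\<^esub> (\<lambda>b\<in>B. \<one>\<^bsub>F\<^esub>)" for c
    by (auto simp: perm_module_def F_simps red_def)
  note red_c = this
  show ?thesis
  proof
    show "const_maps F B \<subseteq> {red (\<lambda>b. c) |c. True}"
    proof
      fix x assume "x \<in> const_maps F B"
      then obtain c where c: "c \<in> carrier F" "x = c \<odot>\<^bsub>perm_module F B\<^esub> (\<lambda>b\<in>B. \<one>\<^bsub>F\<^esub>)"
        unfolding const_maps_def by blast
      then have "x = red (\<lambda>b. c)" using red_c[of c] by (simp add: F_simps)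
      then show "x \<in> {red (\<lambda>b. c) |c. True}" by blast
    qed
    show "{red (\<lambda>b. c) |c. True} \<subseteq> const_maps F B"
      using red_c mod_F unfolding const_maps_def F_simps(1) by blast
  qed
qed

lemma subspace_const:
  assumes "p dvd card B" shows "VS.subspace (const_maps F B)"
  unfolding VS.subspace_def
proof (intro conjI ballI)
  show "const_maps F B \<subseteq> carrier V"
    using assms red_closed by (auto simp: const_maps_eq)
  show "\<zero>\<^bsub>V\<^esub> \<in> const_maps F B" unfolding red_zero[symmetric] const_maps_eq by blast
  show "x \<oplus>\<^bsub>V\<^esub> y \<in> const_maps F B" if "x \<in> const_maps F B" "y \<in> const_maps F B" for x y
    using that red_add[symmetric] by (auto simp: const_maps_eq)
  show "c \<odot>\<^bsub>V\<^esub> x \<in> const_maps F B" if "x \<in> const_maps F B" for c x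
    using that red_smult[symmetric] by (auto simp: const_maps_eq)
qed

lemma red_const_iff:
  assumes "B \<noteq> {}"
  shows "red f \<in> const_maps F B \<longleftrightarrow> (\<forall>b\<in>B. \<forall>b'\<in>B. int p dvd f b - f b')"
proof
  assume "red f \<in> const_maps F B"
  then obtain c where c: "\<forall>b\<in>B. int p dvd f b - c" by (auto simp: const_maps_eq red_eq_iff)
  have "int p dvd (f b - c) - (f b' - c)" if "b \<in> B" "b' \<in> B" for b b'
    by (rule dvd_diff) (use c that in auto)
  then show "\<forall>b\<in>B. \<forall>b'\<in>B. int p dvd f b - f b'" by simp
next
  assume *: "\<forall>b\<in>B. \<forall>b'\<in>B. int p dvd f b - f b'"
  obtain b0 where "b0 \<in> B" using assms by blast
  then have "red f = red (\<lambda>b. f b0)" using * by (simp add: red_eq_iff)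
  then show "red f \<in> const_maps F B" by (auto simp: const_maps_eq)
qed

lemma perm_act_red:
  assumes "s \<in> Bij B" shows "perm_act B s (red f) = red (\<lambda>b. f ((inv\<^bsub>BijGroup B\<^esub> s) b))"
proof -
  have "(inv\<^bsub>BijGroup B\<^esub> s) b \<in> B" if "b \<in> B" for b
    using Bij_imp_funcset[OF BijGroup_inverse(1)[OF assms]] that by blast
  then show ?thesis by (auto simp: perm_act_def red_def)
qed

text \<open>Permutations fix the constant functions.\<close>

lemma perm_act_coset:
  assumes s: "s \<in> Bij B" and p: "p dvd card B" and f: "int p dvd sum f B"
  shows "perm_act B s ` (const_maps F B +>\<^bsub>V\<^esub> red f) =
    const_maps F B +>\<^bsub>V\<^esub> red (\<lambda>b. f ((inv\<^bsub>BijGroup B\<^esub> s) b))"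
proof -
  have "perm_act B s (red (\<lambda>b. c) \<oplus>\<^bsub>V\<^esub> red f) = red (\<lambda>b. c) \<oplus>\<^bsub>V\<^esub> red (\<lambda>b. f ((inv\<^bsub>BijGroup B\<^esub> s) b))" for c
    unfolding red_add[symmetric] perm_act_red[OF s] ..
  then show ?thesis by (auto simp: a_r_coset_def' const_maps_eq image_UN image_iff)
qed

end

theorem theorem4p10:
  fixes B :: "'b set" and G H :: "('b \<Rightarrow> 'b) set" and l r q n p :: nat
  assumes "prime l" and "r > 0" and "q = l ^ r" and "q > 11" and "n = q + 1"
    and "CARD('k::{field,finite}) = q"
    and "finite B" and "card B = n"
    and "subgroup G (BijGroup B)"
    and "subgroup H ((BijGroup B)\<lparr>carrier := G\<rparr>)"
    and "(BijGroup B)\<lparr>carrier := H\<rparr> \<cong> (PSL2 :: ('k^2^2) set monoid)"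
    and "prime p" and "odd p"
  shows "if p dvd n
     then central_simple_module (residue_ring (int p)) (heart_quotient (residue_ring (int p)) B)
            ((BijGroup B)\<lparr>carrier := G\<rparr>) (heart_quotient_act (residue_ring (int p)) B)
     else central_simple_module (residue_ring (int p)) (zero_sum_module (residue_ring (int p)) B)
            ((BijGroup B)\<lparr>carrier := G\<rparr>) (zero_sum_act (residue_ring (int p)) B)"
proof -
  interpret residue_zero_sum p B
    by (intro residue_zero_sum.intro assms)
  have k: "CARD('k) = l ^ r" "CARD('k) > 11" "card B = CARD('k) + 1" using assms by simp_all
  have Bne: "B \<noteq> {}" using k(3) by auto
  note central = central_simple_module_presented[OF assms(1) k(1,2) assms(7) k(3) assms(9-13)]
  have ext: "\<And>f g. (\<And>b. b \<in> B \<Longrightarrow> f b = g b) \<Longrightarrow> red f = red g" by (simp add: red_def cong: restrict_cong)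
  show ?thesis
  proof (cases "p dvd n")
    case False
    have "central_simple_module F V ((BijGroup B)\<lparr>carrier := G\<rparr>) (zero_sum_act F B)"
    proof (rule central[where cls = red, OF module_V])
      fix f assume f: "int p dvd sum f B"
      show "red f = \<zero>\<^bsub>V\<^esub> \<longleftrightarrow> (\<forall>b\<in>B. \<forall>b'\<in>B. int p dvd f b - f b')"
      proof
        assume "red f = \<zero>\<^bsub>V\<^esub>"
        then have "\<forall>b\<in>B. int p dvd f b" by (simp add: red_zero[symmetric] red_eq_iff)
        then show "\<forall>b\<in>B. \<forall>b'\<in>B. int p dvd f b - f b'" by (blast intro: dvd_diff)
      next
        assume *: "\<forall>b\<in>B. \<forall>b'\<in>B. int p dvd f b - f b'"
        have "int p dvd f b" if b: "b \<in> B" for b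
        proof -
          \<comment> \<open>As f has sum zero, the differences add up to n f b modulo p, and p does
            not divide n.\<close>
          have "int p dvd (\<Sum>b'\<in>B. f b - f b')" using * b by (intro dvd_sum) blast
          then have "int p dvd int (card B) * f b - sum f B" by (simp add: sum_subtractf)
          then have "int p dvd int (card B) * f b" using f by (simp add: dvd_diff_left_iff)
          then have "int p dvd int (card B) \<or> int p dvd f b"
            using assms(12) by (simp add: prime_dvd_mult_iff)
          then show ?thesis using False assms(8) by simp
        qed
        then show "red f = \<zero>\<^bsub>V\<^esub>" by (simp add: red_zero[symmetric] red_eq_iff)
      qed
    next
      fix s f assume s: "s \<in> Bij B" and f: "int p dvd sum f B"
      then show "zero_sum_act F B s (red f) = red (\<lambda>b. f ((inv\<^bsub>BijGroup B\<^esub> s) b))"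
        using red_closed[OF f] perm_act_red[OF s] by (simp add: zero_sum_act_def)
    next
      fix v assume "v \<in> carrier V"
      then show "\<exists>f. int p dvd sum f B \<and> v = red f" using red_surj by blast
    next
      fix s show "zero_sum_act F B s \<in> extensional (carrier V)" by (simp add: zero_sum_act_def)
    next
      fix f g :: "'b \<Rightarrow> int" assume "\<And>b. b \<in> B \<Longrightarrow> f b = g b"
      then show "red f = red g" by (rule ext)
    qed (rule red_closed red_add red_smult, assumption?)+
    then show ?thesis using False by simp
  next
    case True
    let ?C = "const_maps F B"
    let ?cls = "\<lambda>f. ?C +>\<^bsub>V\<^esub> red f"
    have pB: "p dvd card B" using True assms(8) by simp
    note Q = VS.module_quot[OF subspace_const[OF pB], folded heart_quotient_def]
    have "central_simple_module F (heart_quotient F B) ((BijGroup B)\<lparr>carrier := G\<rparr>) (heart_quotient_act F B)"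
    proof (rule central[where cls = ?cls, OF Q(1)])
      fix v assume "v \<in> carrier (heart_quotient F B)"
      then obtain x where x: "x \<in> carrier V" "v = ?C +>\<^bsub>V\<^esub> x" using Q(3) by blast
      show "\<exists>f. int p dvd sum f B \<and> v = ?cls f"
        using red_surj[OF x(1)] x(2) by (intro exI[of _ x]) simp
    next
      fix f assume f: "int p dvd sum f B"
      show "?cls f \<in> carrier (heart_quotient F B)" by (rule Q(2)[OF red_closed[OF f]])
      show "?cls f = \<zero>\<^bsub>heart_quotient F B\<^esub> \<longleftrightarrow> (\<forall>b\<in>B. \<forall>b'\<in>B. int p dvd f b - f b')"
        unfolding Q(6)[OF red_closed[OF f]] by (rule red_const_iff[OF Bne])
      show "?cls (\<lambda>b. c * f b) = c \<odot>\<^bsub>heart_quotient F B\<^esub> ?cls f" if "c \<in> {0..int p - 1}" for c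
        using Q(5)[OF _ red_closed[OF f], of c] that by (simp add: F_simps red_smult)
      show "?cls (\<lambda>b. f b + g b) = ?cls f \<oplus>\<^bsub>heart_quotient F B\<^esub> ?cls g" if "int p dvd sum g B" for g
        using Q(4)[OF red_closed[OF f] red_closed[OF that]] by (simp add: red_add)
      show "heart_quotient_act F B s (?cls f) = ?cls (\<lambda>b. f ((inv\<^bsub>BijGroup B\<^esub> s) b))" if "s \<in> Bij B" for s
        using Q(2)[OF red_closed[OF f]] perm_act_coset[OF that pB f] by (simp add: heart_quotient_act_def)
    next
      fix s show "heart_quotient_act F B s \<in> extensional (carrier (heart_quotient F B))"
        by (simp add: heart_quotient_act_def)
    next
      fix f g :: "'b \<Rightarrow> int" assume "\<And>b. b \<in> B \<Longrightarrow> f b = g b"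
      then have "red f = red g" by (rule ext)
      then show "?cls f = ?cls g" by simp
    qed
    then show ?thesis using True by simp
  qed
qed

end
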